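(* Let $s=(s_n)_{n\ge0}$ be a normalized Stieltjes moment sequence which is indet(S), with N-extremal solutions $\mu_t$ and Friedrichs parameter $F(s)$. Then the measures $x\,d\mu_t(x)$, $F(s)\le t\le\infty$, are solutions to the moment problem for the shifted moment sequence $(s_{n+1})_{n\ge0}$. The measure $x\,d\mu_{F(s)}(x)$ is an N-extremal solution, and $x\,d\mu_\infty(x)=x\,d\mu_K(x)$ is the Friedrichs solution of the moment problem for $(s_{n+1})_{n\ge0}$. For $F(s)<t<\infty$ the measures $x\,d\mu_t(x)$ are solutions which are not N-extremal.
   Context: $\mathcal M^*$ denotes the set of positive Borel measures on $\mathbb R$ with infinite support and finite moments of every order. A measure $\mu\in\mathcal M^*$, and its moment sequence $s_n=\int x^n\,d\mu(x)$, $n\ge0$, is determinate if $\mu$ is the only measure in $\mathcal M^*$ with these moments, and indeterminate otherwise. $V=V(s)$ is the set of measures in $\mathcal M^*$ with moment sequence $s$ (the solutions); $s$ is normalized if $s_0=1$. Let $s$ be normalized and indeterminate. Let $p_n$ be the orthonormal polynomials (degree $n$, positive leading coefficient) and $q_n(z)=\int\frac{p_n(z)-p_n(x)}{z-x}d\mu(x)$ ($\mu\in V$) the polynomials of the second kind. Define entire functions $A(z)=z\sum q_n(0)q_n(z)$, $B(z)=-1+z\sum q_n(0)p_n(z)$, $C(z)=1+z\sum p_n(0)q_n(z)$, $D(z)=z\sum p_n(0)p_n(z)$ (sums over $n\ge0$). For $t\in\mathbb R\cup\{\infty\}$ the N-extremal solution $\mu_t\in V$ is determined by $$\int\frac{d\mu_t(x)}{x-z}=-\frac{A(z)+tC(z)}{B(z)+tD(z)},\quad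 z\in\mathbb C\setminus\mathbb R,$$ with right-hand side $-C(z)/D(z)$ for $t=\infty$. An indeterminate measure $\mu$ is N-extremal iff $\mathbb C[x]$ is dense in $L^2(\mu)$ (M. Riesz). An indeterminate $s$ is Stieltjes if some $\mu\in V$ is supported in $[0,\infty)$; it is det(S) if there is exactly one such $\mu\in V$, and indet(S) if there is more than one. For $s$ indeterminate and Stieltjes put $\alpha(s)=\lim_{n\to\infty}p_n(0)/q_n(0)=\lim_{x\to-\infty}D(x)/B(x)\le 0$; $s$ is det(S) iff $\alpha(s)=0$. The Friedrichs parameter is $F(s)=-1/\alpha(s)$ if $\alpha(s)<0$ and $F(s)=\infty$ if $\alpha(s)=0$. The measure $\mu_t$ is supported in $[0,\infty)$ iff $F(s)\le t\le\infty$. The Friedrichs solution is $\mu_F=\mu_{F(s)}$ and the Krein solution is $\mu_K=\mu_\infty$. For non-normalized moment sequences, N-extremal, Friedrichs and Krein solutions are defined by rescaling to total mass 1. *)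

theory Defs
  imports "HOL-Analysis.Analysis" "HOL-Computational_Algebra.Polynomial"
begin

definition msupport :: "real measure \<Rightarrow> real set" where
  "msupport M = {x. \<forall>U. open U \<longrightarrow> x \<in> U \<longrightarrow> emeasure M U > 0}"

definition Mstar :: "real measure set" where
  "Mstar = {M. sets M = sets borel \<and> infinite (msupport M) \<and> (\<forall>n. integrable M (\<lambda>x. x ^ n))}"

definition solutions :: "(nat \<Rightarrow> real) \<Rightarrow> real measure set" where
  "solutions s = {M \<in> Mstar. \<forall>n. (\<integral>x. x ^ n \<partial>M) = s n}"

definition indeterminate :: "(nat \<Rightarrow> real) \<Rightarrow> bool" where
  "indeterminate s \<longleftrightarrow> (\<exists>M\<in>solutions s. solutions s \<noteq> {M})"

definition stieltjes :: "(nat \<Rightarrow> real) \<Rightarrow> bool" where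
  "stieltjes s \<longleftrightarrow> (\<exists>M\<in>solutions s. msupport M \<subseteq> {0..})"

definition indet_S :: "(nat \<Rightarrow> real) \<Rightarrow> bool" where
  "indet_S s \<longleftrightarrow> indeterminate s \<and> stieltjes s \<and>
     (\<exists>M\<in>solutions s. \<exists>N\<in>solutions s. M \<noteq> N \<and> msupport M \<subseteq> {0..} \<and> msupport N \<subseteq> {0..})"

definition cpoly :: "real poly \<Rightarrow> complex \<Rightarrow> complex" where
  "cpoly p z = poly (map_poly complex_of_real p) z"

definition orthonormal_polys :: "real measure \<Rightarrow> nat \<Rightarrow> real poly" where
  "orthonormal_polys M = (THE P.
     (\<forall>n. degree (P n) = n \<and> lead_coeff (P n) > 0) \<and>
     (\<forall>m n. (\<integral>x. poly (P m) x * poly (P n) x \<partial>M) = (if m = n then 1 else 0)))"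

text \<open>
  The integral formula is imposed off the real axis only: there the difference quotient has no
  removable singularity (where Isabelle's division would return 0), and the values off the real
  axis determine the polynomial.
\<close>

definition second_kind_polys :: "real measure \<Rightarrow> nat \<Rightarrow> real poly" where
  "second_kind_polys M n = (THE Q. \<forall>z. Im z \<noteq> 0 \<longrightarrow>
     cpoly Q z = (\<integral>x. (cpoly (orthonormal_polys M n) z
                        - cpoly (orthonormal_polys M n) (complex_of_real x))
                       / (z - complex_of_real x) \<partial>M))"

text \<open>
  Both families of polynomials depend on the measure only through its moments, so any solution
  may be used to define them for a moment sequence.
\<close>

definition pn :: "(nat \<Rightarrow> real) \<Rightarrow> nat \<Rightarrow> real poly" where
  "pn s = orthonormal_polys (SOME M. M \<in> solutions s)"

definition qn :: "(nat \<Rightarrow> real) \<Rightarrow> nat \<Rightarrow> real poly" where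
  "qn s = second_kind_polys (SOME M. M \<in> solutions s)"

definition nev_A :: "(nat \<Rightarrow> real) \<Rightarrow> complex \<Rightarrow> complex" where
  "nev_A s z = z * (\<Sum>n. cpoly (qn s n) 0 * cpoly (qn s n) z)"

definition nev_B :: "(nat \<Rightarrow> real) \<Rightarrow> complex \<Rightarrow> complex" where
  "nev_B s z = - 1 + z * (\<Sum>n. cpoly (qn s n) 0 * cpoly (pn s n) z)"

definition nev_C :: "(nat \<Rightarrow> real) \<Rightarrow> complex \<Rightarrow> complex" where
  "nev_C s z = 1 + z * (\<Sum>n. cpoly (pn s n) 0 * cpoly (qn s n) z)"

definition nev_D :: "(nat \<Rightarrow> real) \<Rightarrow> complex \<Rightarrow> complex" where
  "nev_D s z = z * (\<Sum>n. cpoly (pn s n) 0 * cpoly (pn s n) z)"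

text \<open>
  The parameter set \<open>\<real> \<union> {\<infinity>}\<close> is the type \<^typ>\<open>ereal\<close> without \<open>-\<infinity>\<close>;
  the value of the following functions at \<open>-\<infinity>\<close> is never used.
\<close>

definition nev_quotient :: "(nat \<Rightarrow> real) \<Rightarrow> ereal \<Rightarrow> complex \<Rightarrow> complex" where
  "nev_quotient s t z =
     (case t of
        ereal r \<Rightarrow> - ((nev_A s z + of_real r * nev_C s z) / (nev_B s z + of_real r * nev_D s z))
      | _ \<Rightarrow> - (nev_C s z / nev_D s z))"

definition mu :: "(nat \<Rightarrow> real) \<Rightarrow> ereal \<Rightarrow> real measure" where
  "mu s t = (THE M. M \<in> solutions s \<and>
     (\<forall>z. Im z \<noteq> 0 \<longrightarrow> (\<integral>x. 1 / (complex_of_real x - z) \<partial>M) = nev_quotient s t z))"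

definition alpha :: "(nat \<Rightarrow> real) \<Rightarrow> real" where
  "alpha s = lim (\<lambda>n. poly (pn s n) 0 / poly (qn s n) 0)"

definition friedrichs_param :: "(nat \<Rightarrow> real) \<Rightarrow> ereal" where
  "friedrichs_param s = (if alpha s < 0 then ereal (- 1 / alpha s) else \<infinity>)"

text \<open>
  The functions \<^const>\<open>mu\<close> and \<^const>\<open>friedrichs_param\<close> are meant for normalized sequences.
  The three notions below cover arbitrary total mass \<open>s 0 > 0\<close>, by rescaling to mass 1.
\<close>

definition normalize_seq :: "(nat \<Rightarrow> real) \<Rightarrow> nat \<Rightarrow> real" where
  "normalize_seq s n = s n / s 0"

definition N_extremal_solution :: "(nat \<Rightarrow> real) \<Rightarrow> real measure \<Rightarrow> bool" where
  "N_extremal_solution s M \<longleftrightarrow> indeterminate s \<and>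
     (\<exists>t. t \<noteq> -\<infinity> \<and> M = scale_measure (ennreal (s 0)) (mu (normalize_seq s) t))"

definition friedrichs_solution :: "(nat \<Rightarrow> real) \<Rightarrow> real measure \<Rightarrow> bool" where
  "friedrichs_solution s M \<longleftrightarrow> indeterminate s \<and> stieltjes s \<and>
     M = scale_measure (ennreal (s 0))
           (mu (normalize_seq s) (friedrichs_param (normalize_seq s)))"

definition krein_solution :: "(nat \<Rightarrow> real) \<Rightarrow> real measure \<Rightarrow> bool" where
  "krein_solution s M \<longleftrightarrow> indeterminate s \<and> stieltjes s \<and>
     M = scale_measure (ennreal (s 0)) (mu (normalize_seq s) \<infinity>)"

text \<open>
  The measure \<open>x dM(x)\<close>, for \<open>M\<close> supported in \<open>[0,\<infinity>)\<close>; \<^const>\<open>ennreal\<close> sends negative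
  numbers to 0, which is immaterial for such \<open>M\<close>.
\<close>

definition times_x :: "real measure \<Rightarrow> real measure" where
  "times_x M = density M (\<lambda>x. ennreal x)"

end

theory Submission
  imports Defs "HOL-Probability.Probability" "HOL-Complex_Analysis.Complex_Analysis"
    "HOL-Real_Asymp.Real_Asymp" "HOL-Computational_Algebra.Fundamental_Theorem_Algebra"
begin

text \<open>
  Write \<open>s'\<close> for the normalized shift of \<open>s\<close>. Its orthonormal polynomials are multiples of the kernel
  polynomials \<open>K\<^sub>n(x) = \<Sum>\<^sub>k\<^sub>\<le>\<^sub>n p\<^sub>k(0) p\<^sub>k(x)\<close>, with squared norming constants proportional to
  \<open>\<sigma>\<^sub>n - \<sigma>\<^sub>n\<^sub>+\<^sub>1\<close>, where \<open>\<sigma>\<^sub>n = q\<^sub>n(0) / p\<^sub>n(0)\<close> decreases to \<open>-F(s)\<close>. Summation by parts then expresses the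
  Nevanlinna matrix of \<open>s'\<close> through that of \<open>s\<close>, and comparing Stieltjes transforms shows that
  \<open>x d\<mu>\<^sub>F / s\<^sub>1\<close> has parameter \<open>1 / s\<^sub>1\<close> for \<open>s'\<close>, that \<open>x d\<mu>\<^sub>\<infinity> / s\<^sub>1\<close> has the parameter \<open>F(s')\<close>, and, because
  \<open>AD - BC = 1\<close>, that no other \<open>x d\<mu>\<^sub>t / s\<^sub>1\<close> is N-extremal.

  The measures \<open>\<mu>\<^sub>t\<close> are weak limits of the Gauss quadratures at the zeros of the partial sums of \<open>B + tD\<close>.
  All series are controlled by \<open>\<Sum> p\<^sub>n(0)\<^sup>2\<close> and \<open>F(s)\<close>, whose finiteness follows from the fact that the
  transforms of all Stieltjes solutions on the negative axis lie between \<open>-q\<^sub>n / p\<^sub>n\<close> and \<open>-C\<^sub>n / D\<^sub>n\<close>.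
\<close>

section \<open>Moment functionals and polynomials of the second kind\<close>

text \<open>N-extremality is by definition membership in a family described by Stieltjes transforms,
  so every claim about the type of a solution becomes a comparison of transforms; since x / (x - z)
  = 1 + z / (x - z), the transform of x d\<mu>_t is explicit. What has to be found is the Nevanlinna
  matrix of the shifted sequence, and the obstacle is convergence: identities are proved for
  polynomial partial sums, and the four entire functions enter only as pointwise limits. The two
  conditions of \<open>stieltjes_indet\<close> are chosen so as to survive the shift. The
  differences \<sigma>_n - \<sigma>_(n+1) telescope to F(s) and K_n(0) stays below the sum of all
  p_k(0)^2, which together make the squares p'_n(0)^2 summable. Hence everything proved for
  \<open>s\<close>, including the existence of the N-extremal solutions, can be interpreted for
  \<open>s'\<close>. Failure of N-extremality is decided at one non-real point: a coincidence of
  transforms would require h = e (t - F(s)) z with real e and h, so both would vanish.\<close>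

definition mlin :: "(nat \<Rightarrow> real) \<Rightarrow> real poly \<Rightarrow> real" where
  "mlin s p = (\<Sum>i\<le>degree p. coeff p i * s i)"

lemma mlin_altdef:
  assumes "degree p \<le> n"
  shows "mlin s p = (\<Sum>i\<le>n. coeff p i * s i)"
  unfolding mlin_def using assms
  by (intro sum.mono_neutral_left) (auto simp: coeff_eq_0)

lemma mlin_0 [simp]: "mlin s 0 = 0"
  by (simp add: mlin_def)

lemma mlin_add: "mlin s (p + q) = mlin s p + mlin s q"
  using mlin_altdef[of p "max (degree p) (degree q)" s] mlin_altdef[of q "max (degree p) (degree q)" s]
    mlin_altdef[OF degree_add_le_max, of s p q]
  by (simp add: sum.distrib algebra_simps)

lemma mlin_smult: "mlin s (smult c p) = c * mlin s p"
  using mlin_altdef[OF degree_smult_le, of s c p]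
  by (simp add: mlin_def sum_distrib_left mult.assoc)

lemma mlin_minus: "mlin s (- p) = - mlin s p"
  using mlin_smult[of s "-1" p] by simp

lemma mlin_diff: "mlin s (p - q) = mlin s p - mlin s q"
  using mlin_add[of s p "- q"] by (simp add: mlin_minus)

lemma mlin_sum: "mlin s (sum f A) = (\<Sum>a\<in>A. mlin s (f a))"
  by (induction A rule: infinite_finite_induct) (auto simp: mlin_add)

lemma mlin_pCons: "mlin s (pCons a p) = a * s 0 + mlin (\<lambda>n. s (Suc n)) p"
proof -
  have "mlin s (pCons a p) = (\<Sum>i\<le>Suc (degree p). coeff (pCons a p) i * s i)"
    by (intro mlin_altdef degree_pCons_le)
  also have "\<dots> = a * s 0 + mlin (\<lambda>n. s (Suc n)) p"
    by (simp only: sum.atMost_Suc_shift mlin_def) simp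
  finally show ?thesis .
qed

lemma mlin_const [simp]: "mlin s [:c:] = c * s 0"
  by (simp add: mlin_pCons)

lemma mlin_1 [simp]: "mlin s 1 = s 0"
  using mlin_const[of s 1] by (simp add: one_pCons)

lemma mlin_monom: "mlin s (monom c n) = c * s n"
  using mlin_altdef[OF degree_monom_le, of s c n]
  by (simp add: if_distrib[of "\<lambda>x. x * _"] cong: if_cong)

lemma mlin_integral:
  assumes "\<And>i. i \<le> degree p \<Longrightarrow> integrable M (\<lambda>x. x ^ i)"
    and "\<And>i. i \<le> degree p \<Longrightarrow> (\<integral>x. x ^ i \<partial>M) = s i"
  shows "integrable M (\<lambda>x. poly p x)" "(\<integral>x. poly p x \<partial>M) = mlin s p"
  using assms by (auto simp: poly_altdef mlin_def integral_sum)

text \<open>The image of \<open>(z^n - x^n) / (z - x)\<close>, the sum of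
  \<open>x^(n-1-j) z^j\<close> over \<open>j < n\<close>, when \<open>x^k\<close> is replaced by
  \<open>s k\<close>.\<close>

primrec sk_monom :: "(nat \<Rightarrow> real) \<Rightarrow> nat \<Rightarrow> real poly" where
  "sk_monom s 0 = 0"
| "sk_monom s (Suc n) = pCons (s n) (sk_monom s n)"

text \<open>The polynomial of the second kind attached to \<open>p\<close>: the functional \<^term>\<open>mlin s\<close>, acting
  on the variable \<open>x\<close>, applied to the difference quotient \<open>(p(z) - p(x)) / (z - x)\<close>.\<close>

definition sk :: "(nat \<Rightarrow> real) \<Rightarrow> real poly \<Rightarrow> real poly" where
  "sk s p = (\<Sum>i\<le>degree p. smult (coeff p i) (sk_monom s i))"

lemma sk_altdef:
  assumes "degree p \<le> n"
  shows "sk s p = (\<Sum>i\<le>n. smult (coeff p i) (sk_monom s i))"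
  unfolding sk_def using assms
  by (intro sum.mono_neutral_left) (auto simp: coeff_eq_0)

lemma sk_0 [simp]: "sk s 0 = 0"
  by (simp add: sk_def)

lemma sk_add: "sk s (p + q) = sk s p + sk s q"
  using sk_altdef[of p "max (degree p) (degree q)" s] sk_altdef[of q "max (degree p) (degree q)" s]
    sk_altdef[OF degree_add_le_max, of s p q]
  by (simp add: sum.distrib smult_add_left)

lemma smult_sum_right: "smult c (sum f A) = (\<Sum>a\<in>A. smult c (f a))"
  by (induction A rule: infinite_finite_induct) (auto simp: smult_add_right)

lemma sk_smult: "sk s (smult c p) = smult c (sk s p)"
  using sk_altdef[OF degree_smult_le, of s c p]
  by (simp add: sk_def smult_sum_right)

lemma sk_minus: "sk s (- p) = - sk s p"
  using sk_smult[of s "-1" p] by simp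

lemma sk_diff: "sk s (p - q) = sk s p - sk s q"
  using sk_add[of s p "- q"] by (simp add: sk_minus)

lemma sk_sum: "sk s (sum f A) = (\<Sum>a\<in>A. sk s (f a))"
  by (induction A rule: infinite_finite_induct) (auto simp: sk_add)

text \<open>From \<open>z f(z) - x f(x) = z (f(z) - f(x)) + (z - x) f(x)\<close>. It is the
  recursion behind the later inductions over \<open>pCons\<close>.\<close>

lemma sk_pCons: "sk s (pCons a p) = pCons (mlin s p) (sk s p)"
proof -
  have pc: "(\<Sum>i\<in>A. pCons (f i) (g i)) = pCons (sum f A) (sum g A)"
    for f :: "nat \<Rightarrow> real" and g A
    by (induction A rule: infinite_finite_induct) auto
  have "sk s (pCons a p) = (\<Sum>i\<le>Suc (degree p). smult (coeff (pCons a p) i) (sk_monom s i))"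
    by (intro sk_altdef degree_pCons_le)
  also have "\<dots> = pCons (mlin s p) (sk s p)"
    by (simp only: sum.atMost_Suc_shift mlin_def sk_def) (simp add: pc)
  finally show ?thesis .
qed

lemma sk_const [simp]: "sk s [:c:] = 0"
  by (simp add: sk_pCons)

lemma sk_1 [simp]: "sk s 1 = 0"
  using sk_const[of s 1] by (simp add: one_pCons)

text \<open>At \<open>z = a\<close> the difference quotient of \<open>(x - a) S(x) + c\<close> is
  just \<open>S(x)\<close>.\<close>

lemma poly_sk_at:
  "poly (sk s ([:-a, 1:] * S + [:c:])) a = mlin s S"
proof -
  have "[:-a, 1:] * S + [:c:] = pCons 0 S - smult a S + [:c:]"
    by simp
  then show ?thesis
    by (simp only: sk_add sk_diff sk_smult sk_pCons sk_const) simp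
qed

text \<open>From \<open>x (f(z) - f(x)) = (z f(z) - x f(x)) - (z - x) f(z)\<close>. This gives
  access to the polynomials of the second kind of the shifted sequence.\<close>

lemma sk_shift:
  "sk (\<lambda>n. s (Suc n)) f = sk s (pCons 0 f) - smult (s 0) f"
  by (induction f) (simp_all add: sk_pCons mlin_pCons)

section \<open>Complex evaluation of real polynomials\<close>

lemma cpoly_0 [simp]: "cpoly 0 z = 0"
  and cpoly_1 [simp]: "cpoly 1 z = 1"
  by (simp_all add: cpoly_def)

lemma cpoly_pCons: "cpoly (pCons c p) z = of_real c + z * cpoly p z"
  by (cases "pCons c p = 0") (simp_all add: cpoly_def map_poly_pCons)

lemma cpoly_add: "cpoly (p + q) z = cpoly p z + cpoly q z"
  by (induction p q rule: poly_induct2) (simp_all add: cpoly_pCons algebra_simps)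

lemma cpoly_smult: "cpoly (smult c p) z = of_real c * cpoly p z"
  by (induction p) (simp_all add: cpoly_pCons algebra_simps)

lemma cpoly_uminus: "cpoly (- p) z = - cpoly p z"
  using cpoly_smult[of "-1" p z] by simp

lemma cpoly_diff: "cpoly (p - q) z = cpoly p z - cpoly q z"
  using cpoly_add[of p "- q" z] by (simp add: cpoly_uminus)

lemma cpoly_mult: "cpoly (p * q) z = cpoly p z * cpoly q z"
  by (induction p) (simp_all add: cpoly_pCons cpoly_add cpoly_smult algebra_simps)

lemma cpoly_of_real: "cpoly p (of_real x) = of_real (poly p x)"
  by (induction p) (simp_all add: cpoly_pCons)

lemma cpoly_sum: "cpoly (sum f A) z = (\<Sum>a\<in>A. cpoly (f a) z)"
  by (induction A rule: infinite_finite_induct) (auto simp: cpoly_add)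

lemma cpoly_at_0: "cpoly p 0 = of_real (poly p 0)"
  using cpoly_of_real[of p 0] by simp

lemma cpoly_eqI:
  assumes "\<And>z. Im z \<noteq> 0 \<Longrightarrow> cpoly p z = cpoly q z"
  shows "p = q"
proof -
  have "poly (map_poly complex_of_real (p - q)) z = 0" if "Im z \<noteq> 0" for z
    using assms[OF that] by (simp add: cpoly_def[symmetric] cpoly_diff)
  moreover have "infinite {z. Im z \<noteq> 0}"
  proof -
    have "inj (\<lambda>n. Complex 0 (1 + real n))" by (auto simp: inj_def)
    then have "infinite (range (\<lambda>n. Complex 0 (1 + real n)))" using finite_imageD by blast
    moreover have "range (\<lambda>n. Complex 0 (1 + real n)) \<subseteq> {z. Im z \<noteq> 0}" by auto
    ultimately show ?thesis using finite_subset by blast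
  qed
  ultimately have "infinite {z. poly (map_poly complex_of_real (p - q)) z = 0}"
    by (metis (mono_tags, lifting) Collect_mono infinite_super)
  then have "map_poly complex_of_real (p - q) = 0"
    using poly_roots_finite by blast
  then have "p - q = 0"
    by (simp add: map_poly_eq_0_iff)
  then show ?thesis by simp
qed

text \<open>Only moments below the degree of \<open>p\<close> enter, because the difference quotient
  has degree one less. This suits the quadrature measures, which share only finitely many moments
  with \<open>s\<close>.\<close>

lemma sk_integral:
  assumes "Im z \<noteq> 0"
    and "\<And>i. i < degree p \<Longrightarrow> integrable M (\<lambda>x. x ^ i)"
    and "\<And>i. i < degree p \<Longrightarrow> (\<integral>x. x ^ i \<partial>M) = s i"
  shows "integrable M (\<lambda>x. (cpoly p z - cpoly p (of_real x)) / (z - of_real x))" (is ?A)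
    and "(\<integral>x. (cpoly p z - cpoly p (of_real x)) / (z - of_real x) \<partial>M) = cpoly (sk s p) z" (is ?B)
proof -
  have nz: "z - of_real x \<noteq> 0" for x using assms(1) by (auto simp: complex_eq_iff)
  have "?A \<and> ?B" using assms(2,3)
  proof (induction p)
    case 0
    then show ?case by simp
  next
    case (pCons a p)
    show ?case
    proof (cases "p = 0")
      case True
      then show ?thesis by (simp add: cpoly_pCons)
    next
      case False
      then have deg: "degree (pCons a p) = Suc (degree p)" by simp
      have IH: "integrable M (\<lambda>x. (cpoly p z - cpoly p (of_real x)) / (z - of_real x))"
        "(\<integral>x. (cpoly p z - cpoly p (of_real x)) / (z - of_real x) \<partial>M) = cpoly (sk s p) z"
        using pCons deg by auto
      have eq: "(\<lambda>x. (cpoly (pCons a p) z - cpoly (pCons a p) (of_real x)) / (z - of_real x)) =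
        (\<lambda>x. z * ((cpoly p z - cpoly p (of_real x)) / (z - of_real x)) + of_real (poly p x))"
        using nz by (auto simp: fun_eq_iff cpoly_pCons cpoly_of_real field_simps)
      have i: "integrable M (\<lambda>x. poly p x)" "(\<integral>x. poly p x \<partial>M) = mlin s p"
        using mlin_integral[of p M s] pCons.prems deg by auto
      show ?thesis
        unfolding eq using integrable_mult_right[OF IH(1), of z] IH(2) i
        by (simp add: cpoly_pCons sk_pCons del: times_divide_eq_right)
    qed
  qed
  then show ?A ?B by auto
qed

section \<open>Orthonormal polynomials of a Stieltjes sequence\<close>

definition posdef :: "(nat \<Rightarrow> real) \<Rightarrow> bool" where
  "posdef s \<longleftrightarrow> (\<forall>p. p \<noteq> 0 \<longrightarrow> mlin s (p * p) > 0)"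

definition orthonormal :: "(nat \<Rightarrow> real) \<Rightarrow> (nat \<Rightarrow> real poly) \<Rightarrow> bool" where
  "orthonormal s P \<longleftrightarrow> (\<forall>n. degree (P n) = n \<and> lead_coeff (P n) > 0) \<and>
     (\<forall>m n. mlin s (P m * P n) = (if m = n then 1 else 0))"

lemma orthonormalD:
  assumes "orthonormal s P"
  shows "degree (P n) = n" "coeff (P n) n > 0" "mlin s (P m * P n) = (if m = n then 1 else 0)"
  using assms unfolding orthonormal_def by metis+

lemma orthonormal_expansion:
  assumes P: "orthonormal s P" and "degree f \<le> n"
  shows "f = (\<Sum>k\<le>n. smult (mlin s (f * P k)) (P k))"
proof -
  have "\<exists>c. f = (\<Sum>k\<le>n. smult (c k) (P k))" using \<open>degree f \<le> n\<close>
  proof (induction n arbitrary: f)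
    case 0
    then obtain a where f: "f = [:a:]" by (metis degree_0_id le_zero_eq)
    obtain d where d: "P 0 = [:d:]" using orthonormalD(1)[OF P, of 0] by (metis degree_0_id)
    have "d \<noteq> 0" using orthonormalD(2)[OF P, of 0] d by simp
    then show ?case using f d by (intro exI[of _ "\<lambda>_. a / d"]) simp
  next
    case (Suc n)
    define b where "b = coeff f (Suc n) / coeff (P (Suc n)) (Suc n)"
    define g where "g = f - smult b (P (Suc n))"
    have "degree g \<le> n"
    proof (rule degree_le, safe)
      fix i assume "n < i"
      show "coeff g i = 0"
      proof (cases "i = Suc n")
        case True
        then show ?thesis using orthonormalD(2)[OF P, of "Suc n"] by (simp add: g_def b_def)
      next
        case False
        then have "i > Suc n" using \<open>n < i\<close> by simp
        then show ?thesis
          using Suc.prems orthonormalD(1)[OF P, of "Suc n"] by (simp add: g_def coeff_eq_0)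
      qed
    qed
    then obtain c where c: "g = (\<Sum>k\<le>n. smult (c k) (P k))" using Suc.IH by blast
    have "f = g + smult b (P (Suc n))" by (simp add: g_def)
    also have "\<dots> = (\<Sum>k\<le>Suc n. smult ((c(Suc n := b)) k) (P k))"
      by (simp add: c)
    finally show ?case by blast
  qed
  then obtain c where c: "f = (\<Sum>k\<le>n. smult (c k) (P k))" by blast
  have "mlin s (f * P k) = c k" if "k \<le> n" for k
  proof -
    have "mlin s (f * P k) = (\<Sum>j\<le>n. c j * (if j = k then 1 else 0))"
      by (simp add: c sum_distrib_right mlin_sum mlin_smult orthonormalD(3)[OF P])
    also have "\<dots> = c k" using that by (simp add: if_distrib cong: if_cong)
    finally show ?thesis .
  qed
  then have "(\<Sum>k\<le>n. smult (mlin s (f * P k)) (P k)) = (\<Sum>k\<le>n. smult (c k) (P k))"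
    by (intro sum.cong) auto
  then show ?thesis using c by simp
qed

lemma orthonormal_lower:
  assumes P: "orthonormal s P" and "degree g < n"
  shows "mlin s (P n * g) = 0"
proof -
  obtain m where m: "n = Suc m" "degree g \<le> m" using assms(2) by (cases n) auto
  have "mlin s (P n * g) = mlin s (P n * (\<Sum>k\<le>m. smult (mlin s (g * P k)) (P k)))"
    using orthonormal_expansion[OF P m(2)] by simp
  also have "\<dots> = (\<Sum>k\<le>m. mlin s (g * P k) * mlin s (P n * P k))"
    by (simp add: sum_distrib_left mlin_sum mlin_smult)
  also have "\<dots> = 0"
    by (intro sum.neutral) (auto simp: orthonormalD(3)[OF P] m)
  finally show ?thesis .
qed

lemma orthonormal_unique:
  assumes P: "orthonormal s P" and Q: "orthonormal s Q"
  shows "P = Q"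
proof
  fix n
  define c where "c = mlin s (Q n * P n)"
  have "Q n = (\<Sum>k\<le>n. smult (mlin s (Q n * P k)) (P k))"
    by (intro orthonormal_expansion[OF P]) (simp add: orthonormalD(1)[OF Q])
  also have "\<dots> = (\<Sum>k\<le>n. if k = n then smult c (P n) else 0)"
    using orthonormal_lower[OF Q] by (intro sum.cong) (auto simp: c_def orthonormalD(1)[OF P])
  also have "\<dots> = smult c (P n)" by simp
  finally have eq: "Q n = smult c (P n)" .
  have "c * c = 1"
    using orthonormalD(3)[OF Q, of n n] orthonormalD(3)[OF P, of n n]
    by (simp add: eq mlin_smult)
  moreover have "c > 0"
    using orthonormalD(2)[OF Q, of n] orthonormalD(2)[OF P, of n]
    by (simp add: eq zero_less_mult_iff)
  ultimately have "c = 1" by (metis abs_of_pos power2_eq_square power2_eq_1_iff zero_less_one abs_minus_cancel less_numeral_extra(1) not_less_iff_gr_or_eq neg_less_0_iff_less)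
  then show "P n = Q n" using eq by simp
qed

section \<open>Existence of orthonormal polynomials\<close>

fun gram_schmidt :: "(nat \<Rightarrow> real) \<Rightarrow> nat \<Rightarrow> real poly" where
  "gram_schmidt s n =
     (let u = monom 1 n - (\<Sum>k<n. smult (mlin s (monom 1 n * gram_schmidt s k)) (gram_schmidt s k))
      in smult (1 / sqrt (mlin s (u * u))) u)"

declare gram_schmidt.simps [simp del]

lemma gram_schmidt_props:
  assumes "posdef s"
  shows "degree (gram_schmidt s n) = n \<and> coeff (gram_schmidt s n) n > 0 \<and>
    mlin s (gram_schmidt s n * gram_schmidt s n) = 1 \<and>
    (\<forall>m<n. mlin s (gram_schmidt s n * gram_schmidt s m) = 0)"
proof (induction n rule: less_induct)
  case (less n)
  let ?G = "gram_schmidt s"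
  define v where "v = (\<Sum>k<n. smult (mlin s (monom 1 n * ?G k)) (?G k))"
  define u where "u = monom 1 n - v"
  define c where "c = 1 / sqrt (mlin s (u * u))"
  have G: "?G n = smult c u"
    by (subst gram_schmidt.simps) (simp add: Let_def u_def v_def c_def)
  have cv: "coeff v i = 0" if "i \<ge> n" for i
    unfolding v_def coeff_sum using less.IH that
    by (intro sum.neutral) (auto simp: coeff_eq_0)
  have cu: "coeff u n = 1" by (simp add: u_def cv)
  have "degree u \<le> n" by (rule degree_le) (auto simp: u_def cv)
  then have du: "degree u = n" using cu le_degree[of u n] by simp
  have "u \<noteq> 0" using cu by auto
  then have pos: "mlin s (u * u) > 0" using assms by (simp add: posdef_def)
  have c: "c > 0" "c * c * mlin s (u * u) = 1" using pos by (auto simp: c_def)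
  have orth: "mlin s (?G j * ?G k) = (if j = k then 1 else 0)" if "j < n" "k < n" for j k
    using less.IH[of j] less.IH[of k] that by (cases j k rule: linorder_cases) (auto simp: mult.commute)
  have "mlin s (u * ?G m) = 0" if "m < n" for m
  proof -
    have "mlin s (v * ?G m) = (\<Sum>k<n. mlin s (monom 1 n * ?G k) * (if k = m then 1 else 0))"
      using that by (simp add: v_def sum_distrib_right mlin_sum mlin_smult orth)
    also have "\<dots> = mlin s (monom 1 n * ?G m)" using that by (simp add: if_distrib cong: if_cong)
    finally show ?thesis by (simp add: u_def left_diff_distrib mlin_diff)
  qed
  then show ?case using c du cu by (simp add: G mlin_smult mult.assoc)
qed

lemma orthonormal_gram_schmidt:
  assumes "posdef s"
  shows "orthonormal s (gram_schmidt s)"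
proof -
  have "mlin s (gram_schmidt s m * gram_schmidt s n) = (if m = n then 1 else 0)" for m n
    using gram_schmidt_props[OF assms, of m] gram_schmidt_props[OF assms, of n]
    by (cases m n rule: linorder_cases) (auto simp: mult.commute)
  then show ?thesis
    using gram_schmidt_props[OF assms] by (auto simp: orthonormal_def)
qed

text \<open>\<open>D n = x * K n\<close>, \<open>B n\<close>, \<open>C n\<close> and \<open>A n\<close> are the partial sums, up to index \<open>n\<close>, of the entire
  functions of the Nevanlinna matrix.\<close>

locale stieltjes_seq =
  fixes s :: "nat \<Rightarrow> real" and P :: "nat \<Rightarrow> real poly"
  assumes s0: "s 0 = 1"
    and posdef: "posdef s"
    and posdef_shift: "posdef (\<lambda>n. s (Suc n))"
    and P: "orthonormal s P"
begin

definition "p0 n = poly (P n) 0"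
definition "q n = sk s (P n)"
definition "q0 n = poly (q n) 0"
definition "K n = (\<Sum>k\<le>n. smult (p0 k) (P k))"
definition "D n = pCons 0 (K n)"
definition "B n = pCons (-1) (\<Sum>k\<le>n. smult (q0 k) (P k))"
definition "C n = pCons 1 (\<Sum>k\<le>n. smult (p0 k) (q k))"
definition "A n = pCons 0 (\<Sum>k\<le>n. smult (q0 k) (q k))"
definition "\<sigma> n = q0 n / p0 n"

lemma pos: "p \<noteq> 0 \<Longrightarrow> mlin s (p * p) > 0"
  using posdef by (simp add: posdef_def)

lemma pos_shift: "p \<noteq> 0 \<Longrightarrow> mlin s (pCons 0 (p * p)) > 0"
  using posdef_shift by (simp add: posdef_def mlin_pCons)

lemma degP [simp]: "degree (P n) = n" using orthonormalD(1)[OF P] .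

lemma P_nz [simp]: "P n \<noteq> 0" using orthonormalD(2)[OF P, of n] by auto

lemma P_0: "P 0 = 1"
proof -
  obtain d where d: "P 0 = [:d:]" using degP[of 0] by (metis degree_0_id)
  have "d * d = 1" "d > 0"
    using orthonormalD(2)[OF P, of 0] orthonormalD(3)[OF P, of 0 0] by (auto simp: d s0)
  then have "d = 1" by (metis mult_cancel_right2 abs_of_pos abs_mult_self_eq real_sqrt_abs2 real_sqrt_one)
  then show ?thesis using d by (simp add: one_pCons)
qed

lemma p0_0: "p0 0 = 1" and q_0: "q 0 = 0" and q0_0: "q0 0 = 0" and \<sigma>_0: "\<sigma> 0 = 0"
  by (simp_all add: p0_def q_def q0_def P_0 \<sigma>_def)

lemma mlin_P: "mlin s (P n) = (if n = 0 then 1 else 0)"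
  using orthonormalD(3)[OF P, of n 0] by (simp add: P_0)

section \<open>Kernel polynomials and Christoffel-Darboux identities at 0\<close>

lemma mlin_K: "mlin s (K n) = 1"
  by (simp add: K_def mlin_sum mlin_smult mlin_P p0_0 if_distrib cong: if_cong)

lemma sk_D: "sk s (D n) = C n"
  by (simp add: D_def sk_pCons mlin_K C_def) (simp add: K_def sk_sum sk_smult q_def)

lemma sk_B: "sk s (B n) = A n"
  by (simp add: B_def A_def sk_pCons mlin_sum mlin_smult mlin_P q0_0 sk_sum sk_smult
      q_def[symmetric] if_distrib cong: if_cong)

lemma degree_K_le: "degree (K n) \<le> n"
  unfolding K_def by (intro degree_sum_le) (auto intro: order.trans[OF degree_smult_le])

text \<open>\<open>K n\<close> is the reproducing kernel at 0: its pairing with \<open>P k\<close>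
  is \<open>p0 k\<close>, and \<open>f\<close> is a combination of the \<open>P k\<close> with
  \<open>k \<le> n\<close>.\<close>

lemma mlin_K_mult:
  assumes "degree f \<le> n"
  shows "mlin s (K n * f) = poly f 0"
proof -
  have "poly f 0 = poly (\<Sum>k\<le>n. smult (mlin s (f * P k)) (P k)) 0"
    using orthonormal_expansion[OF P assms] by simp
  also have "\<dots> = mlin s (K n * f)"
    by (simp add: K_def poly_sum mlin_sum mlin_smult sum_distrib_right sum_distrib_left p0_def mult.commute)
  finally show ?thesis ..
qed

text \<open>The same expansion for the functional that applies \<open>mlin s\<close> to
  \<open>(f(x) - f(0)) / x\<close>; its value at \<open>P k\<close> is \<open>q0 k\<close>.\<close>

lemma mlin_q_mult:
  assumes "degree f \<le> n"
  shows "(\<Sum>k\<le>n. q0 k * mlin s (P k * f)) = poly (sk s f) 0"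
proof -
  have "poly (sk s f) 0 = poly (sk s (\<Sum>k\<le>n. smult (mlin s (f * P k)) (P k))) 0"
    using orthonormal_expansion[OF P assms] by simp
  also have "\<dots> = (\<Sum>k\<le>n. q0 k * mlin s (P k * f))"
    by (simp add: sk_sum sk_smult poly_sum q_def q0_def mult.commute)
  finally show ?thesis ..
qed

lemma mlin_D_lower:
  assumes "degree g < n"
  shows "mlin s (D n * g) = 0"
proof -
  have "degree (pCons 0 g) \<le> n" using assms degree_pCons_le[of 0 g] by simp
  from mlin_K_mult[OF this] show ?thesis by (simp add: D_def)
qed

text \<open>The constant \<open>-1\<close> in \<open>B n\<close> cancels against
  \<open>poly (sk s (pCons 0 g)) 0 = mlin s g\<close>. Together with \<open>mlin_D_lower\<close>
  this makes every real combination of \<open>B n\<close> and \<open>D n\<close>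
  quasi-orthogonal.\<close>

lemma mlin_B_lower:
  assumes "degree g < n"
  shows "mlin s (B n * g) = 0"
proof -
  have "degree (pCons 0 g) \<le> n" using assms degree_pCons_le[of 0 g] by simp
  from mlin_q_mult[OF this] show ?thesis
    by (simp add: B_def sk_pCons mlin_diff mlin_pCons mlin_sum mlin_smult sum_distrib_right
)
qed

text \<open>The Christoffel-Darboux identity with one argument at 0, obtained by expanding
  \<open>(P n - p0 n) / x\<close> in the orthonormal basis. Applying \<open>sk s\<close> to it gives
  the companion identity for \<open>q n\<close>.\<close>

lemma P_eq: "P n = smult (q0 n) (D n) - smult (p0 n) (B n)"
proof -
  obtain a S where aS: "P n = pCons a S" by (cases "P n")
  have a: "a = p0 n" by (simp add: p0_def aS)
  have lS: "mlin s S = q0 n" by (simp add: q0_def q_def aS sk_pCons)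
  have dS: "degree S \<le> n" using degP[of n] aS by (cases "S = 0") auto
  \<comment> \<open>With \<open>P n = a + x S\<close> and \<open>P k = b + x T\<close>, both
    \<open>S * P k\<close> and \<open>P n * T\<close> contain \<open>x S T\<close>, so they differ
    only by multiples of \<open>S\<close> and \<open>T\<close>; and \<open>P n * T\<close> is
    annihilated because \<open>T\<close> has degree below \<open>k \<le> n\<close>.\<close>
  have coef: "mlin s (S * P k) = p0 k * q0 n - q0 k * p0 n" if "k \<le> n" for k
  proof -
    obtain b T where bT: "P k = pCons b T" by (cases "P k")
    have b: "b = p0 k" by (simp add: p0_def bT)
    have lT: "mlin s T = q0 k" by (simp add: q0_def q_def bT sk_pCons)
    have "mlin s (P n * T) = 0"
    proof (cases "T = 0")
      case False
      then have "degree T < k" using degP[of k] bT by simp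
      then show ?thesis using that by (intro orthonormal_lower[OF P]) auto
    qed simp
    moreover have "S * P k = smult b S + P n * T - smult a T"
      by (simp add: aS bT algebra_simps)
    ultimately show ?thesis
      by (simp add: mlin_add mlin_diff mlin_smult b a lS lT)
  qed
  have "S = (\<Sum>k\<le>n. smult (p0 k * q0 n - q0 k * p0 n) (P k))"
    using orthonormal_expansion[OF P dS] by (simp add: coef)
  also have "\<dots> = smult (q0 n) (K n) - smult (p0 n) (\<Sum>k\<le>n. smult (q0 k) (P k))"
    by (simp add: K_def smult_sum_right smult_diff_left sum_subtractf mult.commute)
  finally show ?thesis
    by (simp add: aS a D_def B_def)
qed

lemma q_eq: "q n = smult (q0 n) (C n) - smult (p0 n) (A n)"
proof -
  have "q n = sk s (smult (q0 n) (D n) - smult (p0 n) (B n))"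
    unfolding q_def by (subst P_eq) simp
  then show ?thesis by (simp add: sk_diff sk_smult sk_D sk_B)
qed

text \<open>A zero \<open>x \<le> 0\<close> would give \<open>P n = (y - x) S(y)\<close>, and
  pairing with \<open>S\<close> yields the value of \<open>y S^2\<close> minus \<open>x\<close>
  times that of \<open>S^2\<close>, which is positive although orthogonality makes it 0.\<close>

lemma P_nonzero_nonpos:
  assumes "x \<le> 0"
  shows "poly (P n) x \<noteq> 0"
proof
  assume "poly (P n) x = 0"
  then obtain S where S: "P n = [:-x, 1:] * S" using poly_eq_0_iff_dvd by (metis dvdE)
  then have "S \<noteq> 0" using P_nz[of n] by auto
  then have "degree (P n) = Suc (degree S)"
    by (subst S, subst degree_mult_eq) auto
  then have "mlin s (P n * S) = 0" by (intro orthonormal_lower[OF P]) simp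
  moreover have "P n * S = pCons 0 (S * S) + smult (- x) (S * S)"
    by (simp add: S left_diff_distrib)
  ultimately have "mlin s (pCons 0 (S * S)) - x * mlin s (S * S) = 0"
    by (simp add: mlin_add mlin_diff mlin_smult)
  moreover have "x * mlin s (S * S) \<le> 0"
    using assms pos[OF \<open>S \<noteq> 0\<close>] by (simp add: mult_le_0_iff)
  ultimately show False using pos_shift[OF \<open>S \<noteq> 0\<close>] by simp
qed

lemma p0_nz [simp]: "p0 n \<noteq> 0"
  using P_nonzero_nonpos[of 0 n] by (simp add: p0_def)

lemma p0_mult_P_pos:
  assumes "x \<le> 0"
  shows "p0 n * poly (P n) x > 0"
proof (rule ccontr)
  assume neg: "\<not> p0 n * poly (P n) x > 0"
  then have "poly (P n) x * poly (P n) 0 < 0"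
    using P_nonzero_nonpos[OF assms, of n] p0_nz[of n]
    by (metis mult.commute linorder_neqE_linordered_idom mult_eq_0_iff p0_def)
  moreover have "x < 0" using assms neg p0_nz[of n] by (cases "x = 0") (auto simp: p0_def zero_less_mult_iff)
  ultimately obtain y where "x < y" "y < 0" "poly (P n) y = 0"
    using poly_IVT[of x 0 "P n"] by auto
  then show False using P_nonzero_nonpos[of y n] by simp
qed

lemma degree_K: "degree (K n) = n" and K_nz: "K n \<noteq> 0"
  and lead_K: "coeff (K n) n = p0 n * coeff (P n) n"
proof -
  show lc: "coeff (K n) n = p0 n * coeff (P n) n"
  proof -
    have "coeff (K n) n = (\<Sum>k\<le>n. if k = n then p0 n * coeff (P n) n else 0)"
      unfolding K_def coeff_sum by (intro sum.cong) (auto simp: coeff_eq_0)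
    then show ?thesis by simp
  qed
  have "coeff (K n) n \<noteq> 0" using lc orthonormalD(2)[OF P, of n] by simp
  then show "K n \<noteq> 0" "degree (K n) = n"
    using degree_K_le[of n] le_degree[of "K n" n] by auto
qed

lemma D_nz: "D n \<noteq> 0" using K_nz[of n] by (simp add: D_def)

lemma K_Suc: "K (Suc n) = K n + smult (p0 (Suc n)) (P (Suc n))"
  and D_Suc: "D (Suc n) = D n + pCons 0 (smult (p0 (Suc n)) (P (Suc n)))"
  and B_Suc: "B (Suc n) = B n + pCons 0 (smult (q0 (Suc n)) (P (Suc n)))"
  and C_Suc: "C (Suc n) = C n + pCons 0 (smult (p0 (Suc n)) (q (Suc n)))"
  and A_Suc: "A (Suc n) = A n + pCons 0 (smult (q0 (Suc n)) (q (Suc n)))"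
  by (simp_all add: K_def D_def B_def C_def A_def)

text \<open>The increments of \<open>D\<close> and \<open>B\<close> cancel in \<open>P_eq\<close>,
  so \<open>P n\<close> and \<open>P (Suc n)\<close> are combinations of one and the same pair
  \<open>D n\<close>, \<open>B n\<close>.\<close>

lemma P_Suc_eq: "P (Suc n) = smult (q0 (Suc n)) (D n) - smult (p0 (Suc n)) (B n)"
  using P_eq[of "Suc n"] by (simp add: D_Suc B_Suc smult_add_right algebra_simps)

text \<open>Pairing \<open>P n\<close> and \<open>P (Suc n)\<close>, both written through
  \<open>D n\<close> and \<open>B n\<close>, with \<open>P n\<close> gives two linear equations;
  eliminating \<open>b\<close> leaves \<open>p0 n * d\<close>, the squared norm of
  \<open>K n\<close> under the shifted functional. Its positivity makes \<open>\<sigma>\<close>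
  strictly decreasing.\<close>

lemma \<sigma>_diff: "(\<sigma> n - \<sigma> (Suc n)) * mlin s (pCons 0 (K n * K n)) = 1"
proof -
  define d where "d = mlin s (D n * P n)"
  define b where "b = mlin s (B n * P n)"
  have 1: "q0 (Suc n) * d = p0 (Suc n) * b"
  proof -
    have "mlin s (P (Suc n) * P n) = 0" by (simp add: orthonormalD(3)[OF P])
    then show ?thesis
      by (subst (asm) P_Suc_eq) (simp add: left_diff_distrib mlin_diff mlin_smult d_def b_def)
  qed
  have 2: "q0 n * d - p0 n * b = 1"
  proof -
    have "mlin s (P n * P n) = 1" by (simp add: orthonormalD(3)[OF P])
    then show ?thesis
      by (subst (asm) (1) P_eq) (simp add: left_diff_distrib mlin_diff mlin_smult d_def b_def)
  qed
  have "mlin s (pCons 0 (K n * K n)) = p0 n * d"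
  proof (cases n)
    case 0
    then show ?thesis by (simp add: K_def D_def d_def P_0 p0_0)
  next
    case (Suc m)
    have "pCons 0 (K n * K n) = D n * K m + smult (p0 n) (D n * P n)"
      by (simp add: D_def Suc K_Suc[of m] distrib_left smult_add_right)
    moreover have "mlin s (D n * K m) = 0"
      using degree_K_le[of m] by (intro mlin_D_lower) (simp add: Suc)
    ultimately show ?thesis by (simp add: mlin_add mlin_smult d_def)
  qed
  moreover have "(\<sigma> n - \<sigma> (Suc n)) * (p0 n * d) = 1"
  proof -
    have "(\<sigma> n - \<sigma> (Suc n)) * (p0 n * d) = q0 n * d - p0 n * (q0 (Suc n) * d) / p0 (Suc n)"
      by (simp add: \<sigma>_def field_simps)
    also have "\<dots> = 1" using 2 by (simp add: 1)
    finally show ?thesis .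
  qed
  ultimately show ?thesis by simp
qed

lemma \<sigma>_less: "\<sigma> (Suc n) < \<sigma> n"
  using \<sigma>_diff[of n] pos_shift[OF K_nz[of n]]
  by (metis diff_gt_0_iff_gt zero_less_mult_pos2 zero_less_one)

lemma decseq_\<sigma>: "decseq \<sigma>"
  using \<sigma>_less by (intro decseq_SucI) (simp add: less_imp_le)

lemma \<sigma>_le_0: "\<sigma> n \<le> 0"
  using decseqD[OF decseq_\<sigma>, of 0 n] by (simp add: \<sigma>_0)

lemma q0_eq: "q0 n = \<sigma> n * p0 n" by (simp add: \<sigma>_def)

end

section \<open>The Nevanlinna matrix and the shifted sequence\<close>

text \<open>The induction runs over the right-hand side of the hypothesis rather than over
  \<open>y\<close>; each new weight is absorbed by \<open>1 + x \<le> exp x\<close>.\<close>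

lemma discrete_gronwall:
  fixes y w :: "nat \<Rightarrow> real"
  assumes "\<And>n. y n \<le> a + b * (\<Sum>k<n. w k * y k)"
    and "a \<ge> 0" "b \<ge> 0" "\<And>n. w n \<ge> 0"
  shows "y n \<le> a * exp (b * (\<Sum>k<n. w k))"
proof -
  have "a + b * (\<Sum>k<n. w k * y k) \<le> a * exp (b * (\<Sum>k<n. w k))" for n
  proof (induction n)
    case (Suc n)
    let ?e = "a * exp (b * (\<Sum>k<n. w k))"
    have "a + b * (\<Sum>k<Suc n. w k * y k) = (a + b * (\<Sum>k<n. w k * y k)) + b * w n * y n"
      by (simp add: algebra_simps)
    also have "\<dots> \<le> ?e + b * w n * ?e"
      using Suc assms(1)[of n] assms(3) assms(4)[of n] by (intro add_mono mult_left_mono) auto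
    also have "\<dots> = ?e * (1 + b * w n)" by (simp add: algebra_simps)
    also have "\<dots> \<le> ?e * exp (b * w n)"
      using assms(2) by (intro mult_left_mono exp_ge_add_one_self) auto
    also have "\<dots> = a * exp (b * (\<Sum>k<Suc n. w k))"
      by (simp add: exp_add algebra_simps)
    finally show ?case .
  qed simp
  then show ?thesis using assms(1)[of n] order.trans by blast
qed

lemma mlin_divide: "mlin (\<lambda>n. t n / a) f = mlin t f / a"
  by (simp add: mlin_def sum_divide_distrib)

lemma sk_divide: "sk (\<lambda>n. t n / a) f = smult (1 / a) (sk t f)"
  by (induction f) (simp_all add: sk_pCons mlin_divide)

context stieltjes_seq
begin

lemma q_Suc_eq: "q (Suc n) = smult (q0 (Suc n)) (C n) - smult (p0 (Suc n)) (A n)"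
  using q_eq[of "Suc n"] by (simp add: C_Suc A_Suc smult_add_right algebra_simps)

lemma det_AD_BC: "A n * D n - B n * C n = 1"
proof (induction n)
  case 0
  show ?case by (simp add: A_def B_def C_def D_def K_def q0_0 q_0 p0_0 P_0 one_pCons)
next
  case (Suc n)
  \<comment> \<open>The update multiplies the matrix with rows \<open>(a, b)\<close>,
    \<open>(c, d)\<close> from the left by the identity plus \<open>x\<close> times the product of
    the column \<open>(q', p')\<close> and the row \<open>(- p', q')\<close>. That product has rank
    one and trace 0, so the determinant is kept.\<close>
  have step: "(a + x * (q' * q)) * (d + x * (p' * p)) - (b + x * (q' * p)) * (c + x * (p' * q)) = a * d - b * c"
    if "p = q' * d - p' * b" "q = q' * c - p' * a" for a b c d x p q p' q' :: "real poly"
    unfolding that by (simp add: algebra_simps)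
  have "A (Suc n) * D (Suc n) - B (Suc n) * C (Suc n) = A n * D n - B n * C n"
    unfolding A_Suc B_Suc C_Suc D_Suc
    using step[of "P (Suc n)" "[:q0 (Suc n):]" "D n" "[:p0 (Suc n):]" "B n" "q (Suc n)" "C n" "A n" "[:0, 1:]"]
    by (simp add: P_Suc_eq[symmetric] q_Suc_eq[symmetric])
  then show ?case using Suc.IH by simp
qed

lemma cpoly_det: "cpoly (A n) z * cpoly (D n) z - cpoly (B n) z * cpoly (C n) z = 1"
  using arg_cong[OF det_AD_BC[of n], of "\<lambda>p. cpoly p z"] by (simp add: cpoly_diff cpoly_mult)

definition "\<kappa> n = \<sigma> n - \<sigma> (Suc n)"
definition "k0 n = poly (K n) 0"

lemma \<kappa>_pos: "\<kappa> n > 0" using \<sigma>_less[of n] by (simp add: \<kappa>_def)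

lemma k0_eq: "k0 n = (\<Sum>k\<le>n. (p0 k)\<^sup>2)"
  by (simp add: k0_def K_def poly_sum p0_def power2_eq_square)

lemma k0_ge_1: "k0 n \<ge> 1"
proof -
  have "(p0 0)\<^sup>2 \<le> k0 n" unfolding k0_eq by (rule member_le_sum) auto
  then show ?thesis by (simp add: p0_0)
qed

lemma cpoly_D_K: "cpoly (D n) z = z * cpoly (K n) z"
  by (simp add: D_def cpoly_pCons)

lemma cpoly_D: "cpoly (D n) z = z * (\<Sum>k\<le>n. of_real (p0 k) * cpoly (P k) z)"
  and cpoly_B: "cpoly (B n) z = -1 + z * (\<Sum>k\<le>n. of_real (q0 k) * cpoly (P k) z)"
  and cpoly_C: "cpoly (C n) z = 1 + z * (\<Sum>k\<le>n. of_real (p0 k) * cpoly (q k) z)"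
  and cpoly_A: "cpoly (A n) z = z * (\<Sum>k\<le>n. of_real (q0 k) * cpoly (q k) z)"
  by (simp_all add: D_def K_def B_def C_def A_def cpoly_pCons cpoly_sum cpoly_smult)

section \<open>Summation by parts for the shifted Nevanlinna matrix\<close>

context
  fixes z :: complex
begin

text \<open>Abel summation: \<open>\<kappa>\<close> is the decrement of \<open>\<sigma>\<close>, and
  \<open>q0 = \<sigma> p0\<close> turns \<open>\<sigma>\<close> times an increment of
  \<open>D\<close> into the increment of \<open>B\<close>.\<close>

lemma sum_\<kappa>_D:
  "(\<Sum>n\<le>N. of_real (\<kappa> n) * cpoly (D n) z) = 1 + cpoly (B N) z - of_real (\<sigma> (Suc N)) * cpoly (D N) z"
proof (induction N)
  case 0
  show ?case by (simp add: \<kappa>_def \<sigma>_0 cpoly_B cpoly_D q0_0)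
next
  case (Suc N)
  then show ?case
    by (simp add: \<kappa>_def D_Suc B_Suc cpoly_add cpoly_pCons cpoly_smult q0_eq algebra_simps)
qed

lemma sum_\<kappa>_C:
  "(\<Sum>n\<le>N. of_real (\<kappa> n) * cpoly (C n) z) = cpoly (A N) z - of_real (\<sigma> (Suc N)) * cpoly (C N) z"
proof (induction N)
  case 0
  show ?case by (simp add: \<kappa>_def \<sigma>_0 cpoly_A cpoly_C q0_0 q_0)
next
  case (Suc N)
  then show ?case
    by (simp add: \<kappa>_def C_Suc A_Suc cpoly_add cpoly_pCons cpoly_smult q0_eq algebra_simps)
qed

text \<open>Here the weight \<open>k0\<close> changes as well. Its increment, the square of
  \<open>p0 (Suc N)\<close>, multiplies \<open>B N - \<sigma> (Suc N) D N\<close>, which equals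
  \<open>- P (Suc N) / p0 (Suc N)\<close> by \<open>P_Suc_eq\<close>; the product cancels the
  increment of \<open>K\<close>.\<close>

lemma sum_\<kappa>_k0_D:
  "(\<Sum>n\<le>N. of_real (\<kappa> n * k0 n) * cpoly (D n) z) =
   cpoly (K N) z + of_real (k0 N) * (cpoly (B N) z - of_real (\<sigma> (Suc N)) * cpoly (D N) z)"
proof (induction N)
  case 0
  show ?case by (simp add: \<kappa>_def \<sigma>_0 cpoly_B cpoly_D q0_0 k0_eq p0_0 K_def P_0 cpoly_pCons)
next
  case (Suc N)
  define p where "p = cpoly (P (Suc N)) z"
  define r where "r = complex_of_real (p0 (Suc N))"
  define S where "S = complex_of_real (\<sigma> (Suc N))"
  define b where "b = cpoly (B N) z"
  define d where "d = cpoly (D N) z"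
  have p: "p = S * r * d - r * b"
    unfolding p_def by (subst P_Suc_eq) (simp add: cpoly_diff cpoly_smult q0_eq S_def r_def b_def d_def)
  have D: "cpoly (D (Suc N)) z = d + z * r * p" and B: "cpoly (B (Suc N)) z = b + z * S * r * p"
    and K: "cpoly (K (Suc N)) z = cpoly (K N) z + r * p"
    by (simp_all add: D_Suc B_Suc K_Suc cpoly_add cpoly_pCons cpoly_smult d_def r_def p_def b_def q0_eq S_def)
  have k: "complex_of_real (k0 (Suc N)) = of_real (k0 N) + r * r"
    by (simp add: k0_eq r_def power2_eq_square)
  have kap: "complex_of_real (\<kappa> (Suc N)) = S - of_real (\<sigma> (Suc (Suc N)))"
    by (simp add: \<kappa>_def S_def)
  show ?case
    unfolding sum.atMost_Suc Suc.IH
    unfolding of_real_mult D B K k kap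
    unfolding S_def[symmetric] b_def[symmetric] d_def[symmetric] p
    by (simp add: algebra_simps)
qed

text \<open>Stated with a factor \<open>z\<close> because the counterpart of \<open>K N\<close> is
  \<open>(C N - 1) / z\<close>.\<close>

lemma sum_\<kappa>_k0_C:
  "z * (\<Sum>n\<le>N. of_real (\<kappa> n * k0 n) * cpoly (C n) z) =
   cpoly (C N) z - 1 + z * of_real (k0 N) * (cpoly (A N) z - of_real (\<sigma> (Suc N)) * cpoly (C N) z)"
proof (induction N)
  case 0
  show ?case by (simp add: \<kappa>_def \<sigma>_0 cpoly_A cpoly_C q0_0 k0_eq p0_0 q_0)
next
  case (Suc N)
  define p where "p = cpoly (q (Suc N)) z"
  define r where "r = complex_of_real (p0 (Suc N))"
  define S where "S = complex_of_real (\<sigma> (Suc N))"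
  define b where "b = cpoly (A N) z"
  define d where "d = cpoly (C N) z"
  have p: "p = S * r * d - r * b"
    unfolding p_def by (subst q_Suc_eq) (simp add: cpoly_diff cpoly_smult q0_eq S_def r_def b_def d_def)
  have D: "cpoly (C (Suc N)) z = d + z * r * p" and B: "cpoly (A (Suc N)) z = b + z * S * r * p"
    by (simp_all add: C_Suc A_Suc cpoly_add cpoly_pCons cpoly_smult d_def r_def p_def b_def q0_eq S_def)
  have k: "complex_of_real (k0 (Suc N)) = of_real (k0 N) + r * r"
    by (simp add: k0_eq r_def power2_eq_square)
  have kap: "complex_of_real (\<kappa> (Suc N)) = S - of_real (\<sigma> (Suc (Suc N)))"
    by (simp add: \<kappa>_def S_def)
  show ?case
    unfolding sum.atMost_Suc distrib_left[of z] Suc.IH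
    unfolding of_real_mult D B k kap
    unfolding S_def[symmetric] b_def[symmetric] d_def[symmetric] p
    by (simp add: algebra_simps)
qed

end

lemma s1_pos: "s 1 > 0"
  using pos_shift[of 1] by (simp add: mlin_pCons)

section \<open>The normalized shifted sequence\<close>

definition "s' n = s (Suc n) / s 1"
text \<open>By \<open>\<sigma>_diff\<close> the squared norm of \<open>K n\<close> for
  \<open>s'\<close> is \<open>1 / (s 1 * \<kappa> n)\<close>. The sign makes the leading coefficient
  positive, since that of \<open>K n\<close> has the sign of \<open>p0 n\<close>.\<close>

definition "c n = sgn (p0 n) * sqrt (s 1 * \<kappa> n)"
definition "P' n = smult (c n) (K n)"

lemma c_sq: "c n * c n = s 1 * \<kappa> n"
proof -
  have "c n * c n = (sgn (p0 n) * sgn (p0 n)) * (sqrt (s 1 * \<kappa> n) * sqrt (s 1 * \<kappa> n))"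
    by (simp add: c_def mult_ac)
  also have "sgn (p0 n) * sgn (p0 n) = 1" by (simp add: sgn_if)
  also have "sqrt (s 1 * \<kappa> n) * sqrt (s 1 * \<kappa> n) = s 1 * \<kappa> n"
    using s1_pos \<kappa>_pos[of n] by simp
  finally show ?thesis by simp
qed

lemma c_nz [simp]: "c n \<noteq> 0"
  using c_sq[of n] s1_pos \<kappa>_pos[of n] by auto

lemma mlin_s': "mlin s' f = mlin s (pCons 0 f) / s 1"
  unfolding s'_def mlin_divide by (simp add: mlin_pCons)

lemma orthonormal_P': "orthonormal s' P'"
  unfolding orthonormal_def
proof (intro conjI allI)
  fix n
  show deg: "degree (P' n) = n" by (simp add: P'_def degree_K)
  have "c n * p0 n > 0"
    using s1_pos \<kappa>_pos[of n] p0_nz[of n]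
    by (auto simp: c_def sgn_if zero_less_mult_iff linorder_neq_iff simp del: p0_nz)
  then show "lead_coeff (P' n) > 0"
    unfolding deg using orthonormalD(2)[OF P, of n]
    by (simp add: P'_def lead_K flip: mult.assoc)
next
  fix m n
  have less: "mlin s' (P' m * P' n) = 0" if "m < n" for m n
  proof -
    have "mlin s (D n * K m) = 0" using that degree_K_le[of m] by (intro mlin_D_lower) simp
    then show ?thesis
      by (simp add: mlin_s' P'_def D_def mult.commute mlin_pCons mlin_smult)
  qed
  have "mlin s' (P' n * P' n) = c n * c n * mlin s (pCons 0 (K n * K n)) / s 1" for n
    by (simp add: mlin_s' P'_def mlin_pCons mlin_smult)
  also have "\<dots> n = 1" for n
    using \<sigma>_diff[of n] s1_pos by (simp add: c_sq \<kappa>_def)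
  finally show "mlin s' (P' m * P' n) = (if m = n then 1 else 0)"
    using less[of m n] less[of n m] by (cases m n rule: linorder_cases) (auto simp: mult.commute)
qed

text \<open>The second shift is positive because \<open>x p^2\<close> under \<open>s'\<close> is, up
  to the factor \<open>s 1\<close>, \<open>(x p)^2\<close> under \<open>s\<close>.\<close>

lemma stieltjes_seq_shift: "stieltjes_seq s' P'"
proof
  show "s' 0 = 1" using s1_pos by (simp add: s'_def)
  show "posdef s'" using pos_shift s1_pos by (simp add: posdef_def mlin_s')
  show "orthonormal s' P'" by (rule orthonormal_P')
  have "mlin s' (pCons 0 (p * p)) > 0" if "p \<noteq> 0" for p
    using pos[of "pCons 0 p"] that s1_pos by (simp add: mlin_s')
  then show "posdef (\<lambda>n. s' (Suc n))" by (simp add: posdef_def mlin_pCons)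
qed

lemma shift_p0: "stieltjes_seq.p0 P' n = c n * k0 n"
  using stieltjes_seq.p0_def[OF stieltjes_seq_shift, of n] by (simp add: P'_def k0_def)

lemma shift_q: "stieltjes_seq.q s' P' n = smult (c n / s 1) (C n - K n)"
proof -
  have "stieltjes_seq.q s' P' n = sk s' (P' n)"
    by (rule stieltjes_seq.q_def[OF stieltjes_seq_shift])
  also have "\<dots> = smult (c n / s 1) (sk (\<lambda>n. s (Suc n)) (K n))"
    unfolding s'_def sk_divide P'_def by (simp add: sk_smult)
  also have "\<dots> = smult (c n / s 1) (C n - K n)"
    using sk_D[of n] by (simp add: sk_shift s0 D_def)
  finally show ?thesis .
qed

lemma shift_q0: "stieltjes_seq.q0 s' P' n = c n / s 1 * (1 - k0 n)"
  using stieltjes_seq.q0_def[OF stieltjes_seq_shift, of n]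
  by (simp add: shift_q k0_def C_def)

lemma shift_\<sigma>: "stieltjes_seq.\<sigma> s' P' n = (1 - k0 n) / (s 1 * k0 n)"
  using stieltjes_seq.\<sigma>_def[OF stieltjes_seq_shift, of n]
  by (simp add: shift_p0 shift_q0)

context
  fixes z :: complex
begin

text \<open>The factor \<open>z\<close> in front of the sum turns \<open>K n\<close> into
  \<open>D n\<close>, and the two factors \<open>c n\<close> combine to
  \<open>s 1 * \<kappa> n\<close>. The other three entries follow the same pattern.\<close>

lemma shift_D:
  "cpoly (stieltjes_seq.D P' N) z = of_real (s 1) * (\<Sum>n\<le>N. of_real (\<kappa> n * k0 n) * cpoly (D n) z)"
proof -
  have "cpoly (stieltjes_seq.D P' N) z = (\<Sum>n\<le>N. of_real (c n * c n) * of_real (k0 n) * cpoly (D n) z)"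
    unfolding stieltjes_seq.cpoly_D[OF stieltjes_seq_shift] shift_p0 sum_distrib_left
    by (intro sum.cong) (simp_all add: P'_def cpoly_smult cpoly_D_K)
  then show ?thesis by (simp add: c_sq sum_distrib_left mult_ac)
qed

lemma shift_B:
  "cpoly (stieltjes_seq.B s' P' N) z = - 1 + (\<Sum>n\<le>N. of_real (\<kappa> n) * cpoly (D n) z)
     - (\<Sum>n\<le>N. of_real (\<kappa> n * k0 n) * cpoly (D n) z)"
proof -
  have "cpoly (stieltjes_seq.B s' P' N) z =
      - 1 + (\<Sum>n\<le>N. of_real (c n * c n) / of_real (s 1) * of_real (1 - k0 n) * cpoly (D n) z)"
    unfolding stieltjes_seq.cpoly_B[OF stieltjes_seq_shift] shift_q0 sum_distrib_left
    by (intro arg_cong2[where f = "(+)"] sum.cong) (simp_all add: P'_def cpoly_smult cpoly_D_K)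
  also have "\<dots> = - 1 + (\<Sum>n\<le>N. of_real (\<kappa> n) * cpoly (D n) z - of_real (\<kappa> n * k0 n) * cpoly (D n) z)"
    using s1_pos by (simp add: c_sq algebra_simps)
  finally show ?thesis by (simp add: sum_subtractf)
qed

lemma shift_C:
  "cpoly (stieltjes_seq.C s' P' N) z = 1 + z * (\<Sum>n\<le>N. of_real (\<kappa> n * k0 n) * cpoly (C n) z)
     - (\<Sum>n\<le>N. of_real (\<kappa> n * k0 n) * cpoly (D n) z)"
proof -
  have "cpoly (stieltjes_seq.C s' P' N) z =
      1 + (\<Sum>n\<le>N. of_real (c n * c n) / of_real (s 1) * of_real (k0 n) * (z * cpoly (C n) z - cpoly (D n) z))"
    unfolding stieltjes_seq.cpoly_C[OF stieltjes_seq_shift] shift_p0 shift_q sum_distrib_left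
    by (intro arg_cong2[where f = "(+)"] sum.cong)
      (simp_all add: cpoly_smult cpoly_diff cpoly_D_K algebra_simps diff_divide_distrib add_divide_distrib)
  also have "\<dots> = 1 + (\<Sum>n\<le>N. z * (of_real (\<kappa> n * k0 n) * cpoly (C n) z) - of_real (\<kappa> n * k0 n) * cpoly (D n) z)"
    using s1_pos by (simp add: c_sq algebra_simps)
  finally show ?thesis by (simp add: sum_subtractf sum_distrib_left)
qed

lemma shift_A:
  "cpoly (stieltjes_seq.A s' P' N) z =
     (z * (\<Sum>n\<le>N. of_real (\<kappa> n) * cpoly (C n) z) - (\<Sum>n\<le>N. of_real (\<kappa> n) * cpoly (D n) z)
     - z * (\<Sum>n\<le>N. of_real (\<kappa> n * k0 n) * cpoly (C n) z)
     + (\<Sum>n\<le>N. of_real (\<kappa> n * k0 n) * cpoly (D n) z)) / of_real (s 1)"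
proof -
  have "cpoly (stieltjes_seq.A s' P' N) z =
      (\<Sum>n\<le>N. of_real (c n * c n) / of_real (s 1) * of_real (1 - k0 n) * (z * cpoly (C n) z - cpoly (D n) z)) / of_real (s 1)"
    unfolding stieltjes_seq.cpoly_A[OF stieltjes_seq_shift] shift_q0 shift_q sum_distrib_left sum_divide_distrib
    by (intro sum.cong)
      (simp_all add: cpoly_smult cpoly_diff cpoly_D_K algebra_simps diff_divide_distrib add_divide_distrib)
  also have "\<dots> = (\<Sum>n\<le>N. z * (of_real (\<kappa> n) * cpoly (C n) z) - of_real (\<kappa> n) * cpoly (D n) z
      - z * (of_real (\<kappa> n * k0 n) * cpoly (C n) z) + of_real (\<kappa> n * k0 n) * cpoly (D n) z) / of_real (s 1)"
    using s1_pos by (intro arg_cong2[where f = "(/)"] sum.cong) (simp_all add: c_sq algebra_simps)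
  finally show ?thesis by (simp add: sum_subtractf sum.distrib sum_distrib_left)
qed

end

end

text \<open>The form in which indet(S) is used: convergence of the sum of \<open>p0\<close>-squares,
  and finiteness of the Friedrichs parameter. Both are extracted from two distinct Stieltjes
  solutions in \<open>stieltjes_indet_if_transforms_differ\<close>.\<close>

locale stieltjes_indet = stieltjes_seq +
  assumes summable_p0: "summable (\<lambda>n. (p0 n)\<^sup>2)"
    and \<sigma>_bdd: "\<exists>b. \<forall>n. b \<le> \<sigma> n"
begin

definition "F = - lim \<sigma>"
definition "Kinf = (\<Sum>n. (p0 n)\<^sup>2)"

lemma \<sigma>_tendsto: "\<sigma> \<longlonglongrightarrow> - F"
proof -
  obtain b where "\<forall>n. b \<le> \<sigma> n" using \<sigma>_bdd by blast
  then have "convergent \<sigma>"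
    using decseq_convergent[OF decseq_\<sigma>] convergentI by metis
  then show ?thesis by (simp add: F_def convergent_LIMSEQ_iff)
qed

lemma \<sigma>_ge: "- F \<le> \<sigma> n"
  using decseq_ge[OF decseq_\<sigma> \<sigma>_tendsto] .

lemma F_pos: "F > 0"
  using \<sigma>_ge[of 1] \<sigma>_less[of 0] by (simp add: \<sigma>_0)

lemma k0_tendsto: "k0 \<longlonglongrightarrow> Kinf"
  unfolding k0_eq Kinf_def using summable_LIMSEQ'[OF summable_p0] .

lemma Kinf_gt_1: "Kinf > 1"
proof -
  have "k0 1 \<le> Kinf"
    unfolding k0_eq Kinf_def by (intro sum_le_suminf summable_p0) auto
  moreover have "k0 1 > 1" by (simp add: k0_eq p0_0)
  ultimately show ?thesis by simp
qed

text \<open>After division by \<open>p0 n\<close> the recursion is of Volterra type, with kernel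
  bounded by \<open>F\<close> and summable weights \<open>(p0 k)^2\<close>, so Gronwall's inequality
  bounds the quotient uniformly in \<open>n\<close>. It serves \<open>P\<close> with
  \<open>a = 1\<close> and \<open>q\<close> with \<open>a = \<sigma>\<close>.\<close>

lemma bound_by_p0:
  assumes eq: "\<And>n. f n = of_real (p0 n) * (of_real (a n) + z * (\<Sum>k<n. of_real ((\<sigma> n - \<sigma> k) * p0 k) * f k))"
    and a: "\<And>n. \<bar>a n\<bar> \<le> a'"
  shows "\<exists>M. \<forall>n. norm (f n :: complex) \<le> M * \<bar>p0 n\<bar>"
proof -
  define y where "y n = norm (f n) / \<bar>p0 n\<bar>" for n
  have a': "a' \<ge> 0" using a[of 0] by linarith
  have "y n \<le> a' + (norm z * F) * (\<Sum>k<n. (p0 k)\<^sup>2 * y k)" for n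
  proof -
    have "y n = norm (of_real (a n) + z * (\<Sum>k<n. of_real ((\<sigma> n - \<sigma> k) * p0 k) * f k))"
      unfolding y_def by (subst eq) (simp add: norm_mult)
    also have "\<dots> \<le> \<bar>a n\<bar> + norm z * norm (\<Sum>k<n. of_real ((\<sigma> n - \<sigma> k) * p0 k) * f k)"
      by (rule order.trans[OF norm_triangle_ineq]) (simp add: norm_mult)
    also have "\<dots> \<le> a' + norm z * (\<Sum>k<n. F * ((p0 k)\<^sup>2 * y k))"
    proof (intro add_mono mult_left_mono a order.trans[OF norm_sum] sum_mono)
      fix k assume "k \<in> {..<n}"
      have "\<bar>\<sigma> n - \<sigma> k\<bar> \<le> F"
        using \<sigma>_ge[of n] \<sigma>_ge[of k] \<sigma>_le_0[of n] \<sigma>_le_0[of k] by linarith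
      then have "\<bar>\<sigma> n - \<sigma> k\<bar> * (\<bar>p0 k\<bar> * norm (f k)) \<le> F * (\<bar>p0 k\<bar> * norm (f k))"
        by (intro mult_right_mono) auto
      moreover have "\<bar>p0 k\<bar> * norm (f k) = (\<bar>p0 k\<bar> * \<bar>p0 k\<bar>) * y k"
        by (simp add: y_def del: abs_mult_self_eq)
      then have "\<bar>p0 k\<bar> * norm (f k) = (p0 k)\<^sup>2 * y k"
        by (simp add: power2_eq_square)
      ultimately show "norm (complex_of_real ((\<sigma> n - \<sigma> k) * p0 k) * f k) \<le> F * ((p0 k)\<^sup>2 * y k)"
        by (simp add: norm_mult abs_mult mult.assoc del: of_real_mult)
    qed auto
    finally show ?thesis by (simp add: sum_distrib_left mult.assoc)
  qed
  then have y: "y n \<le> a' * exp ((norm z * F) * (\<Sum>k<n. (p0 k)\<^sup>2))" for n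
    using a' F_pos by (intro discrete_gronwall) auto
  have "y n \<le> a' * exp ((norm z * F) * Kinf)" for n
    using F_pos a' unfolding Kinf_def
    by (intro order.trans[OF y] mult_left_mono iffD2[OF exp_le_cancel_iff] sum_le_suminf summable_p0) auto
  then show ?thesis
    by (intro exI[of _ "a' * exp ((norm z * F) * Kinf)"] allI) (simp add: y_def field_simps)
qed

lemma P_bound: "\<exists>M. \<forall>n. norm (cpoly (P n) z) \<le> M * \<bar>p0 n\<bar>"
proof (rule bound_by_p0[where a = "\<lambda>_. 1" and a' = 1])
  fix n
  have "cpoly (P n) z = of_real (p0 n) * (1 + z * (\<Sum>k\<le>n. of_real ((\<sigma> n - \<sigma> k) * p0 k) * cpoly (P k) z))"
    by (subst (1) P_eq) (simp add: cpoly_diff cpoly_smult cpoly_D cpoly_B q0_eq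
        sum_distrib_left sum_subtractf algebra_simps)
  then show "cpoly (P n) z = of_real (p0 n) * (of_real 1 + z * (\<Sum>k<n. of_real ((\<sigma> n - \<sigma> k) * p0 k) * cpoly (P k) z))"
    \<comment> \<open>The term \<open>k = n\<close> carries the factor
      \<open>\<sigma> n - \<sigma> n = 0\<close>, so the sum stops below \<open>n\<close>.\<close>
    by (simp add: lessThan_Suc_atMost[symmetric])
qed simp

lemma q_bound: "\<exists>M. \<forall>n. norm (cpoly (q n) z) \<le> M * \<bar>p0 n\<bar>"
proof (rule bound_by_p0[where a = \<sigma> and a' = F])
  fix n
  have "cpoly (q n) z = of_real (p0 n) * (of_real (\<sigma> n) + z * (\<Sum>k\<le>n. of_real ((\<sigma> n - \<sigma> k) * p0 k) * cpoly (q k) z))"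
    by (subst (1) q_eq) (simp add: cpoly_diff cpoly_smult cpoly_C cpoly_A q0_eq
        sum_distrib_left sum_subtractf algebra_simps)
  then show "cpoly (q n) z = of_real (p0 n) * (of_real (\<sigma> n) + z * (\<Sum>k<n. of_real ((\<sigma> n - \<sigma> k) * p0 k) * cpoly (q k) z))"
    by (simp add: lessThan_Suc_atMost[symmetric])
  show "\<bar>\<sigma> n\<bar> \<le> F" using \<sigma>_ge[of n] \<sigma>_le_0[of n] by simp
qed

lemma summable_mult:
  assumes "\<exists>M. \<forall>n. norm (f n :: complex) \<le> M * \<bar>p0 n\<bar>" "\<exists>M. \<forall>n. \<bar>g n\<bar> \<le> M * \<bar>p0 n\<bar>"
  shows "summable (\<lambda>n. of_real (g n) * f n)"
proof -
  obtain M where M: "\<And>n. norm (f n) \<le> M * \<bar>p0 n\<bar>" using assms by blast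
  obtain N where N: "\<And>n. \<bar>g n\<bar> \<le> N * \<bar>p0 n\<bar>" using assms by blast
  have "norm (of_real (g n) * f n) \<le> N * M * (p0 n)\<^sup>2" for n
  proof -
    have "\<bar>g n\<bar> * norm (f n) \<le> (N * \<bar>p0 n\<bar>) * (M * \<bar>p0 n\<bar>)"
      using M[of n] N[of n] abs_ge_zero[of "g n"] norm_ge_zero[of "f n"]
      by (intro mult_mono) (auto simp del: abs_ge_zero)
    then show ?thesis by (simp add: norm_mult power2_eq_square mult_ac flip: abs_mult)
  qed
  then show ?thesis
    by (intro summable_comparison_test'[OF summable_mult[OF summable_p0, of "N * M"]])
qed

lemma p0_bound: "\<exists>M. \<forall>n. \<bar>p0 n\<bar> \<le> M * \<bar>p0 n\<bar>"
  by (rule exI[of _ 1]) simp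

lemma q0_bound: "\<exists>M. \<forall>n. \<bar>q0 n\<bar> \<le> M * \<bar>p0 n\<bar>"
proof (intro exI allI)
  fix n
  have "\<bar>\<sigma> n\<bar> \<le> F" using \<sigma>_ge[of n] \<sigma>_le_0[of n] by simp
  then show "\<bar>q0 n\<bar> \<le> F * \<bar>p0 n\<bar>"
    unfolding q0_eq abs_mult by (intro mult_right_mono) auto
qed

section \<open>Pointwise limits of the Nevanlinna matrix\<close>

definition "Dinf z = z * (\<Sum>k. of_real (p0 k) * cpoly (P k) z)"
definition "Binf z = -1 + z * (\<Sum>k. of_real (q0 k) * cpoly (P k) z)"
definition "Cinf z = 1 + z * (\<Sum>k. of_real (p0 k) * cpoly (q k) z)"
definition "Ainf z = z * (\<Sum>k. of_real (q0 k) * cpoly (q k) z)"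

lemma tendsto_D: "(\<lambda>n. cpoly (D n) z) \<longlonglongrightarrow> Dinf z"
  unfolding cpoly_D Dinf_def
  by (intro tendsto_intros summable_LIMSEQ' summable_mult P_bound p0_bound)

lemma tendsto_B: "(\<lambda>n. cpoly (B n) z) \<longlonglongrightarrow> Binf z"
  unfolding cpoly_B Binf_def
  by (intro tendsto_intros summable_LIMSEQ' summable_mult P_bound q0_bound)

lemma tendsto_C: "(\<lambda>n. cpoly (C n) z) \<longlonglongrightarrow> Cinf z"
  unfolding cpoly_C Cinf_def
  by (intro tendsto_intros summable_LIMSEQ' summable_mult q_bound p0_bound)

lemma tendsto_A: "(\<lambda>n. cpoly (A n) z) \<longlonglongrightarrow> Ainf z"
  unfolding cpoly_A Ainf_def
  by (intro tendsto_intros summable_LIMSEQ' summable_mult q_bound q0_bound)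

lemma det_inf: "Ainf z * Dinf z - Binf z * Cinf z = 1"
proof -
  have "(\<lambda>n. cpoly (A n) z * cpoly (D n) z - cpoly (B n) z * cpoly (C n) z)
      \<longlonglongrightarrow> Ainf z * Dinf z - Binf z * Cinf z"
    by (intro tendsto_intros tendsto_A tendsto_B tendsto_C tendsto_D)
  then have "(\<lambda>n::nat. 1) \<longlonglongrightarrow> Ainf z * Dinf z - Binf z * Cinf z"
    by (simp add: cpoly_det)
  then show ?thesis using LIMSEQ_const_iff by metis
qed

text \<open>The square of \<open>T.p0 n\<close> is \<open>s 1 * \<kappa> n * (k0 n)^2\<close>, where
  \<open>\<kappa>\<close> telescopes and \<open>k0\<close> is bounded by \<open>Kinf\<close>; the
  lower bound for \<open>T.\<sigma>\<close> is read off from \<open>shift_\<sigma>\<close>.\<close>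

lemma stieltjes_indet_shift: "stieltjes_indet s' P'"
proof -
  interpret T: stieltjes_seq s' P' by (rule stieltjes_seq_shift)
  have "summable \<kappa>"
    unfolding \<kappa>_def using telescope_summable'[OF \<sigma>_tendsto] by simp
  then have sm: "summable (\<lambda>n. s 1 * \<kappa> n * Kinf\<^sup>2)"
    by (intro summable_mult2 Series.summable_mult)
  have "summable (\<lambda>n. (T.p0 n)\<^sup>2)"
  proof (rule summable_comparison_test'[OF sm])
    fix n
    have "k0 n \<le> Kinf" unfolding k0_eq Kinf_def by (intro sum_le_suminf summable_p0) auto
    then have "(k0 n)\<^sup>2 \<le> Kinf\<^sup>2" using k0_ge_1[of n] by (intro power_mono) auto
    moreover have "(T.p0 n)\<^sup>2 = s 1 * \<kappa> n * (k0 n)\<^sup>2"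
      by (simp add: shift_p0 power_mult_distrib power2_eq_square[of "c n"] c_sq)
    ultimately show "norm ((T.p0 n)\<^sup>2) \<le> s 1 * \<kappa> n * Kinf\<^sup>2"
      using s1_pos \<kappa>_pos[of n] by (simp add: mult_left_mono)
  qed
  moreover have "- 1 / s 1 \<le> T.\<sigma> n" for n
    using k0_ge_1[of n] s1_pos by (simp add: shift_\<sigma> field_simps)
  ultimately show ?thesis
    by unfold_locales blast+
qed

context
  fixes z :: complex
  assumes z: "z \<noteq> 0"
begin

lemma limits_\<kappa>:
  "(\<lambda>N. \<Sum>n\<le>N. of_real (\<kappa> n) * cpoly (D n) z) \<longlonglongrightarrow> 1 + Binf z + of_real F * Dinf z"
  "(\<lambda>N. \<Sum>n\<le>N. of_real (\<kappa> n) * cpoly (C n) z) \<longlonglongrightarrow> Ainf z + of_real F * Cinf z"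
  "(\<lambda>N. \<Sum>n\<le>N. of_real (\<kappa> n * k0 n) * cpoly (D n) z) \<longlonglongrightarrow>
     Dinf z / z + of_real Kinf * (Binf z + of_real F * Dinf z)"
  "(\<lambda>N. z * (\<Sum>n\<le>N. of_real (\<kappa> n * k0 n) * cpoly (C n) z)) \<longlonglongrightarrow>
     Cinf z - 1 + z * of_real Kinf * (Ainf z + of_real F * Cinf z)"
proof -
  have \<sigma>: "(\<lambda>N. complex_of_real (\<sigma> (Suc N))) \<longlonglongrightarrow> - of_real F"
    using tendsto_of_real[OF LIMSEQ_Suc[OF \<sigma>_tendsto], where 'a = complex] by simp
  have K: "(\<lambda>N. cpoly (K N) z) \<longlonglongrightarrow> Dinf z / z"
    using tendsto_divide[OF tendsto_D[of z] tendsto_const[of z]] z by (simp add: cpoly_D_K)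
  have k: "(\<lambda>N. complex_of_real (k0 N)) \<longlonglongrightarrow> of_real Kinf"
    by (intro tendsto_of_real k0_tendsto)
  note lims = \<sigma> K k tendsto_A[of z] tendsto_B[of z] tendsto_C[of z] tendsto_D[of z]
  show "(\<lambda>N. \<Sum>n\<le>N. of_real (\<kappa> n) * cpoly (D n) z) \<longlonglongrightarrow> 1 + Binf z + of_real F * Dinf z"
    unfolding sum_\<kappa>_D by (rule tendsto_eq_intros lims refl)+ simp
  show "(\<lambda>N. \<Sum>n\<le>N. of_real (\<kappa> n) * cpoly (C n) z) \<longlonglongrightarrow> Ainf z + of_real F * Cinf z"
    unfolding sum_\<kappa>_C by (rule tendsto_eq_intros lims refl)+ simp
  show "(\<lambda>N. \<Sum>n\<le>N. of_real (\<kappa> n * k0 n) * cpoly (D n) z) \<longlonglongrightarrow>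
     Dinf z / z + of_real Kinf * (Binf z + of_real F * Dinf z)"
    unfolding sum_\<kappa>_k0_D by (rule tendsto_eq_intros lims refl)+ simp
  show "(\<lambda>N. z * (\<Sum>n\<le>N. of_real (\<kappa> n * k0 n) * cpoly (C n) z)) \<longlonglongrightarrow>
     Cinf z - 1 + z * of_real Kinf * (Ainf z + of_real F * Cinf z)"
    unfolding sum_\<kappa>_k0_C by (rule tendsto_eq_intros lims refl)+ simp
qed

text \<open>\<open>U\<close> and \<open>W\<close> arise because \<open>\<sigma> (Suc N)\<close>
  tends to \<open>- F\<close>; \<open>- W / U\<close> is the transform of the Friedrichs solution of
  \<open>s\<close>.\<close>

lemma shift_inf:
  defines "U \<equiv> Binf z + of_real F * Dinf z" and "W \<equiv> Ainf z + of_real F * Cinf z"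
  shows "stieltjes_indet.Dinf P' z = of_real (s 1) * (of_real Kinf * U + Dinf z / z)"
    and "stieltjes_indet.Binf s' P' z = U - of_real Kinf * U - Dinf z / z"
    and "stieltjes_indet.Cinf s' P' z = of_real Kinf * (z * W - U) + (Cinf z - Dinf z / z)"
    and "stieltjes_indet.Ainf s' P' z =
      ((z * W - U) - of_real Kinf * (z * W - U) - (Cinf z - Dinf z / z)) / of_real (s 1)"
proof -
  interpret T: stieltjes_indet s' P' by (rule stieltjes_indet_shift)
  have s1: "complex_of_real (s 1) \<noteq> 0" using s1_pos by simp
  have "(\<lambda>N. cpoly (T.D N) z) \<longlonglongrightarrow> of_real (s 1) * (of_real Kinf * U + Dinf z / z)"
    unfolding shift_D by (rule tendsto_eq_intros limits_\<kappa> refl)+ (simp add: U_def)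
  then show "T.Dinf z = of_real (s 1) * (of_real Kinf * U + Dinf z / z)"
    using T.tendsto_D[of z] LIMSEQ_unique by blast
  have "(\<lambda>N. cpoly (T.B N) z) \<longlonglongrightarrow> U - of_real Kinf * U - Dinf z / z"
    unfolding shift_B by (rule tendsto_eq_intros limits_\<kappa> refl)+ (simp add: U_def)
  then show "T.Binf z = U - of_real Kinf * U - Dinf z / z"
    using T.tendsto_B[of z] LIMSEQ_unique by blast
  have "(\<lambda>N. cpoly (T.C N) z) \<longlonglongrightarrow> of_real Kinf * (z * W - U) + (Cinf z - Dinf z / z)"
    unfolding shift_C by (rule tendsto_eq_intros limits_\<kappa> refl)+ (simp add: U_def W_def algebra_simps)
  then show "T.Cinf z = of_real Kinf * (z * W - U) + (Cinf z - Dinf z / z)"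
    using T.tendsto_C[of z] LIMSEQ_unique by blast
  have "(\<lambda>N. cpoly (T.A N) z) \<longlonglongrightarrow>
      ((z * W - U) - of_real Kinf * (z * W - U) - (Cinf z - Dinf z / z)) / of_real (s 1)"
    unfolding shift_A by (rule tendsto_eq_intros limits_\<kappa> refl s1)+ (simp add: U_def W_def algebra_simps)
  then show "T.Ainf z = ((z * W - U) - of_real Kinf * (z * W - U) - (Cinf z - Dinf z / z)) / of_real (s 1)"
    using T.tendsto_A[of z] LIMSEQ_unique by blast
qed

end

end

section \<open>Solutions and Stieltjes transforms\<close>

lemma borel_measurable_eq_borel:
  "sets M = sets borel \<Longrightarrow> f \<in> borel_measurable borel \<Longrightarrow> f \<in> borel_measurable M"
  using measurable_cong_sets by blast

text \<open>By second countability the complement of the support is covered by countably many basic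
  open null sets.\<close>

lemma AE_msupport:
  fixes M :: "real measure"
  assumes "sets M = sets borel"
  shows "AE x in M. x \<in> msupport M"
proof -
  obtain B :: "real set set" where B: "countable B" "topological_basis B"
    using ex_countable_basis by blast
  define N where "N = \<Union>{b \<in> B. emeasure M b = 0}"
  have "open b" if "b \<in> B" for b using B(2) that topological_basis_open by blast
  then have s: "b \<in> sets M" if "b \<in> B" for b using that assms by auto
  have "N \<in> null_sets M"
    using null_sets_UN'[of "{b \<in> B. emeasure M b = 0}" "\<lambda>b. b" M] s countable_subset[OF _ B(1)]
    by (auto simp: N_def)
  moreover have "x \<in> N" if x: "x \<notin> msupport M" for x
  proof -
    obtain U where U: "open U" "x \<in> U" "emeasure M U = 0"
      using x by (auto simp: msupport_def)
    obtain b where b: "b \<in> B" "x \<in> b" "b \<subseteq> U"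
      using B(2) U topological_basisE by metis
    have "emeasure M b \<le> emeasure M U" using U assms b by (intro emeasure_mono) auto
    then show ?thesis using b U by (auto simp: N_def)
  qed
  ultimately show ?thesis
    by (intro AE_I'[of N]) auto
qed

lemma msupport_subset_iff:
  assumes "sets M = sets borel" "closed S"
  shows "msupport M \<subseteq> S \<longleftrightarrow> (AE x in M. x \<in> S)"
proof
  assume "msupport M \<subseteq> S"
  then show "AE x in M. x \<in> S" using AE_msupport[OF assms(1)] by (auto elim: eventually_mono)
next
  assume AE: "AE x in M. x \<in> S"
  show "msupport M \<subseteq> S"
  proof
    fix x assume x: "x \<in> msupport M"
    show "x \<in> S"
    proof (rule ccontr)
      assume "x \<notin> S"
      then have "emeasure M (- S) > 0" using x assms(2) by (auto simp: msupport_def open_Compl)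
      moreover have "emeasure M (- S) = 0"
        using AE assms by (subst emeasure_eq_0_AE[symmetric, where P = "\<lambda>x. x \<notin> S"])
          (auto simp: sets_eq_imp_space_eq[OF assms(1)] Compl_eq intro!: AE_iff_measurable[THEN iffD1])
      ultimately show False by simp
    qed
  qed
qed

lemma finite_measure_if_integrable_1:
  assumes "integrable M (\<lambda>x. 1 :: real)"
  shows "finite_measure M"
proof
  have "integrable M (indicator (space M) :: _ \<Rightarrow> real)"
    using assms Bochner_Integration.integrable_cong[of M M "indicator (space M)" "\<lambda>_. 1 :: real"] by simp
  then show "emeasure M (space M) \<noteq> \<infinity>"
    by (simp add: integrable_indicator_iff)
qed

lemma solutionsD:
  assumes "M \<in> solutions s"
  shows "sets M = sets borel" "space M = UNIV" "integrable M (\<lambda>x. x ^ n)"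
    "(\<integral>x. x ^ n \<partial>M) = s n" "infinite (msupport M)" "finite_measure M"
    "integrable M (\<lambda>x. poly p x)" "(\<integral>x. poly p x \<partial>M) = mlin s p"
proof -
  show 1: "sets M = sets borel" "integrable M (\<lambda>x. x ^ n)"
    "(\<integral>x. x ^ n \<partial>M) = s n" "infinite (msupport M)" for n
    using assms by (auto simp: solutions_def Mstar_def)
  show "space M = UNIV" using sets_eq_imp_space_eq[OF 1(1)] by simp
  show "finite_measure M" using 1(2)[of 0] by (intro finite_measure_if_integrable_1) simp
  show "integrable M (\<lambda>x. poly p x)" "(\<integral>x. poly p x \<partial>M) = mlin s p"
    using mlin_integral[of p M s] 1(2,3) by auto
qed

lemma posdef_if_solution:
  assumes M: "M \<in> solutions s"
  shows "posdef s"
  unfolding posdef_def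
proof (intro allI impI)
  fix p :: "real poly" assume p: "p \<noteq> 0"
  have int: "integrable M (\<lambda>x. poly (p * p) x)" by (rule solutionsD[OF M])
  have eq: "(\<integral>x. poly (p * p) x \<partial>M) = mlin s (p * p)" by (rule solutionsD[OF M])
  have "(\<integral>x. poly (p * p) x \<partial>M) \<ge> 0" by (intro Bochner_Integration.integral_nonneg) simp
  moreover have "(\<integral>x. poly (p * p) x \<partial>M) \<noteq> 0"
  proof
    assume "(\<integral>x. poly (p * p) x \<partial>M) = 0"
    then have "AE x in M. poly (p * p) x = 0"
      using integral_nonneg_eq_0_iff_AE[OF int] by simp
    then have AE: "AE x in M. x \<in> {x. poly p x = 0}" by simp
    have fin: "finite {x. poly p x = 0}" by (rule poly_roots_finite[OF p])
    then have "msupport M \<subseteq> {x. poly p x = 0}"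
      using msupport_subset_iff[OF solutionsD(1)[OF M], of "{x. poly p x = 0}"] AE
      by (simp add: finite_imp_closed)
    then show False using solutionsD(5)[OF M] fin finite_subset by blast
  qed
  ultimately show "mlin s (p * p) > 0" using eq by linarith
qed

text \<open>Infinite support follows from positivity: a polynomial vanishing on a finite support
  would be non-zero with a square of integral 0.\<close>

lemma solutionsI:
  assumes "posdef s" "sets M = sets borel" "\<And>n. integrable M (\<lambda>x. x ^ n)"
    and "\<And>n. (\<integral>x. x ^ n \<partial>M) = s n"
  shows "M \<in> solutions s"
proof -
  have "infinite (msupport M)"
  proof
    assume fin: "finite (msupport M)"
    define p where "p = (\<Prod>a\<in>msupport M. [:-a, 1:])"
    have "p \<noteq> 0" using fin by (simp add: p_def)
    then have "mlin s (p * p) > 0" using assms(1) by (simp add: posdef_def)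
    moreover have "(\<integral>x. poly (p * p) x \<partial>M) = mlin s (p * p)"
      using mlin_integral[of "p * p" M s] assms by auto
    moreover have "(\<integral>x. poly (p * p) x \<partial>M) = (\<integral>x. 0 \<partial>M)"
    proof (rule integral_cong_AE)
      show "AE x in M. poly (p * p) x = 0"
        using AE_msupport[OF assms(2)]
        by eventually_elim (use fin in \<open>auto simp: p_def poly_prod prod_zero_iff\<close>)
    qed (use mlin_integral(1)[of "p * p" M s] assms in auto)
    ultimately show False by simp
  qed
  then show ?thesis using assms by (auto simp: solutions_def Mstar_def)
qed

lemma solution_nonneg_iff:
  "M \<in> solutions s \<Longrightarrow> msupport M \<subseteq> {0..} \<longleftrightarrow> (AE x in M. x \<ge> 0)"
  using msupport_subset_iff[OF solutionsD(1), of M s "{0..}"] by simp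

lemma posdef_shift_if_stieltjes:
  assumes M: "M \<in> solutions s" and "msupport M \<subseteq> {0..}"
  shows "posdef (\<lambda>n. s (Suc n))"
  unfolding posdef_def
proof (intro allI impI)
  fix p :: "real poly" assume p: "p \<noteq> 0"
  have AE0: "AE x in M. x \<ge> 0" using assms solution_nonneg_iff by blast
  let ?f = "pCons 0 (p * p)"
  have int: "integrable M (\<lambda>x. poly ?f x)" by (rule solutionsD[OF M])
  have eq: "(\<integral>x. poly ?f x \<partial>M) = mlin s ?f" by (rule solutionsD[OF M])
  have nn: "AE x in M. 0 \<le> poly ?f x" using AE0 by eventually_elim simp
  have "(\<integral>x. poly ?f x \<partial>M) \<ge> 0" by (rule integral_nonneg_AE[OF nn])
  moreover have "(\<integral>x. poly ?f x \<partial>M) \<noteq> 0"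
  proof
    assume "(\<integral>x. poly ?f x \<partial>M) = 0"
    then have "AE x in M. poly ?f x = 0"
      using integral_nonneg_eq_0_iff_AE[OF int nn] by simp
    then have AE: "AE x in M. x \<in> {x. poly ?f x = 0}" by simp
    have fin: "finite {x. poly ?f x = 0}" using p by (intro poly_roots_finite) simp
    then have "msupport M \<subseteq> {x. poly ?f x = 0}"
      using msupport_subset_iff[OF solutionsD(1)[OF M], of "{x. poly ?f x = 0}"] AE
      by (simp add: finite_imp_closed)
    then show False using solutionsD(5)[OF M] fin finite_subset by blast
  qed
  ultimately show "mlin (\<lambda>n. s (Suc n)) (p * p) > 0"
    using eq by (simp add: mlin_pCons)
qed

section \<open>Stieltjes inversion and uniqueness\<close>

lemma inverse_diff_bound:
  assumes "Im z \<noteq> 0"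
  shows "norm (1 / (complex_of_real x - z)) \<le> 1 / \<bar>Im z\<bar>"
proof -
  have "\<bar>Im z\<bar> \<le> norm (complex_of_real x - z)"
    using abs_Im_le_cmod[of "complex_of_real x - z"] by simp
  then show ?thesis using assms by (simp add: norm_divide frac_le)
qed

lemma integrable_stieltjes_kernel:
  assumes "finite_measure M" "sets M = sets borel" "Im z \<noteq> 0"
  shows "integrable M (\<lambda>x. 1 / (complex_of_real x - z))"
  using inverse_diff_bound[OF assms(3)]
  by (intro finite_measure.integrable_const_bound[OF assms(1), where B = "1 / \<bar>Im z\<bar>"]
      borel_measurable_eq_borel[OF assms(2)]) auto

text \<open>The imaginary part of the kernel at \<open>u + i e\<close> is the Poisson kernel
  \<open>e / ((u - x)^2 + e^2)\<close>; integrating it over \<open>u \<ge> a\<close> and exchanging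
  the order of integration gives the arctangent.\<close>

lemma stieltjes_inversion_aux:
  fixes a e :: real
  assumes fin: "finite_measure M" and sets: "sets M = sets borel" and "e > 0"
  shows "(\<integral>\<^sup>+x. ennreal (pi / 2 - arctan ((a - x) / e)) \<partial>M) =
    (\<integral>\<^sup>+u. ennreal (Im (\<integral>x. 1 / (complex_of_real x - Complex u e) \<partial>M)) * indicator {a..} u \<partial>lborel)"
proof -
  interpret finite_measure M by fact
  interpret pair_sigma_finite M lborel ..
  define f where "f x u = e / ((u - x)\<^sup>2 + e\<^sup>2)" for x u :: real
  have pos: "(u - x)\<^sup>2 + e\<^sup>2 > 0" for u x
    using \<open>e > 0\<close> by (intro add_nonneg_pos) auto
  have f_nn: "f x u \<ge> 0" for x u using pos[of u x] \<open>e > 0\<close> by (simp add: f_def)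
  have 1: "(\<integral>\<^sup>+u. ennreal (f x u) * indicator {a..} u \<partial>lborel) = ennreal (pi / 2 - arctan ((a - x) / e))" for x
  proof (rule nn_integral_FTC_atLeast)
    show "(\<lambda>u. f x u) \<in> borel_measurable borel" unfolding f_def by measurable
    show "DERIV (\<lambda>u. arctan ((u - x) / e)) u :> f x u" for u
    proof -
      have "DERIV (\<lambda>u. arctan ((u - x) / e)) u :> (1 / e) * inverse (1 + ((u - x) / e)\<^sup>2)"
        using \<open>e > 0\<close> by (auto intro!: derivative_eq_intros simp: field_simps)
      moreover have "(1 / e) * inverse (1 + ((u - x) / e)\<^sup>2) = f x u"
        using \<open>e > 0\<close> pos[of u x] by (simp add: f_def field_simps power2_eq_square)
      ultimately show ?thesis by simp
    qed
    have "filterlim (\<lambda>u. (u - x) / e) at_top at_top"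
      using \<open>e > 0\<close> by real_asymp
    then show "((\<lambda>u. arctan ((u - x) / e)) \<longlongrightarrow> pi / 2) at_top"
      by (rule filterlim_compose[OF tendsto_arctan_at_top])
  qed (use f_nn in auto)
  have 2: "(\<integral>\<^sup>+x. ennreal (f x u) \<partial>M) = ennreal (Im (\<integral>x. 1 / (complex_of_real x - Complex u e) \<partial>M))" for u
  proof -
    have int: "integrable M (\<lambda>x. 1 / (complex_of_real x - Complex u e))"
      using \<open>e > 0\<close> by (intro integrable_stieltjes_kernel fin sets) auto
    have Im: "Im (1 / (complex_of_real x - Complex u e)) = f x u" for x
      by (simp add: Im_divide f_def power2_commute)
    have "integrable M (\<lambda>x. Im (1 / (complex_of_real x - Complex u e)))"
      by (rule integrable_Im[OF int])
    then have "integrable M (\<lambda>x. f x u)" unfolding Im .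
    then have "(\<integral>\<^sup>+x. ennreal (f x u) \<partial>M) = ennreal (\<integral>x. f x u \<partial>M)"
      by (intro nn_integral_eq_integral) (auto simp: f_nn)
    also have "(\<integral>x. f x u \<partial>M) = Im (\<integral>x. 1 / (complex_of_real x - Complex u e) \<partial>M)"
      using integral_Im[OF int] unfolding Im by simp
    finally show ?thesis .
  qed
  have m: "(\<lambda>x. x) \<in> measurable M borel" by (rule borel_measurable_eq_borel[OF sets]) simp
  have "case_prod (\<lambda>x u. ennreal (f x u) * indicator {a..} u) \<in> borel_measurable (M \<Otimes>\<^sub>M lborel)"
    unfolding f_def using m by measurable
  then have "(\<integral>\<^sup>+u. (\<integral>\<^sup>+x. ennreal (f x u) * indicator {a..} u \<partial>M) \<partial>lborel) =
      (\<integral>\<^sup>+x. (\<integral>\<^sup>+u. ennreal (f x u) * indicator {a..} u \<partial>lborel) \<partial>M)"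
    by (rule Fubini')
  moreover have "(\<integral>\<^sup>+x. ennreal (f x u) * indicator {a..} u \<partial>M) = (\<integral>\<^sup>+x. ennreal (f x u) \<partial>M) * indicator {a..} u" for u
    by (intro nn_integral_multc borel_measurable_eq_borel[OF sets]) (unfold f_def, measurable)
  ultimately show ?thesis unfolding 1 2 by simp
qed

text \<open>The shift \<open>1 / (k + 1)\<close> of \<open>a\<close> dominates the height
  \<open>1 / (k + 1)^2\<close>. Thus at \<open>x = a\<close> the arctangent has argument
  \<open>k + 1\<close>, the integrand tends to 0 there, and an atom at \<open>a\<close> is excluded
  instead of being counted by half.\<close>

lemma stieltjes_inversion:
  fixes a :: real
  assumes fin: "finite_measure M" and sets: "sets M = sets borel"
  defines "g \<equiv> (\<lambda>k::nat. \<lambda>x. pi / 2 - arctan ((a + 1 / real (Suc k) - x) / (1 / (real (Suc k))\<^sup>2)))"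
  shows "(\<lambda>k. enn2real (\<integral>\<^sup>+x. ennreal (g k x) \<partial>M)) \<longlonglongrightarrow> pi * measure M {a<..}"
proof -
  interpret finite_measure M by fact
  have g_bd: "\<bar>g k x\<bar> \<le> pi" "g k x \<ge> 0" for k x
    using arctan_bounded[of "(a + 1 / real (Suc k) - x) / (1 / (real (Suc k))\<^sup>2)"]
    unfolding g_def by linarith+
  have gm: "g k \<in> borel_measurable M" for k
    by (rule borel_measurable_eq_borel[OF sets]) (simp add: g_def)
  have "integrable M (g k)" for k
    using g_bd gm by (intro integrable_const_bound[where B = pi]) auto
  then have "(\<integral>\<^sup>+x. ennreal (g k x) \<partial>M) = ennreal (\<integral>x. g k x \<partial>M)" for k
    using g_bd by (intro nn_integral_eq_integral) auto
  then have eq: "enn2real (\<integral>\<^sup>+x. ennreal (g k x) \<partial>M) = (\<integral>x. g k x \<partial>M)" for k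
    using g_bd by simp
  have "(\<lambda>k. \<integral>x. g k x \<partial>M) \<longlonglongrightarrow> (\<integral>x. pi * indicator {a<..} x \<partial>M)"
  proof (rule integral_dominated_convergence)
    show "AE x in M. (\<lambda>k. g k x) \<longlonglongrightarrow> pi * indicator {a<..} x"
    proof (rule AE_I2)
      fix x
      show "(\<lambda>k. g k x) \<longlonglongrightarrow> pi * indicator {a<..} x"
      proof (cases "x > a")
        case True
        then have "filterlim (\<lambda>k. (a + 1 / real (Suc k) - x) / (1 / (real (Suc k))\<^sup>2)) at_bot sequentially"
          by real_asymp
        from tendsto_diff[OF tendsto_const filterlim_compose[OF tendsto_arctan_at_bot this], of "pi / 2"]
        show ?thesis using True by (simp add: g_def)
      next
        case False
        have "filterlim (\<lambda>k. (a + 1 / real (Suc k) - x) / (1 / (real (Suc k))\<^sup>2)) at_top sequentially"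
        proof (rule filterlim_at_top_mono)
          show "filterlim (\<lambda>k. real (Suc k)) at_top sequentially" by real_asymp
          show "\<forall>\<^sub>F k in sequentially. real (Suc k) \<le> (a + 1 / real (Suc k) - x) / (1 / (real (Suc k))\<^sup>2)"
          proof (rule always_eventually, rule allI)
            fix k
            have "(1 / real (Suc k)) * (real (Suc k))\<^sup>2 \<le> (a + 1 / real (Suc k) - x) * (real (Suc k))\<^sup>2"
              using False by (intro mult_right_mono) auto
            moreover have "(1 / real (Suc k)) * (real (Suc k))\<^sup>2 = real (Suc k)"
              by (simp add: power2_eq_square)
            ultimately show "real (Suc k) \<le> (a + 1 / real (Suc k) - x) / (1 / (real (Suc k))\<^sup>2)"
              by simp
          qed
        qed
        from tendsto_diff[OF tendsto_const filterlim_compose[OF tendsto_arctan_at_top this], of "pi / 2"]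
        show ?thesis using False by (simp add: g_def)
      qed
    qed
    show "AE x in M. norm (g k x) \<le> pi" for k using g_bd by simp
  qed (use gm sets in \<open>auto intro!: borel_measurable_eq_borel[OF sets]\<close>)
  then show ?thesis unfolding eq using sets by simp
qed

theorem stieltjes_transform_unique:
  assumes "finite_measure M" "finite_measure N" "sets M = sets borel" "sets N = sets borel"
    and eq: "\<And>z. Im z \<noteq> 0 \<Longrightarrow>
      (\<integral>x. 1 / (complex_of_real x - z) \<partial>M) = (\<integral>x. 1 / (complex_of_real x - z) \<partial>N)"
  shows "M = N"
proof (rule measure_eqI_lessThan)
  fix a :: real
  interpret M: finite_measure M by fact
  interpret N: finite_measure N by fact
  show "emeasure M {a<..} < \<infinity>" by (simp add: M.emeasure_eq_measure)
  have inv: "(\<integral>\<^sup>+x. ennreal (pi / 2 - arctan ((b - x) / e)) \<partial>M) =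
      (\<integral>\<^sup>+x. ennreal (pi / 2 - arctan ((b - x) / e)) \<partial>N)" if "e > 0" for b e
    using that by (simp add: stieltjes_inversion_aux assms(1-4) eq)
  have "(\<integral>\<^sup>+x. ennreal (pi / 2 - arctan ((a + 1 / real (Suc k) - x) / (1 / (real (Suc k))\<^sup>2))) \<partial>M) =
      (\<integral>\<^sup>+x. ennreal (pi / 2 - arctan ((a + 1 / real (Suc k) - x) / (1 / (real (Suc k))\<^sup>2))) \<partial>N)" for k
    by (intro inv) simp
  then have "pi * measure M {a<..} = pi * measure N {a<..}"
    using stieltjes_inversion[OF assms(1,3), of a] stieltjes_inversion[OF assms(2,4), of a]
    by (intro LIMSEQ_unique[OF stieltjes_inversion[OF assms(1,3), of a]]) simp
  then show "emeasure M {a<..} = emeasure N {a<..}"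
    by (simp add: M.emeasure_eq_measure N.emeasure_eq_measure)
qed (use assms in auto)

section \<open>Transforms of measures on the half-line\<close>

lemma open_slit_plane: "open (- (complex_of_real ` {0..}))"
proof -
  have "complex_of_real ` {0..} = \<real>\<^sub>\<ge>\<^sub>0" by (auto simp: nonneg_Reals_def)
  then show ?thesis using closed_nonneg_Reals_complex by (simp add: open_Compl)
qed

text \<open>Replacing \<open>x\<close> by \<open>max 0 x\<close> keeps the kernel bounded near each
  point of the slit plane for every \<open>x\<close>, and changes nothing for a measure carried by
  the half-line. The derivative comes from a direct estimate of the difference quotient.\<close>

lemma holomorphic_stieltjes_transform:
  assumes fin: "finite_measure M" and sets: "sets M = sets borel"
  shows "(\<lambda>z. \<integral>x. 1 / (complex_of_real (max 0 x) - z) \<partial>M) holomorphic_on - (complex_of_real ` {0..})"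
    (is "?G holomorphic_on ?S")
proof -
  interpret finite_measure M by fact
  have "open ?S" by (rule open_slit_plane)
  have "\<exists>D. (?G has_field_derivative D) (at z)" if zS: "z \<in> ?S" for z
  proof -
    obtain r where r: "r > 0" "ball z r \<subseteq> ?S" by (rule openE[OF \<open>open ?S\<close> zS])
    define d where "d = r / 2"
    have d: "d > 0" using r by (simp add: d_def)
    have lower: "norm (complex_of_real (max 0 x) - w) \<ge> d" if "dist z w < d" for x w
    proof (rule ccontr)
      assume "\<not> ?thesis"
      then have "dist z (complex_of_real (max 0 x)) < r"
        using that dist_triangle[of z "complex_of_real (max 0 x)" w]
        by (simp add: d_def dist_norm norm_minus_commute)
      then have "complex_of_real (max 0 x) \<in> ?S" using r by auto
      then show False by auto
    qed
    have bd: "norm (1 / (complex_of_real (max 0 x) - w)) \<le> 1 / d" if "dist z w < d" for x w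
      using lower[OF that, of x] d by (simp add: norm_divide frac_le)
    have int1: "integrable M (\<lambda>x. 1 / (complex_of_real (max 0 x) - w))" if "dist z w < d" for w
      using bd[OF that] by (intro integrable_const_bound[where B = "1 / d"] borel_measurable_eq_borel[OF sets]) auto
    have bd2: "norm (1 / (complex_of_real (max 0 x) - z)\<^sup>2) \<le> 1 / d\<^sup>2" for x
    proof -
      have "norm (1 / (complex_of_real (max 0 x) - z)) ^ 2 \<le> (1 / d) ^ 2"
        using bd[of z x] d by (intro power_mono) auto
      then show ?thesis by (simp add: norm_power norm_divide power_divide)
    qed
    have int2: "integrable M (\<lambda>x. 1 / (complex_of_real (max 0 x) - z)\<^sup>2)"
      using bd2 by (intro integrable_const_bound[where B = "1 / d\<^sup>2"] borel_measurable_eq_borel[OF sets]) auto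
    define D where "D = (\<integral>x. 1 / (complex_of_real (max 0 x) - z)\<^sup>2 \<partial>M)"
    have est: "norm ((?G w - ?G z) / (w - z) - D) \<le> norm (w - z) * (1 / d ^ 3 * measure M (space M))"
      if w: "dist z w < d" "w \<noteq> z" for w
    proof -
      let ?h = "\<lambda>x. (w - z) * (1 / (complex_of_real (max 0 x) - z)\<^sup>2 * (1 / (complex_of_real (max 0 x) - w)))"
      have nz: "complex_of_real (max 0 x) - w \<noteq> 0" "complex_of_real (max 0 x) - z \<noteq> 0" for x
        using order.strict_trans2[OF d lower[OF w(1), of x]] order.strict_trans2[OF d lower[of z x]] d
        unfolding zero_less_norm_iff by simp_all
      have "(?G w - ?G z) / (w - z) - D =
        (\<integral>x. (1 / (complex_of_real (max 0 x) - w) - 1 / (complex_of_real (max 0 x) - z)) / (w - z)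
          - 1 / (complex_of_real (max 0 x) - z)\<^sup>2 \<partial>M)"
        using int1[OF w(1)] int1[of z] int2 d unfolding D_def by simp
      also have "\<dots> = (\<integral>x. ?h x \<partial>M)"
      proof (rule Bochner_Integration.integral_cong[OF refl])
        fix x
        have "(1 / (u - w) - 1 / (u - z)) / (w - z) - 1 / (u - z)\<^sup>2 = (w - z) * (1 / (u - z)\<^sup>2 * (1 / (u - w)))"
          if "u - w \<noteq> 0" "u - z \<noteq> 0" for u :: complex
        proof -
          have "(1 / (u - w) - 1 / (u - z)) / (w - z) = 1 / ((u - w) * (u - z))"
            using that w by (simp add: diff_frac_eq)
          moreover have "1 / ((u - w) * (u - z)) - 1 / (u - z)\<^sup>2 = (w - z) * (1 / (u - z)\<^sup>2 * (1 / (u - w)))"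
            using that by (simp add: divide_simps power2_eq_square)
          ultimately show ?thesis by simp
        qed
        then show "(1 / (complex_of_real (max 0 x) - w) - 1 / (complex_of_real (max 0 x) - z)) / (w - z)
          - 1 / (complex_of_real (max 0 x) - z)\<^sup>2 = ?h x" using nz by blast
      qed
      also have "norm \<dots> \<le> (\<integral>x. norm (w - z) * (1 / d ^ 3) \<partial>M)"
      proof (rule Bochner_Integration.integral_norm_bound_integral)
        have bdh: "norm (?h x) \<le> norm (w - z) * (1 / d ^ 3)" for x
        proof -
          have "norm (1 / (complex_of_real (max 0 x) - z)\<^sup>2) * norm (1 / (complex_of_real (max 0 x) - w)) \<le> 1 / d\<^sup>2 * (1 / d)"
            using bd2[of x] bd[OF w(1), of x] d by (intro mult_mono) auto
          then show ?thesis unfolding norm_mult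
            by (intro mult_left_mono) (auto simp: power2_eq_square power3_eq_cube)
        qed
        then show "norm (?h x) \<le> norm (w - z) * (1 / d ^ 3)" for x .
        show "integrable M ?h"
          using bdh by (intro integrable_const_bound[where B = "norm (w - z) * (1 / d ^ 3)"] borel_measurable_eq_borel[OF sets]) auto
      qed simp
      finally show ?thesis by (simp add: mult_ac)
    qed
    have lim: "((\<lambda>w. norm (w - z) * (1 / d ^ 3 * measure M (space M))) \<longlongrightarrow> 0) (at z)"
      by (rule tendsto_eq_intros refl)+ simp
    have ev: "\<forall>\<^sub>F w in at z. norm ((?G w - ?G z) / (w - z) - D) \<le> norm (w - z) * (1 / d ^ 3 * measure M (space M))"
      unfolding eventually_at using est d by (intro exI[of _ d]) (auto simp: dist_commute)
    have "((\<lambda>w. (?G w - ?G z) / (w - z) - D) \<longlongrightarrow> 0) (at z)"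
      by (rule Lim_null_comparison[OF ev lim])
    then have "((\<lambda>w. (?G w - ?G z) / (w - z)) \<longlongrightarrow> D) (at z)"
      by (rule LIM_zero_cancel)
    then show ?thesis by (intro exI[of _ D]) (simp add: has_field_derivative_iff)
  qed
  then show ?thesis
    unfolding holomorphic_on_open[OF \<open>open ?S\<close>] by blast
qed

text \<open>The slit plane is connected and the negative axis accumulates in it, so the identity
  theorem applies. In this way two Stieltjes solutions are told apart at some \<open>x < 0\<close>,
  where positivity arguments are available.\<close>

theorem stieltjes_transform_unique_neg_axis:
  fixes M N :: "real measure"
  assumes "finite_measure M" "finite_measure N" "sets M = sets borel" "sets N = sets borel"
    and M0: "AE x in M. x \<ge> 0" and N0: "AE x in N. x \<ge> 0"
    and eq: "\<And>x. x < 0 \<Longrightarrow> (\<integral>u. 1 / (u - x) \<partial>M) = (\<integral>u. 1 / (u - x) \<partial>N)"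
  shows "M = N"
proof (rule stieltjes_transform_unique)
  fix z :: complex assume z: "Im z \<noteq> 0"
  let ?S = "- (complex_of_real ` {0..})"
  let ?G = "\<lambda>M z. \<integral>x. 1 / (complex_of_real (max 0 x) - z) \<partial>M"
  have G: "(\<integral>x. 1 / (complex_of_real x - z) \<partial>M) = ?G M z"
    if "AE x in M. x \<ge> 0" "sets M = sets borel" for M z
    by (rule integral_cong_AE) (use that in \<open>auto elim!: eventually_mono
      intro!: borel_measurable_eq_borel[OF that(2)] simp: max_absorb2\<close>)
  have neg: "?G M (complex_of_real x) = complex_of_real (\<integral>u. 1 / (u - x) \<partial>M)"
    if "AE x in M. x \<ge> 0" "sets M = sets borel" for M x
  proof -
    have "?G M (complex_of_real x) = (\<integral>u. complex_of_real (1 / (u - x)) \<partial>M)"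
      by (subst G[OF that, symmetric]) simp
    then show ?thesis by (simp only: integral_complex_of_real)
  qed
  have "?G M z - ?G N z = 0"
  proof (rule analytic_continuation[of "\<lambda>z. ?G M z - ?G N z" ?S "complex_of_real ` {..<0}" "-1"])
    show "(\<lambda>z. ?G M z - ?G N z) holomorphic_on ?S"
      using assms by (intro holomorphic_intros holomorphic_stieltjes_transform)
    show "open ?S" by (rule open_slit_plane)
    show "connected ?S" by (intro starlike_imp_connected starlike_slotted_complex_plane_right)
    show "complex_of_real ` {..<0} \<subseteq> ?S" by auto
    show "- 1 \<in> ?S" by (auto simp: complex_eq_iff)
    show "- 1 islimpt complex_of_real ` {..<0}"
    proof -
      have "(- 1 :: real) islimpt {..<0}" by (intro open_imp_islimpt) auto
      then have "complex_of_real (- 1) islimpt complex_of_real ` {..<0}"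
        by (intro islimpt_isCont_image) (auto simp: eventually_at complex_eq_iff intro!: exI[of _ 1])
      then show ?thesis by simp
    qed
    show "?G M w - ?G N w = 0" if "w \<in> complex_of_real ` {..<0}" for w
      using that eq by (auto simp: neg M0 N0 assms(3,4))
    show "z \<in> ?S" using z by auto
  qed
  then show "(\<integral>x. 1 / (complex_of_real x - z) \<partial>M) = (\<integral>x. 1 / (complex_of_real x - z) \<partial>N)"
    by (simp add: G M0 N0 assms(3,4))
qed (use assms in auto)

section \<open>Existence of the N-extremal solutions\<close>

lemma prod_linear_dvd:
  fixes h :: "real poly"
  assumes "finite Z" "\<And>x. x \<in> Z \<Longrightarrow> poly h x = 0"
  shows "(\<Prod>x\<in>Z. [:-x, 1:]) dvd h"
  using assms
proof (induction Z rule: finite_induct)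
  case (insert x Z)
  then obtain k where k: "h = (\<Prod>x\<in>Z. [:-x, 1:]) * k" by auto
  have "poly (\<Prod>x\<in>Z. [:-x, 1:]) x \<noteq> 0"
    using insert.hyps by (auto simp: poly_prod)
  moreover have "poly h x = 0" using insert.prems by simp
  ultimately have "poly k x = 0" by (simp add: k)
  then obtain l where l: "k = [:-x, 1:] * l" using poly_eq_0_iff_dvd by (metis dvdE)
  have ins: "(\<Prod>x\<in>insert x Z. [:-x, 1:]) = [:-x, 1:] * (\<Prod>x\<in>Z. [:-x, 1:])"
    by (rule prod.insert[OF insert.hyps])
  have "h = (\<Prod>x\<in>insert x Z. [:-x, 1:]) * l"
    unfolding k l ins by (simp only: mult_ac)
  then show ?case by simp
qed simp

lemma degree_prod_linear: "finite Z \<Longrightarrow> degree (\<Prod>x\<in>Z. [:-x, 1 :: real:]) = card Z"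
  by (subst degree_prod_eq_sum_degree) auto

text \<open>\<open>R\<close> may have degree \<open>n\<close> or \<open>n + 1\<close> while being
  orthogonal only to degrees below \<open>n\<close>; this leaves room for the combinations
  \<open>a B n + b D n\<close>.\<close>

locale quasi_orthogonal =
  fixes s :: "nat \<Rightarrow> real" and R :: "real poly" and n :: nat
  assumes s0: "s 0 = 1" and posdef: "posdef s"
    and n: "n \<ge> 1" and R_nz: "R \<noteq> 0" and degR: "degree R \<le> Suc n"
    and orth: "\<And>g. degree g < n \<Longrightarrow> mlin s (R * g) = 0"
begin

text \<open>Excludes conjugate zeros \<open>a + i b\<close>, \<open>a - i b\<close> and, for
  \<open>b = 0\<close>, a double real zero at once: \<open>R * S\<close> is
  \<open>((x - a) S)^2 + b^2 S^2\<close>, of positive value, although \<open>S\<close> has degree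
  below \<open>n\<close>.\<close>

lemma no_quadratic_factor:
  assumes "R = [:a\<^sup>2 + b\<^sup>2, - 2 * a, 1:] * S"
  shows False
proof -
  have S: "S \<noteq> 0" using assms R_nz by auto
  have "degree R = 2 + degree S" unfolding assms using S by (subst degree_mult_eq) auto
  then have "mlin s (R * S) = 0" using degR n by (intro orth) simp
  moreover have "R * S = ([:-a, 1:] * S) * ([:-a, 1:] * S) + smult (b\<^sup>2) (S * S)"
  proof -
    have "[:a\<^sup>2 + b\<^sup>2, - 2 * a, 1:] = [:-a, 1:] * [:-a, 1:] + [:b\<^sup>2:]"
      by (simp add: power2_eq_square)
    then have "R * S = ([:-a, 1:] * [:-a, 1:]) * S * S + [:b\<^sup>2:] * S * S"
      unfolding assms by (simp only: distrib_right)
    moreover have "[:b\<^sup>2:] * S * S = smult (b\<^sup>2) (S * S)" by simp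
    ultimately show ?thesis by (simp only: mult_ac)
  qed
  moreover have "mlin s (([:-a, 1:] * S) * ([:-a, 1:] * S)) > 0"
    using posdef S unfolding posdef_def by (metis mult_eq_0_iff pCons_eq_0_iff zero_neq_one)
  moreover have "mlin s (smult (b\<^sup>2) (S * S)) \<ge> 0"
    unfolding mlin_smult using posdef S
    by (intro mult_nonneg_nonneg zero_le_power2 less_imp_le) (simp add: posdef_def)
  ultimately show False by (simp only: mlin_add)
qed

lemma degree_ge: "degree R \<ge> n"
proof (rule ccontr)
  assume "\<not> ?thesis"
  then have "mlin s (R * R) = 0" by (intro orth) simp
  then show False using posdef R_nz by (auto simp: posdef_def)
qed

lemma complex_root_real:
  assumes "cpoly R z = 0"
  shows "Im z = 0"
proof (rule ccontr)
  assume im: "Im z \<noteq> 0"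
  \<comment> \<open>The real quadratic with roots \<open>z\<close> and its conjugate. The remainder
    of \<open>R\<close> modulo \<open>Q\<close> is real of degree at most 1 and vanishes at the
    non-real \<open>z\<close>, hence is 0.\<close>
  define Q where "Q = [:(Re z)\<^sup>2 + (Im z)\<^sup>2, - 2 * Re z, 1:]"
  have Q: "cpoly Q z = 0"
    by (simp add: Q_def cpoly_pCons complex_eq_iff power2_eq_square algebra_simps)
  have eq: "R = Q * (R div Q) + R mod Q" by simp
  have "cpoly R z = cpoly Q z * cpoly (R div Q) z + cpoly (R mod Q) z"
    by (simp flip: cpoly_add cpoly_mult)
  then have m: "cpoly (R mod Q) z = 0" using assms Q by simp
  have "degree Q = 2" by (simp add: Q_def)
  then have "R mod Q = 0 \<or> degree (R mod Q) < 2"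
    using degree_mod_less[of Q R] by fastforce
  then have "degree (R mod Q) \<le> 1" by auto
  obtain c T where T: "R mod Q = pCons c T" by (rule pCons_cases)
  with \<open>degree (R mod Q) \<le> 1\<close> have "degree T = 0" by (cases "T = 0") auto
  then obtain d where "T = [:d:]" by (rule degree_eq_zeroE)
  with T have cd: "R mod Q = [:c, d:]" by simp
  have "of_real c + z * of_real d = 0" using m unfolding cd by (simp add: cpoly_pCons)
  then have "d = 0" "c = 0" using im by (auto simp: complex_eq_iff)
  then have "R mod Q = 0" using cd by simp
  then have "R = Q * (R div Q)" using eq by (metis add.right_neutral)
  then show False unfolding Q_def by (rule no_quadratic_factor)
qed

definition "Z = {x. poly R x = 0}"
definition "G = (\<Prod>x\<in>Z. [:-x, 1:])"

lemma finite_Z: "finite Z" unfolding Z_def by (rule poly_roots_finite[OF R_nz])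

text \<open>A non-constant cofactor \<open>S\<close> of \<open>G\<close> would have a complex zero;
  it is a zero of \<open>R\<close>, hence real and already in \<open>Z\<close>, hence a double zero
  of \<open>R\<close>, which \<open>no_quadratic_factor\<close> forbids with
  \<open>b = 0\<close>.\<close>

lemma R_eq: "\<exists>c. c \<noteq> 0 \<and> R = smult c G"
proof -
  have "G dvd R" unfolding G_def by (rule prod_linear_dvd[OF finite_Z]) (simp add: Z_def)
  then obtain S where S: "R = G * S" by auto
  have "degree S = 0"
  proof (rule ccontr)
    assume d: "degree S \<noteq> 0"
    have "degree (map_poly complex_of_real S) \<noteq> 0" using d by (simp add: degree_map_poly)
    then have "\<not> constant (poly (map_poly complex_of_real S))" by (simp add: constant_degree)
    from fundamental_theorem_of_algebra[OF this] obtain z where "cpoly S z = 0"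
      by (auto simp: cpoly_def)
    moreover from this have "cpoly R z = 0"
      using arg_cong[OF S, of "\<lambda>p. cpoly p z"] by (simp add: cpoly_mult)
    then have "Im z = 0" by (rule complex_root_real)
    then obtain a where "z = complex_of_real a" by (metis complex_is_Real_iff Reals_cases)
    ultimately have a: "poly S a = 0" by (simp add: cpoly_of_real)
    then have "poly R a = 0" using arg_cong[OF S, of "\<lambda>p. poly p a"] by simp
    then have "a \<in> Z" by (simp add: Z_def)
    then have "G = [:-a, 1:] * (\<Prod>x\<in>Z - {a}. [:-x, 1:])"
      unfolding G_def using finite_Z by (subst prod.remove[of _ a]) auto
    moreover obtain T where "S = [:-a, 1:] * T" using a poly_eq_0_iff_dvd by (metis dvdE)
    ultimately have "G * S = ([:-a, 1:] * [:-a, 1:]) * ((\<Prod>x\<in>Z - {a}. [:-x, 1:]) * T)"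
      by (simp only: mult_ac)
    moreover have "[:-a, 1:] * [:-a, 1:] = [:a\<^sup>2 + 0\<^sup>2, - 2 * a, 1:]"
      by (simp add: power2_eq_square)
    ultimately have "R = [:a\<^sup>2 + 0\<^sup>2, - 2 * a, 1:] * ((\<Prod>x\<in>Z - {a}. [:-x, 1:]) * T)"
      by (rule trans[OF S trans[OF _ arg_cong2[where f = "(*)"]], OF _ _ refl])
    then show False by (rule no_quadratic_factor)
  qed
  then obtain c where "S = [:c:]" by (rule degree_eq_zeroE)
  then have "G * S = smult c G" by simp
  with S have c: "R = smult c G" by (rule trans)
  then have "c \<noteq> 0" using R_nz by (metis smult_0_left)
  with c show ?thesis by (intro exI[of _ c] conjI)
qed

lemma degree_G: "degree G = card Z"
  unfolding G_def by (rule degree_prod_linear[OF finite_Z])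

lemma card_Z: "card Z = degree R"
  using R_eq degree_G degree_smult_eq by metis

text \<open>The Lagrange basis on the zeros of \<open>R\<close>; the numbers \<open>m x\<close> will
  be the quadrature weights.\<close>

definition "l x = smult (1 / (\<Prod>y\<in>Z - {x}. x - y)) (\<Prod>y\<in>Z - {x}. [:-y, 1:])"
definition "m x = mlin s (l x)"

lemma poly_l:
  assumes "x \<in> Z" "y \<in> Z"
  shows "poly (l x) y = (if x = y then 1 else 0)"
proof -
  have "(\<Prod>y\<in>Z - {x}. x - y) \<noteq> 0" using finite_Z by auto
  moreover have "x \<noteq> y \<Longrightarrow> (\<Prod>u\<in>Z - {x}. y - u) = 0" using assms finite_Z by auto
  ultimately show ?thesis by (auto simp: l_def poly_prod)
qed

lemma degree_l: "x \<in> Z \<Longrightarrow> degree (l x) \<le> card Z - 1"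
  unfolding l_def using finite_Z degree_prod_linear[of "Z - {x}"]
  by (intro order.trans[OF degree_smult_le]) simp

text \<open>The interpolation error is a multiple \<open>G * g\<close> of the node polynomial, and
  the bound on the degree of \<open>f\<close> gives \<open>degree g < n\<close>, so
  \<open>orth\<close> annihilates it.\<close>

lemma exact:
  assumes f: "degree f < degree R + n"
  shows "mlin s f = (\<Sum>x\<in>Z. m x * poly f x)"
proof -
  define h where "h = f - (\<Sum>x\<in>Z. smult (poly f x) (l x))"
  have "poly h y = 0" if "y \<in> Z" for y
  proof -
    have "(\<Sum>x\<in>Z. poly f x * poly (l x) y) = (\<Sum>x\<in>Z. if x = y then poly f y else 0)"
      using that by (intro sum.cong) (auto simp: poly_l)
    also have "\<dots> = poly f y" using that finite_Z by simp
    finally show ?thesis by (simp add: h_def poly_sum)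
  qed
  then have "G dvd h" unfolding G_def by (rule prod_linear_dvd[OF finite_Z])
  then obtain g where g: "h = G * g" by auto
  obtain c where c: "c \<noteq> 0" "R = smult c G" using R_eq by blast
  have "degree h < degree R + n"
  proof -
    have "degree (\<Sum>x\<in>Z. smult (poly f x) (l x)) \<le> card Z - 1"
      using degree_l by (intro degree_sum_le finite_Z order.trans[OF degree_smult_le]) auto
    then have "degree (\<Sum>x\<in>Z. smult (poly f x) (l x)) < degree R + n"
      using n by (simp add: card_Z)
    then show ?thesis using f unfolding h_def by (intro degree_diff_less) auto
  qed
  have "mlin s h = 0"
  proof (cases "g = 0")
    case False
    have "G \<noteq> 0" using c(2) R_nz by (metis smult_0_right)
    then have "degree h = degree R + degree g"
      unfolding g using False card_Z degree_G by (subst degree_mult_eq) auto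
    then have "mlin s (R * g) = 0" using \<open>degree h < degree R + n\<close> by (intro orth) simp
    moreover have "R * g = smult c (G * g)" using c(2) by (metis mult_smult_left)
    ultimately show ?thesis using c(1) by (simp add: g mlin_smult)
  qed (simp add: g)
  then show ?thesis
    by (simp add: h_def mlin_diff mlin_sum mlin_smult m_def mult.commute)
qed

lemma m_pos:
  assumes "x \<in> Z"
  shows "m x > 0"
proof -
  have dl: "degree (l x) \<le> degree R - 1" using degree_l[OF assms] by (simp add: card_Z)
  have "degree (l x * l x) \<le> degree (l x) + degree (l x)" by (rule degree_mult_le)
  also have "\<dots> \<le> (degree R - 1) + (degree R - 1)" using dl by simp
  \<comment> \<open>Here \<open>degree R \<le> n + 1\<close> enters: it is what makes the square of
    a Lagrange polynomial fall within the range of exactness.\<close>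
  also have "\<dots> < degree R + n" using degR n degree_ge by simp
  finally have "mlin s (l x * l x) = (\<Sum>y\<in>Z. m y * poly (l x * l x) y)" by (rule exact)
  also have "\<dots> = (\<Sum>y\<in>Z. if y = x then m x else 0)"
    using assms by (intro sum.cong) (auto simp: poly_l)
  also have "\<dots> = m x" using assms finite_Z by simp
  finally have "m x = mlin s (l x * l x)" ..
  moreover have "l x \<noteq> 0" using poly_l[OF assms assms] by auto
  ultimately show ?thesis using posdef by (simp add: posdef_def)
qed

lemma sum_m: "(\<Sum>x\<in>Z. m x) = 1"
  using exact[of 1] n degree_ge by (simp add: s0)

text \<open>The transform formula holds because \<open>R\<close> vanishes at the nodes: the
  difference quotient there is \<open>R(z) / (z - x)\<close>, and its integral is
  \<open>sk s R\<close> since the quadrature has all moments below the degree of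
  \<open>R\<close>.\<close>

lemma gauss_quadrature:
  "\<exists>N. real_distribution N \<and> (\<forall>i. integrable N (\<lambda>x. x ^ i)) \<and>
    (\<forall>i<2*n. (\<integral>x. x ^ i \<partial>N) = s i) \<and> (AE x in N. poly R x = 0) \<and>
    (\<forall>z. Im z \<noteq> 0 \<longrightarrow> cpoly R z * (\<integral>x. 1 / (complex_of_real x - z) \<partial>N) = - cpoly (sk s R) z)"
proof -
  define f where "f x = (if x \<in> Z then m x else 0)" for x
  have f_nn: "f x \<ge> 0" for x using m_pos by (auto simp: f_def intro: less_imp_le)
  have "(\<integral>\<^sup>+x. ennreal (f x) \<partial>count_space UNIV) = (\<Sum>x\<in>Z. ennreal (f x))"
    using finite_Z by (intro nn_integral_count_space') (auto simp: f_def)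
  also have "\<dots> = ennreal (\<Sum>x\<in>Z. f x)" using f_nn by (intro sum_ennreal) auto
  also have "(\<Sum>x\<in>Z. f x) = 1" using sum_m by (simp add: f_def)
  finally have f1: "(\<integral>\<^sup>+x. ennreal (f x) \<partial>count_space UNIV) = 1" by simp
  define p where "p = embed_pmf f"
  have pmf: "pmf p x = f x" for x unfolding p_def by (rule pmf_embed_pmf[OF f_nn f1])
  have setp: "set_pmf p \<subseteq> Z" by (auto simp: set_pmf_eq pmf f_def)
  define N where "N = distr (measure_pmf p) borel (\<lambda>x. x)"
  have dist: "real_distribution N"
    unfolding N_def real_distribution_def real_distribution_axioms_def
    by (auto intro!: measure_pmf.prob_space_distr)
  have int: "(\<integral>x. g x \<partial>N) = (\<Sum>x\<in>Z. m x *\<^sub>R g x)" if "g \<in> borel_measurable borel"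
    for g :: "real \<Rightarrow> 'b :: {banach, second_countable_topology}"
  proof -
    have "(\<integral>x. g x \<partial>N) = (\<integral>x. g x \<partial>measure_pmf p)"
      unfolding N_def using that by (subst integral_distr) auto
    also have "\<dots> = (\<Sum>x\<in>Z. pmf p x *\<^sub>R g x)"
      using setp by (intro integral_measure_pmf finite_Z) auto
    also have "\<dots> = (\<Sum>x\<in>Z. m x *\<^sub>R g x)" by (simp add: pmf f_def)
    finally show ?thesis .
  qed
  have integrable: "integrable N (\<lambda>x. x ^ i)" for i
    unfolding N_def using finite_subset[OF setp finite_Z]
    by (subst integrable_distr_eq) (auto intro: integrable_measure_pmf_finite)
  have mom: "(\<integral>x. x ^ i \<partial>N) = s i" if "i < 2 * n" for i
  proof -
    have "mlin s (monom 1 i) = (\<Sum>x\<in>Z. m x * poly (monom 1 i) x)"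
      using that degree_ge by (intro exact order.strict_trans1[OF degree_monom_le]) simp
    then show ?thesis by (simp add: int mlin_monom poly_monom)
  qed
  have AE: "AE x in N. poly R x = 0"
  proof -
    have "{x \<in> space borel. poly R x = 0} \<in> sets borel"
      using finite_Z by (simp add: Z_def finite_imp_closed borel_closed)
    then show ?thesis
      unfolding N_def using setp by (subst AE_distr_iff) (auto simp: AE_measure_pmf_iff Z_def)
  qed
  have "cpoly R z * (\<integral>x. 1 / (complex_of_real x - z) \<partial>N) = - cpoly (sk s R) z" if z: "Im z \<noteq> 0" for z
  proof -
    have sets: "sets N = sets borel" by (simp add: N_def)
    have ne: "complex_of_real x \<noteq> z" for x using z by auto
    have "cpoly (sk s R) z = (\<integral>x. (cpoly R z - cpoly R (of_real x)) / (z - of_real x) \<partial>N)"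
      using degR n by (intro sk_integral(2)[symmetric] z integrable mom) auto
    also have "\<dots> = (\<integral>x. - cpoly R z * (1 / (of_real x - z)) \<partial>N)"
    proof (rule integral_cong_AE)
      show "AE x in N. (cpoly R z - cpoly R (of_real x)) / (z - of_real x) = - cpoly R z * (1 / (of_real x - z))"
        using AE by eventually_elim (use ne in \<open>simp add: cpoly_of_real divide_simps algebra_simps\<close>)
      have [measurable]: "poly R \<in> borel_measurable borel"
        by (intro borel_measurable_continuous_onI continuous_intros)
      show "(\<lambda>x. (cpoly R z - cpoly R (of_real x)) / (z - of_real x)) \<in> borel_measurable N"
        unfolding cpoly_of_real by (rule borel_measurable_eq_borel[OF sets]) measurable
      show "(\<lambda>x. - cpoly R z * (1 / (of_real x - z))) \<in> borel_measurable N"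
        by (rule borel_measurable_eq_borel[OF sets]) measurable
    qed
    also have "\<dots> = - cpoly R z * (\<integral>x. 1 / (of_real x - z) \<partial>N)"
      by (rule integral_mult_right_zero)
    finally show ?thesis by simp
  qed
  then show ?thesis using dist integrable mom AE by blast
qed

end

text \<open>Every \<open>\<nu> n\<close> has the second moment \<open>s 2\<close>, hence tightness
  and a weak limit along a subsequence. Powers are unbounded, so their integrals do not converge by
  weak convergence alone; truncation with an error controlled by the moment of twice the order
  closes the gap.\<close>

theorem moment_compactness:
  fixes \<nu> :: "nat \<Rightarrow> real measure"
  assumes dist: "\<And>n. real_distribution (\<nu> n)"
    and integrable: "\<And>n i. integrable (\<nu> n) (\<lambda>x. x ^ i)"
    and mom: "\<And>n i. i \<le> n + 2 \<Longrightarrow> (\<integral>x. x ^ i \<partial>\<nu> n) = s i"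
  shows "\<exists>r M. strict_mono r \<and> real_distribution M \<and> weak_conv_m (\<nu> \<circ> r) M \<and>
    (\<forall>i. integrable M (\<lambda>x. x ^ i) \<and> (\<integral>x. x ^ i \<partial>M) = s i)"
proof -
  interpret \<nu>: real_distribution "\<nu> n" for n by (rule dist)
  have tight: "tight \<nu>"
    unfolding tight_def
  proof (intro conjI allI impI dist)
    fix \<epsilon> :: real assume \<epsilon>: "\<epsilon> > 0"
    have s2: "s 2 \<ge> 0"
      using mom[of 2 0] Bochner_Integration.integral_nonneg[of "\<nu> 0" "\<lambda>x. x ^ 2"] by simp
    \<comment> \<open>\<open>c \<ge> 1\<close> makes \<open>\<bar>x\<bar> \<ge> c\<close> imply
      \<open>x^2 \<ge> c\<close>, and Markov's inequality bounds the tail by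
      \<open>s 2 / c < \<epsilon>\<close>.\<close>
    define c where "c = s 2 / \<epsilon> + 1"
    have c: "c \<ge> 1" "s 2 / c < \<epsilon>"
      using s2 \<epsilon> by (auto simp: c_def field_simps)
    have "measure (\<nu> n) {-c<..c} > 1 - \<epsilon>" for n
    proof -
      have "measure (\<nu> n) {x \<in> space (\<nu> n). x ^ 2 \<ge> c} \<le> (\<integral>x. x ^ 2 \<partial>\<nu> n) / c"
        using c by (intro integral_Markov_inequality_measure[where A = "{}"] integrable) auto
      then have 1: "measure (\<nu> n) {x. x ^ 2 \<ge> c} < \<epsilon>" using c mom[of 2 n] by simp
      have "- {-c<..c} \<subseteq> {x. x ^ 2 \<ge> c}"
      proof
        fix x assume "x \<in> - {-c<..c}"
        then have "\<bar>x\<bar> \<ge> c" by auto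
        then have "c * 1 \<le> \<bar>x\<bar> * \<bar>x\<bar>" using c(1) by (intro mult_mono) auto
        then show "x \<in> {x. x ^ 2 \<ge> c}" by (simp add: power2_eq_square)
      qed
      then have "measure (\<nu> n) (- {-c<..c}) \<le> measure (\<nu> n) {x. x ^ 2 \<ge> c}"
        by (intro \<nu>.finite_measure_mono) auto
      moreover have "measure (\<nu> n) (- {-c<..c}) = 1 - measure (\<nu> n) {-c<..c}"
        using \<nu>.prob_compl[of "{-c<..c}" n] by (simp add: Compl_eq_Diff_UNIV)
      ultimately show ?thesis using 1 by simp
    qed
    then show "\<exists>a b. a < b \<and> (\<forall>n. 1 - \<epsilon> < measure (\<nu> n) {a<..b})"
      using c by (intro exI[of _ "- c"] exI[of _ c]) auto
  qed
  have "strict_mono (\<lambda>n::nat. n)" by (simp add: strict_mono_def)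
  from tight_imp_convergent_subsubsequence[OF tight this]
  obtain r M where r: "strict_mono (r :: nat \<Rightarrow> nat)" and M: "real_distribution M"
    and "weak_conv_m (\<nu> \<circ> (\<lambda>n. n) \<circ> r) M"
    by (elim exE conjE) (rule that)
  then have conv: "weak_conv_m (\<nu> \<circ> r) M" by (simp add: comp_def)
  interpret M: real_distribution M by (rule M)
  have lim: "(\<lambda>n. \<integral>x. f x \<partial>\<nu> (r n)) \<longlonglongrightarrow> (\<integral>x. f x \<partial>M)"
    if "\<And>x. isCont f x" "\<And>x. norm (f x) \<le> B" for f :: "real \<Rightarrow> real" and B
    using weak_conv_imp_integral_bdd_continuous_conv[OF _ M conv, of f B] dist that by simp
  have large: "\<forall>\<^sub>F n in sequentially. k \<le> r n + 2" for k
    using seq_suble[OF r] by (intro eventually_sequentiallyI[of k]) (meson le_add1 order.trans)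
  have mom_large: "(\<integral>x. x ^ k \<partial>\<nu> (r n)) = s k" if "k \<le> r n + 2" for k n using mom that by blast
  \<comment> \<open>The truncated powers have integral at most \<open>s (2 * k)\<close> under
    \<open>M\<close> by weak convergence; monotone convergence removes the truncation.\<close>
  have even: "integrable M (\<lambda>x. x ^ (2 * k))" for k
  proof -
    let ?f = "\<lambda>i x. min (x ^ (2 * k)) (real i)"
    have nn: "(x :: real) ^ (2 * k) \<ge> 0" for x by (simp add: power_mult)
    have int: "integrable N (?f i)" if "real_distribution N" for N i
    proof -
      interpret N: real_distribution N by fact
      show ?thesis using nn by (intro N.integrable_const_bound[where B = "real i"]) auto
    qed
    have bd: "(\<integral>x. ?f i x \<partial>M) \<le> s (2 * k)" for i
    proof (rule tendsto_upperbound[OF lim])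
      show "\<forall>\<^sub>F n in sequentially. (\<integral>x. ?f i x \<partial>\<nu> (r n)) \<le> s (2 * k)"
        using large[of "2 * k"]
      proof eventually_elim
        case (elim n)
        have "(\<integral>x. ?f i x \<partial>\<nu> (r n)) \<le> (\<integral>x. x ^ (2 * k) \<partial>\<nu> (r n))"
          by (intro integral_mono int dist integrable) auto
        then show ?case using mom_large[OF elim] by simp
      qed
      show "norm (?f i x) \<le> real i" for x using nn[of x] by auto
    qed (auto intro!: continuous_intros)
    have inc: "incseq (\<lambda>i. \<integral>x. ?f i x \<partial>M)"
      by (intro incseq_SucI integral_mono int M) auto
    obtain L where L: "(\<lambda>i. \<integral>x. ?f i x \<partial>M) \<longlonglongrightarrow> L"
      using incseq_convergent[OF inc, of "s (2 * k)"] bd by blast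
    show ?thesis
    proof (rule integrable_monotone_convergence[where f = ?f, OF int[OF M] _ _ L])
      show "AE x in M. mono (\<lambda>i. ?f i x)" by (auto intro!: AE_I2 monoI)
      show "AE x in M. (\<lambda>i. ?f i x) \<longlonglongrightarrow> x ^ (2 * k)"
      proof (rule AE_I2)
        fix x :: real
        have "\<forall>\<^sub>F i in sequentially. ?f i x = x ^ (2 * k)"
          using eventually_ge_at_top[of "nat \<lceil>x ^ (2 * k)\<rceil>"]
        proof eventually_elim
          case (elim i)
          then have "x ^ (2 * k) \<le> real i"
            using real_nat_ceiling_ge[of "x ^ (2 * k)"] by linarith
          then show ?case by simp
        qed
        then show "(\<lambda>i. ?f i x) \<longlonglongrightarrow> x ^ (2 * k)" by (rule tendsto_eventually)
      qed
    qed simp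
  qed
  have int: "integrable M (\<lambda>x. x ^ k)" for k
  proof (rule Bochner_Integration.integrable_bound)
    show "integrable M (\<lambda>x. 1 + x ^ (2 * k))" using even[of k] by auto
    show "AE x in M. norm (x ^ k) \<le> norm (1 + x ^ (2 * k))"
    proof (rule AE_I2)
      fix x :: real
      have "0 \<le> (\<bar>x ^ k\<bar> - 1)\<^sup>2" by simp
      also have "\<dots> = x ^ (2 * k) - 2 * \<bar>x ^ k\<bar> + 1"
        by (simp add: power2_diff power_mult[symmetric] mult.commute)
      finally have "2 * \<bar>x ^ k\<bar> \<le> 1 + x ^ (2 * k)" by simp
      then show "norm (x ^ k) \<le> norm (1 + x ^ (2 * k))" by simp
    qed
  qed simp
  have "(\<integral>x. x ^ k \<partial>M) = s k" for k
  proof -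
    \<comment> \<open>The sum of the truncation errors, times the truncation height, for the
      approximating measures and for \<open>M\<close>.\<close>
    define C where "C = s (2 * k) + (\<integral>x. x ^ (2 * k) \<partial>M)"
    have "\<bar>(\<integral>x. x ^ k \<partial>M) - s k\<bar> \<le> C / real (Suc i)" for i
    proof -
      let ?R = "real (Suc i)"
      let ?f = "\<lambda>x. max (- ?R) (min ?R (x ^ k))"
      have near: "\<bar>(\<integral>x. ?f x \<partial>N) - (\<integral>x. x ^ k \<partial>N)\<bar> \<le> (\<integral>x. x ^ (2 * k) \<partial>N) / ?R"
        if "real_distribution N" "\<And>k. integrable N (\<lambda>x. x ^ (2 * k))" "integrable N (\<lambda>x. x ^ k)" for N
      proof -
        interpret N: real_distribution N by fact
        have f: "integrable N ?f" by (intro N.integrable_const_bound[where B = ?R]) auto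
        have "\<bar>(\<integral>x. ?f x \<partial>N) - (\<integral>x. x ^ k \<partial>N)\<bar> = norm (\<integral>x. ?f x - x ^ k \<partial>N)"
          using f that by simp
        also have "\<dots> \<le> (\<integral>x. x ^ (2 * k) / ?R \<partial>N)"
        proof (rule Bochner_Integration.integral_norm_bound_integral)
          fix x :: real
          have sq: "x ^ (2 * k) = \<bar>x ^ k\<bar> * \<bar>x ^ k\<bar>"
            by (simp add: power_add[symmetric] mult_2)
          show "norm (?f x - x ^ k) \<le> x ^ (2 * k) / ?R"
          proof (cases "\<bar>x ^ k\<bar> \<le> ?R")
            case True
            then have "?f x = x ^ k" by auto
            then show ?thesis unfolding sq by simp
          next
            case False
            then have "norm (?f x - x ^ k) \<le> \<bar>x ^ k\<bar>" by (auto simp: max_def min_def)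
            also have "\<dots> \<le> x ^ (2 * k) / ?R"
            proof -
              have "\<bar>x ^ k\<bar> * ?R \<le> \<bar>x ^ k\<bar> * \<bar>x ^ k\<bar>" using False by (intro mult_left_mono) auto
              then show ?thesis unfolding sq by (simp add: pos_le_divide_eq)
            qed
            finally show ?thesis .
          qed
        qed (use f that in auto)
        finally show ?thesis by simp
      qed
      have "\<bar>(\<integral>x. ?f x \<partial>M) - s k\<bar> \<le> s (2 * k) / ?R"
      proof (rule tendsto_upperbound)
        show "(\<lambda>n. \<bar>(\<integral>x. ?f x \<partial>\<nu> (r n)) - s k\<bar>) \<longlonglongrightarrow> \<bar>(\<integral>x. ?f x \<partial>M) - s k\<bar>"
          by (intro tendsto_intros lim[of ?f ?R]) (auto intro!: continuous_intros)
        show "\<forall>\<^sub>F n in sequentially. \<bar>(\<integral>x. ?f x \<partial>\<nu> (r n)) - s k\<bar> \<le> s (2 * k) / ?R"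
          using large[of "2 * k"]
        proof eventually_elim
          case (elim n)
          then show ?case
            using near[OF dist integrable integrable, of "r n"] mom_large[of k n] mom_large[of "2 * k" n]
            by simp
        qed
      qed simp
      moreover have "\<bar>(\<integral>x. ?f x \<partial>M) - (\<integral>x. x ^ k \<partial>M)\<bar> \<le> (\<integral>x. x ^ (2 * k) \<partial>M) / ?R"
        by (rule near[OF M even int])
      ultimately show ?thesis unfolding C_def add_divide_distrib by linarith
    qed
    moreover have "(\<lambda>i. C / real (Suc i)) \<longlonglongrightarrow> 0" by real_asymp
    ultimately have "\<bar>(\<integral>x. x ^ k \<partial>M) - s k\<bar> \<le> 0"
      using LIMSEQ_le_const by meson
    then show ?thesis by simp
  qed
  then show ?thesis using r M conv int by (intro exI[of _ r] exI[of _ M]) simp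
qed

section \<open>Passage from the quadratures to the N-extremal solutions\<close>

context stieltjes_indet
begin

text \<open>Homogeneous coordinates treat the finite parameters \<open>(1, t)\<close> and infinity
  \<open>(0, 1)\<close> together. The last clause reads off the support from the zeros of the
  partial sums.\<close>

theorem N_extremal_exists:
  fixes a b :: real
  assumes ab: "a \<noteq> 0 \<or> b \<noteq> 0"
  shows "\<exists>M\<in>solutions s. (\<forall>z. Im z \<noteq> 0 \<longrightarrow> of_real a * Binf z + of_real b * Dinf z \<noteq> 0 \<and>
      (\<integral>x. 1 / (complex_of_real x - z) \<partial>M) =
        - ((of_real a * Ainf z + of_real b * Cinf z) / (of_real a * Binf z + of_real b * Dinf z))) \<and>
    ((\<forall>n x. x < 0 \<longrightarrow> poly (smult a (B n) + smult b (D n)) x \<noteq> 0) \<longrightarrow> (AE x in M. x \<ge> 0))"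
proof -
  define R where "R n = smult a (B n) + smult b (D n)" for n
  have nz: "R n \<noteq> 0" for n
  proof
    assume 0: "R n = 0"
    then have "poly (R n) 0 = 0" by simp
    then have "a = 0" by (simp add: R_def B_def D_def)
    then show False using 0 ab D_nz[of n] by (simp add: R_def)
  qed
  have degR: "degree (R n) \<le> Suc n" for n
  proof -
    have "degree (\<Sum>k\<le>n. smult (q0 k) (P k)) \<le> n"
      by (intro degree_sum_le) (auto intro: order.trans[OF degree_smult_le])
    then have "degree (B n) \<le> Suc n" unfolding B_def by (intro order.trans[OF degree_pCons_le]) simp
    moreover have "degree (D n) \<le> Suc n" unfolding D_def
      using degree_K_le[of n] by (intro order.trans[OF degree_pCons_le]) simp
    ultimately show ?thesis unfolding R_def
      by (intro degree_add_le order.trans[OF degree_smult_le])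
  qed
  have orth: "mlin s (R n * g) = 0" if "degree g < n" for n g
    using mlin_D_lower[OF that] mlin_B_lower[OF that]
    by (simp add: R_def distrib_right mlin_add mlin_smult)
  \<comment> \<open>The shift by 2 gives the measure of index \<open>n\<close> all moments up to
    \<open>n + 2\<close>, as \<open>moment_compactness\<close> requires.\<close>
  define Q where "Q n N \<longleftrightarrow> real_distribution N \<and> (\<forall>i. integrable N (\<lambda>x. x ^ i)) \<and>
    (\<forall>i<2*(n + 2). (\<integral>x. x ^ i \<partial>N) = s i) \<and> (AE x in N. poly (R (n + 2)) x = 0) \<and>
    (\<forall>z. Im z \<noteq> 0 \<longrightarrow> cpoly (R (n + 2)) z * (\<integral>x. 1 / (complex_of_real x - z) \<partial>N) = - cpoly (sk s (R (n + 2))) z)"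
    for n N
  have "\<exists>N. Q n N" for n
  proof -
    interpret quasi_orthogonal s "R (n + 2)" "n + 2"
      using s0 posdef nz degR orth by unfold_locales auto
    show ?thesis unfolding Q_def by (rule gauss_quadrature)
  qed
  then obtain \<nu> where "\<And>n. Q n (\<nu> n)" by metis
  then have \<nu>: "\<And>n. real_distribution (\<nu> n)" "\<And>n i. integrable (\<nu> n) (\<lambda>x. x ^ i)"
    "\<And>n i. i < 2*(n + 2) \<Longrightarrow> (\<integral>x. x ^ i \<partial>\<nu> n) = s i" "\<And>n. AE x in \<nu> n. poly (R (n + 2)) x = 0"
    "\<And>n z. Im z \<noteq> 0 \<Longrightarrow> cpoly (R (n + 2)) z * (\<integral>x. 1 / (complex_of_real x - z) \<partial>\<nu> n) = - cpoly (sk s (R (n + 2))) z"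
    unfolding Q_def by simp_all
  have \<nu>_mom: "(\<integral>x. x ^ i \<partial>\<nu> n) = s i" if "i \<le> n + 2" for i n
    using that by (intro \<nu>(3)) simp
  have "\<exists>r M. strict_mono r \<and> real_distribution M \<and> weak_conv_m (\<nu> \<circ> r) M \<and>
      (\<forall>i. integrable M (\<lambda>x. x ^ i) \<and> (\<integral>x. x ^ i \<partial>M) = s i)"
    by (rule moment_compactness[where \<nu> = \<nu>, OF \<nu>(1,2) \<nu>_mom])
  then obtain r M where r: "strict_mono (r :: nat \<Rightarrow> nat)" and M: "real_distribution M"
    and conv: "weak_conv_m (\<nu> \<circ> r) M"
    and mom': "\<forall>i. integrable M (\<lambda>x. x ^ i) \<and> (\<integral>x. x ^ i \<partial>M) = s i"
    by (elim exE conjE) (rule that)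
  have mom: "integrable M (\<lambda>x. x ^ i)" "(\<integral>x. x ^ i \<partial>M) = s i" for i
    using mom' by auto
  interpret M: real_distribution M by (rule M)
  have sol: "M \<in> solutions s" by (intro solutionsI posdef mom) simp
  have r2: "filterlim (\<lambda>n. r n + 2) sequentially sequentially"
    by (rule filterlim_at_top_mono[OF filterlim_subseq[OF r]]) simp
  have tr: "of_real a * Binf z + of_real b * Dinf z \<noteq> 0 \<and>
      (\<integral>x. 1 / (complex_of_real x - z) \<partial>M) =
        - ((of_real a * Ainf z + of_real b * Cinf z) / (of_real a * Binf z + of_real b * Dinf z))"
    if z: "Im z \<noteq> 0" for z
  proof -
    let ?G = "\<integral>x. 1 / (complex_of_real x - z) \<partial>M"
    have nz: "complex_of_real x - z \<noteq> 0" for x using z by auto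
    have 1: "(\<lambda>n. \<integral>x. 1 / (complex_of_real x - z) \<partial>\<nu> (r n)) \<longlonglongrightarrow> ?G"
    proof -
      have "(\<lambda>n. \<integral>x. 1 / (complex_of_real x - z) \<partial>(\<nu> \<circ> r) n) \<longlonglongrightarrow> ?G"
        by (rule weak_conv_imp_integral_bdd_continuous_conv[OF _ M conv, where B = "1 / \<bar>Im z\<bar>"])
          (use \<nu>(1) nz inverse_diff_bound[OF z] in \<open>auto intro!: continuous_intros\<close>)
      then show ?thesis by simp
    qed
    have 2: "(\<lambda>n. cpoly (R (r n + 2)) z) \<longlonglongrightarrow> of_real a * Binf z + of_real b * Dinf z"
    proof -
      have "(\<lambda>n. cpoly (R n) z) \<longlonglongrightarrow> of_real a * Binf z + of_real b * Dinf z"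
        unfolding R_def cpoly_add cpoly_smult by (intro tendsto_intros tendsto_B tendsto_D)
      from filterlim_compose[OF this r2] show ?thesis .
    qed
    have 3: "(\<lambda>n. cpoly (sk s (R (r n + 2))) z) \<longlonglongrightarrow> of_real a * Ainf z + of_real b * Cinf z"
    proof -
      have "(\<lambda>n. cpoly (sk s (R n)) z) \<longlonglongrightarrow> of_real a * Ainf z + of_real b * Cinf z"
        unfolding R_def sk_add sk_smult sk_B sk_D cpoly_add cpoly_smult
        by (intro tendsto_intros tendsto_A tendsto_C)
      from filterlim_compose[OF this r2] show ?thesis .
    qed
    \<comment> \<open>The limit is taken in product form, since the limiting denominator is not yet
      known to be non-zero.\<close>
    have eq: "(of_real a * Binf z + of_real b * Dinf z) * ?G = - (of_real a * Ainf z + of_real b * Cinf z)"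
      using LIMSEQ_unique[OF tendsto_mult[OF 2 1], OF tendsto_minus[OF 3, folded \<nu>(5)[OF z]]] .
    \<comment> \<open>A vanishing denominator would make the numerator vanish too, and
      \<open>det_inf\<close> would then give \<open>a = b = 0\<close>.\<close>
    have "of_real a * Binf z + of_real b * Dinf z \<noteq> 0"
    proof
      assume 0: "of_real a * Binf z + of_real b * Dinf z = 0"
      then have 00: "of_real a * Ainf z + of_real b * Cinf z = 0" using eq by (metis mult_zero_left neg_equal_0_iff_equal)
      have "of_real a * (Ainf z * Dinf z - Binf z * Cinf z) =
        (of_real a * Ainf z + of_real b * Cinf z) * Dinf z - (of_real a * Binf z + of_real b * Dinf z) * Cinf z"
        by (simp add: algebra_simps)
      moreover have "of_real b * (Ainf z * Dinf z - Binf z * Cinf z) =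
        (of_real a * Binf z + of_real b * Dinf z) * Ainf z - (of_real a * Ainf z + of_real b * Cinf z) * Binf z"
        by (simp add: algebra_simps)
      ultimately show False using ab unfolding det_inf 0 00 by simp
    qed
    then show ?thesis using eq by (simp add: field_simps)
  qed
  have "AE x in M. x \<ge> 0" if neg: "\<forall>n x. x < 0 \<longrightarrow> poly (R n) x \<noteq> 0"
  proof -
    \<comment> \<open>Bounded, continuous and positive exactly on the negative axis, so weak
      convergence transfers its vanishing integral from the quadratures to \<open>M\<close>.\<close>
    let ?f = "\<lambda>x::real. min 1 (max 0 (- x))"
    have lim: "(\<lambda>n. \<integral>x. ?f x \<partial>(\<nu> \<circ> r) n) \<longlonglongrightarrow> (\<integral>x. ?f x \<partial>M)"
      by (rule weak_conv_imp_integral_bdd_continuous_conv[OF _ M conv, where B = 1])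
        (use \<nu>(1) in \<open>auto intro!: continuous_intros\<close>)
    have "(\<integral>x. ?f x \<partial>\<nu> n) = 0" for n
    proof -
      interpret N: real_distribution "\<nu> n" by (rule \<nu>)
      have "(\<integral>x. ?f x \<partial>\<nu> n) = (\<integral>x. 0 \<partial>\<nu> n)"
      proof (rule integral_cong_AE)
        show "AE x in \<nu> n. ?f x = 0"
          using \<nu>(4)[of n]
        proof eventually_elim
          case (elim x)
          then have "\<not> x < 0" using neg by blast
          then show ?case by simp
        qed
      qed auto
      then show ?thesis by simp
    qed
    then have "(\<integral>x. ?f x \<partial>M) = 0" using lim LIMSEQ_unique[OF lim, of 0] by simp
    moreover have "integrable M ?f" by (intro M.integrable_const_bound[where B = 1]) auto
    ultimately have "AE x in M. ?f x = 0"
      by (subst (asm) integral_nonneg_eq_0_iff_AE) auto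
    then show ?thesis by eventually_elim (auto simp: min_def max_def split: if_splits)
  qed
  then show ?thesis unfolding R_def using tr by (intro bexI[OF _ sol] conjI) simp_all
qed

end

section \<open>The N-extremal solutions of an indet(S) sequence\<close>

lemma orthonormal_polys_eq:
  assumes M: "M \<in> solutions s" and P: "orthonormal s P"
  shows "orthonormal_polys M = P"
proof -
  have eq: "(\<integral>x. poly (Q m) x * poly (Q n) x \<partial>M) = mlin s (Q m * Q n)" for Q m n
    using solutionsD(8)[OF M, of "Q m * Q n"] by simp
  show ?thesis
    unfolding orthonormal_polys_def eq orthonormal_def[symmetric]
    using P orthonormal_unique by (intro the_equality)
qed

lemma second_kind_polys_eq:
  assumes M: "M \<in> solutions s" and P: "orthonormal s P"
  shows "second_kind_polys M n = sk s (P n)"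
  unfolding second_kind_polys_def orthonormal_polys_eq[OF M P]
proof (rule the_equality)
  have eq: "(\<integral>x. (cpoly (P n) z - cpoly (P n) (of_real x)) / (z - of_real x) \<partial>M) = cpoly (sk s (P n)) z"
    if "Im z \<noteq> 0" for z
    using that by (intro sk_integral(2) solutionsD[OF M])
  then show "\<forall>z. Im z \<noteq> 0 \<longrightarrow> cpoly (sk s (P n)) z =
      (\<integral>x. (cpoly (P n) z - cpoly (P n) (of_real x)) / (z - of_real x) \<partial>M)" by simp
  fix Q assume "\<forall>z. Im z \<noteq> 0 \<longrightarrow> cpoly Q z =
      (\<integral>x. (cpoly (P n) z - cpoly (P n) (of_real x)) / (z - of_real x) \<partial>M)"
  then show "Q = sk s (P n)" using eq by (intro cpoly_eqI) simp
qed

lemma pn_qn_eq: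
  assumes "solutions s \<noteq> {}" and P: "orthonormal s P"
  shows "pn s = P" "qn s = (\<lambda>n. sk s (P n))"
proof -
  have M: "(SOME M. M \<in> solutions s) \<in> solutions s" using assms(1) some_in_eq by blast
  show "pn s = P" unfolding pn_def by (rule orthonormal_polys_eq[OF M P])
  show "qn s = (\<lambda>n. sk s (P n))" unfolding qn_def by (rule ext) (rule second_kind_polys_eq[OF M P])
qed

lemma solutions_eqI:
  assumes "M \<in> solutions s" "N \<in> solutions s'"
    and "\<And>z. Im z \<noteq> 0 \<Longrightarrow>
      (\<integral>x. 1 / (complex_of_real x - z) \<partial>M) = (\<integral>x. 1 / (complex_of_real x - z) \<partial>N)"
  shows "M = N"
  by (rule stieltjes_transform_unique[OF solutionsD(6)[OF assms(1)] solutionsD(6)[OF assms(2)]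
        solutionsD(1)[OF assms(1)] solutionsD(1)[OF assms(2)] assms(3)])

lemma mu_eqI:
  assumes "M \<in> solutions s"
    and "\<And>z. Im z \<noteq> 0 \<Longrightarrow> (\<integral>x. 1 / (complex_of_real x - z) \<partial>M) = nev_quotient s t z"
  shows "mu s t = M"
  unfolding mu_def
proof (rule the_equality)
  fix N assume N: "N \<in> solutions s \<and>
     (\<forall>z. Im z \<noteq> 0 \<longrightarrow> (\<integral>x. 1 / (complex_of_real x - z) \<partial>N) = nev_quotient s t z)"
  show "N = M" using N assms by (intro solutions_eqI[of N s M s]) simp_all
qed (use assms in simp)

context stieltjes_indet
begin

lemma solutions_nonempty: "solutions s \<noteq> {}"
proof -
  obtain M where "M \<in> solutions s"
    using N_extremal_exists[of 1 0, OF disjI1[OF one_neq_zero]] by (rule bexE)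
  then show ?thesis by auto
qed

lemma pn_eq: "pn s = P" and qn_eq: "qn s = q"
  using pn_qn_eq[OF solutions_nonempty P] by (simp_all add: q_def fun_eq_iff)

lemma nev_eqs: "nev_A s = Ainf" "nev_B s = Binf" "nev_C s = Cinf" "nev_D s = Dinf"
  by (simp_all add: fun_eq_iff nev_A_def nev_B_def nev_C_def nev_D_def pn_eq qn_eq cpoly_at_0
      Ainf_def Binf_def Cinf_def Dinf_def p0_def q0_def)

lemma alpha_eq: "alpha s = - 1 / F"
proof -
  have "(\<lambda>n. 1 / \<sigma> n) \<longlonglongrightarrow> 1 / (- F)"
    using F_pos by (intro tendsto_intros \<sigma>_tendsto) simp
  \<comment> \<open>This includes index 0, where both sides are divisions by zero because
    \<open>q0 0 = 0\<close>.\<close>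
  moreover have "(\<lambda>n. 1 / \<sigma> n) = (\<lambda>n. poly (pn s n) 0 / poly (qn s n) 0)"
    by (simp add: fun_eq_iff \<sigma>_def pn_eq qn_eq p0_def q0_def)
  ultimately show ?thesis unfolding alpha_def by (simp add: limI)
qed

lemma friedrichs_param_eq: "friedrichs_param s = ereal F"
  using F_pos by (simp add: friedrichs_param_def alpha_eq)

lemma mu_real:
  shows "mu s (ereal t) \<in> solutions s"
    and "Im z \<noteq> 0 \<Longrightarrow> (\<integral>x. 1 / (complex_of_real x - z) \<partial>mu s (ereal t)) =
      - ((Ainf z + of_real t * Cinf z) / (Binf z + of_real t * Dinf z))"
    and "Im z \<noteq> 0 \<Longrightarrow> Binf z + of_real t * Dinf z \<noteq> 0"
    and "F \<le> t \<Longrightarrow> AE x in mu s (ereal t). x \<ge> 0"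
proof -
  obtain M where M: "M \<in> solutions s"
    and tr: "\<forall>z. Im z \<noteq> 0 \<longrightarrow> of_real 1 * Binf z + of_real t * Dinf z \<noteq> 0 \<and>
      (\<integral>x. 1 / (complex_of_real x - z) \<partial>M) =
        - ((of_real 1 * Ainf z + of_real t * Cinf z) / (of_real 1 * Binf z + of_real t * Dinf z))"
    and supp: "(\<forall>n x. x < 0 \<longrightarrow> poly (smult 1 (B n) + smult t (D n)) x \<noteq> 0) \<longrightarrow> (AE x in M. x \<ge> 0)"
    using N_extremal_exists[of 1 t, OF disjI1[OF one_neq_zero]] by (elim bexE conjE) (rule that)
  have mu: "mu s (ereal t) = M"
    using tr by (intro mu_eqI M) (simp add: nev_quotient_def nev_eqs)
  show "mu s (ereal t) \<in> solutions s" unfolding mu by (rule M)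
  show "Im z \<noteq> 0 \<Longrightarrow> (\<integral>x. 1 / (complex_of_real x - z) \<partial>mu s (ereal t)) =
      - ((Ainf z + of_real t * Cinf z) / (Binf z + of_real t * Dinf z))"
    "Im z \<noteq> 0 \<Longrightarrow> Binf z + of_real t * Dinf z \<noteq> 0"
    unfolding mu using tr by simp_all
  assume t: "F \<le> t"
  have "poly (smult 1 (B n) + smult t (D n)) x \<noteq> 0" if x: "x < 0" for n x
  proof -
    \<comment> \<open>As \<open>\<sigma> k \<ge> - F \<ge> - t\<close>, the sum is nonnegative, and
      the polynomial is at most \<open>-1\<close> on the negative axis.\<close>
    have "poly (smult 1 (B n) + smult t (D n)) x = - 1 + x * (\<Sum>k\<le>n. (\<sigma> k + t) * (p0 k * poly (P k) x))"
      by (simp add: B_def D_def K_def poly_sum q0_eq sum.distrib sum_distrib_left algebra_simps)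
    moreover have "(\<Sum>k\<le>n. (\<sigma> k + t) * (p0 k * poly (P k) x)) \<ge> 0"
    proof (intro sum_nonneg mult_nonneg_nonneg[of "\<sigma> _ + t"])
      show "0 \<le> \<sigma> k + t" for k using \<sigma>_ge[of k] t by simp
      show "0 \<le> p0 k * poly (P k) x" for k using p0_mult_P_pos[of x k] x by simp
    qed
    ultimately show ?thesis
      using x mult_nonpos_nonneg[of x "\<Sum>k\<le>n. (\<sigma> k + t) * (p0 k * poly (P k) x)"] by linarith
  qed
  then show "AE x in mu s (ereal t). x \<ge> 0" unfolding mu using supp by simp
qed

lemma mu_infinity:
  shows "mu s \<infinity> \<in> solutions s"
    and "Im z \<noteq> 0 \<Longrightarrow> (\<integral>x. 1 / (complex_of_real x - z) \<partial>mu s \<infinity>) = - (Cinf z / Dinf z)"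
    and "Im z \<noteq> 0 \<Longrightarrow> Dinf z \<noteq> 0"
    and "AE x in mu s \<infinity>. x \<ge> 0"
proof -
  have "\<exists>M\<in>solutions s. (\<forall>z. Im z \<noteq> 0 \<longrightarrow> Dinf z \<noteq> 0 \<and>
      (\<integral>x. 1 / (complex_of_real x - z) \<partial>M) = - (Cinf z / Dinf z)) \<and>
    ((\<forall>n x. x < 0 \<longrightarrow> poly (D n) x \<noteq> 0) \<longrightarrow> (AE x in M. x \<ge> 0))"
    using N_extremal_exists[of 0 1] by simp
  then obtain M where M: "M \<in> solutions s"
    and tr: "\<forall>z. Im z \<noteq> 0 \<longrightarrow> Dinf z \<noteq> 0 \<and>
      (\<integral>x. 1 / (complex_of_real x - z) \<partial>M) = - (Cinf z / Dinf z)"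
    and supp: "(\<forall>n x. x < 0 \<longrightarrow> poly (D n) x \<noteq> 0) \<longrightarrow> (AE x in M. x \<ge> 0)"
    by (elim bexE conjE) (rule that)
  have mu: "mu s \<infinity> = M"
    using tr by (intro mu_eqI M) (simp add: nev_quotient_def nev_eqs)
  show "mu s \<infinity> \<in> solutions s" unfolding mu by (rule M)
  show "Im z \<noteq> 0 \<Longrightarrow> (\<integral>x. 1 / (complex_of_real x - z) \<partial>mu s \<infinity>) = - (Cinf z / Dinf z)"
    "Im z \<noteq> 0 \<Longrightarrow> Dinf z \<noteq> 0"
    unfolding mu using tr by simp_all
  have "poly (D n) x \<noteq> 0" if x: "x < 0" for n x
  proof -
    have "(\<Sum>k\<le>n. p0 k * poly (P k) x) > 0"
      using p0_mult_P_pos[of x] x by (intro sum_pos) auto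
    then show ?thesis using x by (simp add: D_def K_def poly_sum)
  qed
  then show "AE x in mu s \<infinity>. x \<ge> 0" unfolding mu using supp by simp
qed

end

section \<open>Transforms of Stieltjes solutions on the negative axis\<close>

lemma integral_div_linear:
  assumes M: "M \<in> solutions s" and AE: "AE u in M. u \<ge> 0" and x: "x < 0"
  shows "integrable M (\<lambda>u. poly f u / (u - x))"
    and "(\<integral>u. poly f u / (u - x) \<partial>M) = poly (sk s f) x + poly f x * (\<integral>u. 1 / (u - x) \<partial>M)"
proof -
  interpret finite_measure M by (rule solutionsD(6)[OF M])
  define S where "S = synthetic_div f x"
  have f: "f = [:-x, 1:] * S + [:poly f x:]" unfolding S_def by (rule synthetic_div_correct'[symmetric])
  have sk: "poly (sk s f) x = mlin s S" by (subst f) (rule poly_sk_at)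
  note meas = borel_measurable_eq_borel[OF solutionsD(1)[OF M]]
  have pm: "poly g \<in> borel_measurable borel" for g :: "real poly"
    by (intro borel_measurable_continuous_onI continuous_intros)
  have 1: "integrable M (\<lambda>u. 1 / (u - x))"
  proof (rule integrable_const_bound[where B = "1 / (- x)"])
    show "AE u in M. norm (1 / (u - x)) \<le> 1 / (- x)"
      using AE
    proof eventually_elim
      case (elim u)
      have "1 / (u - x) \<le> 1 / (- x)" using elim x by (intro frac_le) auto
      then show ?case using elim x by simp
    qed
    show "(\<lambda>u. 1 / (u - x)) \<in> borel_measurable M" by (rule meas) simp
  qed
  have AEeq: "AE u in M. poly f u / (u - x) = poly S u + poly f x * (1 / (u - x))"
    using AE
  proof eventually_elim
    case (elim u)
    have "poly f u = (u - x) * poly S u + poly f x"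
      using arg_cong[OF f, of "\<lambda>p. poly p u"] by (simp add: algebra_simps)
    then show ?case using elim x by (simp add: add_divide_distrib)
  qed
  have int: "integrable M (\<lambda>u. poly S u + poly f x * (1 / (u - x)))"
    by (intro Bochner_Integration.integrable_add integrable_mult_right 1 solutionsD(7)[OF M])
  have m1: "(\<lambda>u. poly f u / (u - x)) \<in> borel_measurable M"
    by (intro meas borel_measurable_divide pm) simp
  have m2: "(\<lambda>u. poly S u + poly f x * (1 / (u - x))) \<in> borel_measurable M"
    by (intro meas borel_measurable_add borel_measurable_times borel_measurable_divide pm) simp_all
  show "integrable M (\<lambda>u. poly f u / (u - x))"
    using integrable_cong_AE[OF m1 m2 AEeq] int by simp
  have "(\<integral>u. poly f u / (u - x) \<partial>M) = (\<integral>u. poly S u + poly f x * (1 / (u - x)) \<partial>M)"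
    by (rule integral_cong_AE[OF m1 m2 AEeq])
  also have "\<dots> = mlin s S + poly f x * (\<integral>u. 1 / (u - x) \<partial>M)"
    by (subst Bochner_Integration.integral_add[OF solutionsD(7)[OF M] integrable_mult_right[OF 1]])
      (simp only: solutionsD(8)[OF M] integral_mult_right_zero)
  finally show "(\<integral>u. poly f u / (u - x) \<partial>M) = poly (sk s f) x + poly f x * (\<integral>u. 1 / (u - x) \<partial>M)"
    by (simp add: sk)
qed

context stieltjes_seq
begin

text \<open>The integral of \<open>f g / (u - x)\<close> is nonnegative. Splitting
  \<open>g = (u - x) S + g(x)\<close>, orthogonality kills the \<open>S\<close> part and leaves
  \<open>g(x)\<close> times the integral of \<open>f / (u - x)\<close>. The pairs
  \<open>(P n, P n)\<close> and \<open>(D n, K n)\<close> give the two bounds on the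
  transform.\<close>

lemma nonneg_of_lower_orthogonal:
  assumes M: "M \<in> solutions s" and AE: "AE u in M. u \<ge> 0" and x: "x < 0"
    and f: "\<And>g. degree g < n \<Longrightarrow> mlin s (f * g) = 0" and g: "degree g \<le> n"
    and nn: "\<And>u. u \<ge> 0 \<Longrightarrow> poly f u * poly g u \<ge> 0"
  shows "poly g x * (poly (sk s f) x + poly f x * (\<integral>u. 1 / (u - x) \<partial>M)) \<ge> 0"
proof -
  define S where "S = synthetic_div g x"
  have gS: "g = [:-x, 1:] * S + [:poly g x:]" unfolding S_def by (rule synthetic_div_correct'[symmetric])
  have S0: "mlin s (f * S) = 0"
  proof (cases "degree g = 0")
    case True
    then have "S = 0" by (simp add: S_def synthetic_div_eq_0_iff)
    then show ?thesis by simp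
  next
    case False
    then show ?thesis using g by (intro f) (simp add: S_def degree_synthetic_div)
  qed
  have "0 \<le> (\<integral>u. poly (f * g) u / (u - x) \<partial>M)"
    by (rule integral_nonneg_AE) (use AE in \<open>eventually_elim, use nn x in \<open>auto intro!: divide_nonneg_nonneg\<close>\<close>)
  also have "\<dots> = poly (sk s (f * g)) x + poly (f * g) x * (\<integral>u. 1 / (u - x) \<partial>M)"
    by (rule integral_div_linear[OF M AE x])
  also have "f * g = [:-x, 1:] * (f * S) + smult (poly g x) f"
    by (subst (1) gS) (simp add: algebra_simps)
  also have "poly (sk s ([:-x, 1:] * (f * S) + smult (poly g x) f)) x = poly g x * poly (sk s f) x"
    using poly_sk_at[of s x "f * S" 0] by (simp add: sk_add sk_smult S0)
  finally show ?thesis by (simp add: algebra_simps)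
qed

definition "\<rho> n x = poly (P n) x / p0 n"

lemma \<rho>_eq: "\<rho> n x = \<sigma> n * poly (D n) x - poly (B n) x"
  using arg_cong[OF P_eq[of n], of "\<lambda>p. poly p x"]
  by (simp add: \<rho>_def q0_eq field_simps)

text \<open>All terms of the sum are nonnegative, and only the one with \<open>k = 0\<close> is
  kept. The result grows linearly in \<open>- \<sigma> n\<close>, so a bound on
  \<open>\<rho>\<close> will bound \<open>\<sigma>\<close> from below.\<close>

lemma \<rho>_ge:
  assumes "x < 0"
  shows "\<rho> n x \<ge> 1 + x * \<sigma> n"
proof -
  have "\<rho> n x = 1 + (\<Sum>k\<le>n. x * (\<sigma> n - \<sigma> k) * (p0 k * poly (P k) x))"
    by (simp add: \<rho>_eq D_def K_def B_def poly_sum q0_eq sum_distrib_left sum_subtractf algebra_simps)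
  moreover have "x * (\<sigma> n - \<sigma> 0) * (p0 0 * poly (P 0) x) \<le> (\<Sum>k\<le>n. x * (\<sigma> n - \<sigma> k) * (p0 k * poly (P k) x))"
  proof (rule member_le_sum)
    fix k assume "k \<in> {..n} - {0}"
    then have "\<sigma> n \<le> \<sigma> k" using decseqD[OF decseq_\<sigma>] by auto
    then have "0 \<le> x * (\<sigma> n - \<sigma> k)" using assms by (intro mult_nonpos_nonpos) auto
    moreover have "0 \<le> p0 k * poly (P k) x" using p0_mult_P_pos[of x k] assms by simp
    ultimately show "0 \<le> x * (\<sigma> n - \<sigma> k) * (p0 k * poly (P k) x)" by (rule mult_nonneg_nonneg)
  qed auto
  ultimately show ?thesis by (simp add: \<sigma>_0 p0_0 P_0)
qed

lemma \<rho>_ge_1: "x < 0 \<Longrightarrow> \<rho> n x \<ge> 1"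
  using \<rho>_ge[of x n] \<sigma>_le_0[of n] by (smt (verit) mult_nonpos_nonpos)

lemma D_le:
  assumes "x < 0"
  shows "- poly (D n) x \<ge> - x * (\<Sum>k\<le>n. (p0 k)\<^sup>2)"
proof -
  have "(\<Sum>k\<le>n. (p0 k)\<^sup>2) \<le> (\<Sum>k\<le>n. p0 k * poly (P k) x)"
  proof (rule sum_mono)
    fix k
    have "(p0 k)\<^sup>2 * 1 \<le> (p0 k)\<^sup>2 * \<rho> k x" using \<rho>_ge_1[OF assms, of k] by (intro mult_left_mono) auto
    then show "(p0 k)\<^sup>2 \<le> p0 k * poly (P k) x" by (simp add: \<rho>_def power2_eq_square)
  qed
  then have "- x * (\<Sum>k\<le>n. (p0 k)\<^sup>2) \<le> - x * (\<Sum>k\<le>n. p0 k * poly (P k) x)"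
    using assms by (intro mult_left_mono) auto
  then show ?thesis by (simp add: D_def K_def poly_sum)
qed

text \<open>Every Stieltjes solution satisfies \<open>- q n / P n \<le> w \<le> - C n / D n\<close> on the negative axis, where
  \<open>w\<close> is its Stieltjes transform; the determinant identity computes the length of this interval.\<close>

lemma transform_gap:
  assumes M: "M \<in> solutions s" "AE u in M. u \<ge> 0" and N: "N \<in> solutions s" "AE u in N. u \<ge> 0"
    and x: "x < 0"
  shows "\<rho> n x * (- poly (D n) x) * ((\<integral>u. 1 / (u - x) \<partial>N) - (\<integral>u. 1 / (u - x) \<partial>M)) \<le> 1"
proof -
  define w1 w2 where w: "w1 = (\<integral>u. 1 / (u - x) \<partial>M)" "w2 = (\<integral>u. 1 / (u - x) \<partial>N)"
  define a b c d where abcd: "a = poly (A n) x" "b = poly (B n) x" "c = poly (C n) x" "d = poly (D n) x"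
  define r where "r = \<rho> n x"
  have det: "a * d - b * c = 1"
    using arg_cong[OF det_AD_BC[of n], of "\<lambda>p. poly p x"] by (simp add: abcd)
  have r: "r = \<sigma> n * d - b" by (simp add: r_def \<rho>_eq abcd)
  have r1: "r \<ge> 1" unfolding r_def by (rule \<rho>_ge_1[OF x])
  have "- x * (\<Sum>k\<le>n. (p0 k)\<^sup>2) \<ge> 0" using x by (intro mult_nonneg_nonneg sum_nonneg) auto
  then have d: "d \<le> 0" using D_le[OF x, of n] by (simp add: abcd)
  have Px: "poly (P n) x = p0 n * r" by (simp add: r_def \<rho>_def)
  have qx: "poly (q n) x = p0 n * (\<sigma> n * c - a)"
    by (subst q_eq) (simp add: abcd q0_eq algebra_simps)
  have "poly (P n) x * (poly (sk s (P n)) x + poly (P n) x * w1) \<ge> 0"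
    unfolding w by (rule nonneg_of_lower_orthogonal[OF M x orthonormal_lower[OF P]]) auto
  then have "(p0 n * p0 n) * (r * ((\<sigma> n * c - a) + r * w1)) \<ge> 0"
    unfolding q_def[symmetric] Px qx by (simp add: algebra_simps)
  moreover have "p0 n * p0 n > 0" by (metis p0_nz mult_neg_neg mult_pos_pos linorder_neqE_linordered_idom)
  ultimately have "r * ((\<sigma> n * c - a) + r * w1) \<ge> 0" by (simp add: zero_le_mult_iff)
  then have 1: "(\<sigma> n * c - a) + r * w1 \<ge> 0" using r1 by (simp add: zero_le_mult_iff)
  have Kx: "poly (K n) x > 0"
    unfolding K_def poly_sum using p0_mult_P_pos[of x] x by (simp add: sum_pos)
  have "poly (K n) x * (poly (sk s (D n)) x + poly (D n) x * w2) \<ge> 0"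
    unfolding w by (rule nonneg_of_lower_orthogonal[OF N x mlin_D_lower degree_K_le])
      (auto simp: D_def mult.assoc)
  then have 2: "c + d * w2 \<ge> 0" using Kx by (simp add: zero_le_mult_iff sk_D abcd)
  \<comment> \<open>The weights \<open>- d\<close> and \<open>r\<close> combine the two inequalities
    so that the terms without \<open>w1\<close>, \<open>w2\<close> form the determinant
    \<open>a d - b c\<close>.\<close>
  have "(- d) * ((\<sigma> n * c - a) + r * w1) + r * (c + d * w2) \<ge> 0"
    using mult_nonneg_nonneg[OF _ 1, of "- d"] mult_nonneg_nonneg[OF _ 2, of r] d r1 by simp
  moreover have "(- d) * ((\<sigma> n * c - a) + r * w1) + r * (c + d * w2) = (a * d - b * c) + r * d * (w2 - w1)"
    unfolding r by (simp add: algebra_simps)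
  ultimately show ?thesis unfolding det w[symmetric] r_def[symmetric] abcd(4)[symmetric] by simp
qed

text \<open>\<open>transform_gap\<close> bounds the product of \<open>\<rho> n x\<close> and
  \<open>- D n(x)\<close> by \<open>1 / \<delta>\<close> for all \<open>n\<close>. Both factors are
  bounded away from 0, so each is bounded: the second controls the sum of the
  \<open>p0\<close>-squares, the first controls \<open>- \<sigma> n\<close>.\<close>

lemma stieltjes_indet_if_transforms_differ:
  assumes M: "M \<in> solutions s" "AE u in M. u \<ge> 0" and N: "N \<in> solutions s" "AE u in N. u \<ge> 0"
    and x: "x < 0" and less: "(\<integral>u. 1 / (u - x) \<partial>M) < (\<integral>u. 1 / (u - x) \<partial>N)"
  shows "stieltjes_indet s P"
proof -
  define \<delta> where "\<delta> = (\<integral>u. 1 / (u - x) \<partial>N) - (\<integral>u. 1 / (u - x) \<partial>M)"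
  have \<delta>: "\<delta> > 0" using less by (simp add: \<delta>_def)
  have gap: "\<rho> n x * (- poly (D n) x) \<le> 1 / \<delta>" for n
    using transform_gap[OF M N x, of n] \<delta> by (simp add: \<delta>_def[symmetric] pos_le_divide_eq)
  have sum1: "(\<Sum>k\<le>n. (p0 k)\<^sup>2) \<ge> 1" for n using k0_ge_1[of n] by (simp add: k0_eq)
  have Dx: "- poly (D n) x \<ge> - x" for n
  proof -
    have "- x * 1 \<le> - x * (\<Sum>k\<le>n. (p0 k)\<^sup>2)" using x sum1[of n] by (intro mult_left_mono) auto
    then show ?thesis using D_le[OF x, of n] by linarith
  qed
  show ?thesis
  proof
    show "summable (\<lambda>n. (p0 n)\<^sup>2)"
    proof (rule summableI_nonneg_bounded)
      fix n
      have "- poly (D n) x * 1 \<le> - poly (D n) x * \<rho> n x"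
        using Dx[of n] x \<rho>_ge_1[OF x, of n] by (intro mult_left_mono) auto
      then have "- x * (\<Sum>k\<le>n. (p0 k)\<^sup>2) \<le> 1 / \<delta>"
        using D_le[OF x, of n] gap[of n] by (simp add: mult.commute)
      then have "(\<Sum>k\<le>n. (p0 k)\<^sup>2) \<le> (1 / \<delta>) / (- x)"
        using x by (subst pos_le_divide_eq) (auto simp: mult.commute)
      moreover have "(\<Sum>k<n. (p0 k)\<^sup>2) \<le> (\<Sum>k\<le>n. (p0 k)\<^sup>2)" by (intro sum_mono2) auto
      ultimately show "(\<Sum>k<n. (p0 k)\<^sup>2) \<le> (1 / \<delta>) / (- x)" by linarith
    qed simp
    show "\<exists>b. \<forall>n. b \<le> \<sigma> n"
    proof (intro exI allI)
      fix n
      have "(1 + x * \<sigma> n) * (- x) \<le> \<rho> n x * (- poly (D n) x)"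
        using \<rho>_ge[OF x, of n] \<rho>_ge_1[OF x, of n] Dx[of n] x by (intro mult_mono) auto
      then have "(1 + x * \<sigma> n) * (- x) \<le> 1 / \<delta>" using gap[of n] by linarith
      then have "(- \<sigma> n) * (x * x) \<le> 1 / \<delta> + x" by (simp add: algebra_simps)
      then have "- \<sigma> n \<le> (1 / \<delta> + x) / (x * x)"
        using x by (subst pos_le_divide_eq) (auto simp: mult_neg_neg)
      then show "- ((1 / \<delta> + x) / (x * x)) \<le> \<sigma> n" by linarith
    qed
  qed
qed

end

lemma stieltjes_indet_if_indet_S:
  assumes "s 0 = 1" "indet_S s"
  shows "\<exists>P. stieltjes_indet s P"
proof -
  obtain M N where M: "M \<in> solutions s" "msupport M \<subseteq> {0..}" and N: "N \<in> solutions s" "msupport N \<subseteq> {0..}"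
    and ne: "M \<noteq> N" using assms(2) unfolding indet_S_def by blast
  have M0: "AE x in M. x \<ge> 0" and N0: "AE x in N. x \<ge> 0"
    using M N solution_nonneg_iff by blast+
  have pd: "posdef s" by (rule posdef_if_solution[OF M(1)])
  interpret stieltjes_seq s "gram_schmidt s"
    by unfold_locales (use assms(1) pd posdef_shift_if_stieltjes[OF M] orthonormal_gram_schmidt[OF pd] in auto)
  have "\<exists>x<0. (\<integral>u. 1 / (u - x) \<partial>M) \<noteq> (\<integral>u. 1 / (u - x) \<partial>N)"
  proof (rule ccontr)
    assume "\<not> ?thesis"
    then have "M = N"
      by (intro stieltjes_transform_unique_neg_axis[OF solutionsD(6)[OF M(1)] solutionsD(6)[OF N(1)]
            solutionsD(1)[OF M(1)] solutionsD(1)[OF N(1)] M0 N0]) auto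
    then show False using ne by simp
  qed
  then obtain x where x: "x < 0" "(\<integral>u. 1 / (u - x) \<partial>M) \<noteq> (\<integral>u. 1 / (u - x) \<partial>N)" by blast
  then show ?thesis
    using stieltjes_indet_if_transforms_differ[OF M(1) M0 N(1) N0 x(1)]
      stieltjes_indet_if_transforms_differ[OF N(1) N0 M(1) M0 x(1)]
    by (metis linorder_neqE_linordered_idom)
qed

section \<open>The measures \<open>x d\<mu>\<close>\<close>

lemma integral_density_linear:
  fixes g :: "real \<Rightarrow> 'b :: {banach, second_countable_topology}"
  assumes M: "M \<in> solutions s" and AE: "AE x in M. x \<ge> 0" and "c > 0"
    and "g \<in> borel_measurable borel"
  shows "(\<integral>x. g x \<partial>density M (\<lambda>x. ennreal (x / c))) = (\<integral>x. (x / c) *\<^sub>R g x \<partial>M)"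
    and "integrable (density M (\<lambda>x. ennreal (x / c))) g \<longleftrightarrow> integrable M (\<lambda>x. (x / c) *\<^sub>R g x)"
proof -
  have g: "g \<in> borel_measurable M" by (rule borel_measurable_eq_borel[OF solutionsD(1)[OF M] assms(4)])
  have l: "(\<lambda>x. x / c) \<in> borel_measurable M"
    by (rule borel_measurable_eq_borel[OF solutionsD(1)[OF M]]) simp
  have nn: "AE x in M. 0 \<le> x / c" using AE by eventually_elim (use \<open>c > 0\<close> in simp)
  show "(\<integral>x. g x \<partial>density M (\<lambda>x. ennreal (x / c))) = (\<integral>x. (x / c) *\<^sub>R g x \<partial>M)"
    by (rule integral_density[OF g l nn])
  show "integrable (density M (\<lambda>x. ennreal (x / c))) g \<longleftrightarrow> integrable M (\<lambda>x. (x / c) *\<^sub>R g x)"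
    by (rule integrable_density[OF g l nn])
qed

text \<open>The divisor covers two uses: \<open>c = 1\<close> for \<open>times_x\<close>, and
  \<open>c = s 1\<close> for its normalization.\<close>

lemma density_linear_solution:
  assumes M: "M \<in> solutions s" and AE: "AE x in M. x \<ge> 0" and c: "c > 0"
  shows "density M (\<lambda>x. ennreal (x / c)) \<in> solutions (\<lambda>n. s (n + 1) / c)"
proof (rule solutionsI)
  have "posdef (\<lambda>n. s (Suc n))"
    using posdef_shift_if_stieltjes[OF M] solution_nonneg_iff[OF M] AE by simp
  then show "posdef (\<lambda>n. s (n + 1) / c)"
    using c unfolding posdef_def mlin_divide by simp
  show "sets (density M (\<lambda>x. ennreal (x / c))) = sets borel"
    by (simp add: solutionsD(1)[OF M])
  fix n
  have eq: "(\<lambda>x. (x / c) *\<^sub>R x ^ n) = (\<lambda>x. x ^ (n + 1) / c)" by (simp add: fun_eq_iff)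
  have m: "(\<lambda>x::real. x ^ n) \<in> borel_measurable borel" by simp
  have int: "integrable M (\<lambda>x. x ^ (n + 1))" by (rule solutionsD(3)[OF M])
  show "integrable (density M (\<lambda>x. ennreal (x / c))) (\<lambda>x. x ^ n)"
    unfolding integral_density_linear(2)[OF M AE c m] eq
    by (rule integrable_divide_zero) (rule int)
  show "(\<integral>x. x ^ n \<partial>density M (\<lambda>x. ennreal (x / c))) = s (n + 1) / c"
    unfolding integral_density_linear(1)[OF M AE c m] eq
    by (simp only: integral_divide_zero solutionsD(4)[OF M])
qed

lemma density_linear_transform:
  assumes M: "M \<in> solutions s" and AE: "AE x in M. x \<ge> 0" and c: "c > 0" and z: "Im z \<noteq> 0"
  shows "(\<integral>x. 1 / (complex_of_real x - z) \<partial>density M (\<lambda>x. ennreal (x / c))) =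
    (of_real (s 0) + z * (\<integral>x. 1 / (complex_of_real x - z) \<partial>M)) / of_real c"
proof -
  have nz: "complex_of_real x - z \<noteq> 0" for x using z by auto
  have m: "(\<lambda>x. 1 / (complex_of_real x - z)) \<in> borel_measurable borel" by simp
  have eq: "(\<lambda>x. (x / c) *\<^sub>R (1 / (complex_of_real x - z))) =
      (\<lambda>x. (of_real 1 + z * (1 / (complex_of_real x - z))) / of_real c)"
  proof
    fix x
    have "complex_of_real x * (1 / (complex_of_real x - z)) = 1 + z * (1 / (complex_of_real x - z))"
      using nz[of x] by (simp add: field_simps)
    moreover have "(x / c) *\<^sub>R (1 / (complex_of_real x - z)) =
        (complex_of_real x * (1 / (complex_of_real x - z))) / of_real c"
      by (simp add: scaleR_conv_of_real mult.commute)
    ultimately show "(x / c) *\<^sub>R (1 / (complex_of_real x - z)) =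
        (of_real 1 + z * (1 / (complex_of_real x - z))) / of_real c"
      by (simp only: of_real_1)
  qed
  have int: "integrable M (\<lambda>x. 1 / (complex_of_real x - z))"
    by (rule integrable_stieltjes_kernel[OF solutionsD(6)[OF M] solutionsD(1)[OF M] z])
  have "integrable M (\<lambda>x. 1 :: real)" using solutionsD(3)[OF M, of 0] by simp
  then have int1: "integrable M (\<lambda>x. complex_of_real 1)" by (rule integrable_of_real)
  have one: "(\<integral>x. complex_of_real 1 \<partial>M) = of_real (s 0)"
    unfolding integral_complex_of_real using solutionsD(4)[OF M, of 0] by simp
  show ?thesis
    unfolding integral_density_linear(1)[OF M AE c m] eq integral_divide_zero
    by (subst Bochner_Integration.integral_add[OF int1 integrable_mult_right[OF int]])
      (simp only: one integral_mult_right_zero)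
qed

lemma scale_density_linear:
  assumes "sets M = sets borel" "c > 0"
  shows "scale_measure (ennreal c) (density M (\<lambda>x. ennreal (x / c))) = times_x M"
proof -
  have m: "(\<lambda>x. ennreal (x / c)) \<in> borel_measurable M"
    by (rule borel_measurable_eq_borel[OF assms(1)]) simp
  show ?thesis unfolding times_x_def
  proof (rule measure_eqI)
    fix A assume "A \<in> sets (scale_measure (ennreal c) (density M (\<lambda>x. ennreal (x / c))))"
    then have A: "A \<in> sets M" by simp
    have m': "(\<lambda>x. ennreal x) \<in> borel_measurable M"
      by (rule borel_measurable_eq_borel[OF assms(1)]) simp
    have "emeasure (scale_measure (ennreal c) (density M (\<lambda>x. ennreal (x / c)))) A =
        ennreal c * (\<integral>\<^sup>+x. ennreal (x / c) * indicator A x \<partial>M)"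
      using A by (simp add: emeasure_density[OF m])
    also have "\<dots> = (\<integral>\<^sup>+x. ennreal c * (ennreal (x / c) * indicator A x) \<partial>M)"
      by (intro nn_integral_cmult[symmetric] borel_measurable_times_ennreal[OF m] borel_measurable_indicator A)
    also have "\<dots> = (\<integral>\<^sup>+x. ennreal x * indicator A x \<partial>M)"
      using assms(2) by (simp add: mult.assoc[symmetric] ennreal_mult'[symmetric])
    also have "\<dots> = emeasure (density M (\<lambda>x. ennreal x)) A"
      by (rule emeasure_density[OF m' A, symmetric])
    finally show "emeasure (scale_measure (ennreal c) (density M (\<lambda>x. ennreal (x / c)))) A =
      emeasure (density M (\<lambda>x. ennreal x)) A" .
  qed simp
qed

lemma times_x_eq: "times_x M = density M (\<lambda>x. ennreal (x / 1))"
  by (simp add: times_x_def)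

lemma times_x_solution:
  assumes "M \<in> solutions s" "AE x in M. x \<ge> 0"
  shows "times_x M \<in> solutions (\<lambda>n. s (n + 1))"
  using density_linear_solution[OF assms, of 1] unfolding times_x_eq by simp

lemma times_x_nonneg:
  assumes "M \<in> solutions s"
  shows "AE x in times_x M. x \<ge> 0"
proof -
  have "(\<lambda>x. ennreal x) \<in> borel_measurable M"
    by (rule borel_measurable_eq_borel[OF solutionsD(1)[OF assms]]) simp
  then show ?thesis unfolding times_x_def
    by (subst AE_density) (auto intro!: AE_I2 simp: not_less)
qed

lemma times_x_transform:
  assumes "M \<in> solutions s" "AE x in M. x \<ge> 0" "Im z \<noteq> 0"
  shows "(\<integral>x. 1 / (complex_of_real x - z) \<partial>times_x M) =
    of_real (s 0) + z * (\<integral>x. 1 / (complex_of_real x - z) \<partial>M)"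
  using density_linear_transform[OF assms(1,2) zero_less_one assms(3)] unfolding times_x_eq by simp

text \<open>Distinct solutions stay distinct: mass at 0 is lost in \<open>times_x\<close>, but
  \<open>s 0 + z G(z)\<close> determines the transform \<open>G\<close> off the real axis, since
  \<open>s 0\<close> is common to all solutions.\<close>

lemma shift_indeterminate:
  assumes "indet_S s"
  shows "indeterminate (\<lambda>n. s (n + 1))" "stieltjes (\<lambda>n. s (n + 1))"
proof -
  obtain M N where M: "M \<in> solutions s" "msupport M \<subseteq> {0..}" and N: "N \<in> solutions s" "msupport N \<subseteq> {0..}"
    and ne: "M \<noteq> N" using assms unfolding indet_S_def by blast
  have M0: "AE x in M. x \<ge> 0" and N0: "AE x in N. x \<ge> 0"
    using M N solution_nonneg_iff by blast+
  note sM = times_x_solution[OF M(1) M0] and sN = times_x_solution[OF N(1) N0]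
  have "times_x M \<noteq> times_x N"
  proof
    assume eq: "times_x M = times_x N"
    have "M = N"
    proof (rule solutions_eqI[OF M(1) N(1)])
      fix z :: complex assume z: "Im z \<noteq> 0"
      then have "z \<noteq> 0" by auto
      then show "(\<integral>x. 1 / (complex_of_real x - z) \<partial>M) = (\<integral>x. 1 / (complex_of_real x - z) \<partial>N)"
        using times_x_transform[OF M(1) M0 z] times_x_transform[OF N(1) N0 z] unfolding eq by simp
    qed
    then show False using ne by simp
  qed
  then show "indeterminate (\<lambda>n. s (n + 1))"
    unfolding indeterminate_def using sM sN by (intro bexI[OF _ sM]) auto
  show "stieltjes (\<lambda>n. s (n + 1))"
    unfolding stieltjes_def using times_x_nonneg[OF M(1)] solution_nonneg_iff[OF sM]
    by (intro bexI[OF _ sM]) simp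
qed

section \<open>Parameters of the measures \<open>x d\<mu>\<close> for the shifted sequence\<close>

context stieltjes_indet
begin

lemma s'_eq: "s' = (\<lambda>n. s (n + 1) / s 1)"
  by (simp add: fun_eq_iff s'_def)

lemma normalize_shift: "normalize_seq (\<lambda>n. s (n + 1)) = s'"
  by (simp add: fun_eq_iff s'_def normalize_seq_def)

text \<open>The quotients for \<^term>\<open>s'\<close> are linear fractional images of the pairs \<open>(U, D/z)\<close>, \<open>(X, Y)\<close>; the parameter
  \<open>1 / s 1\<close> corresponds to \<open>(e, h) = (1, 0)\<close> and the Friedrichs parameter of \<^term>\<open>s'\<close> to \<open>e = 0\<close>.\<close>

lemma shift_quotient:
  assumes z: "Im z \<noteq> 0"
  defines "U \<equiv> Binf z + of_real F * Dinf z" and "X \<equiv> z * (Ainf z + of_real F * Cinf z) - (Binf z + of_real F * Dinf z)"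
    and "Y \<equiv> Cinf z - Dinf z / z"
  shows "e = 1 + (s 1 * t - 1) * Kinf \<Longrightarrow> h = s 1 * t - 1 \<Longrightarrow>
      nev_quotient s' (ereal t) z =
        - ((of_real e * X + of_real h * Y) / (of_real (s 1) * (of_real e * U + of_real h * (Dinf z / z)))) \<and>
      of_real e * U + of_real h * (Dinf z / z) \<noteq> 0"
    and "nev_quotient s' \<infinity> z =
        - ((of_real Kinf * X + of_real 1 * Y) / (of_real (s 1) * (of_real Kinf * U + of_real 1 * (Dinf z / z)))) \<and>
      of_real Kinf * U + of_real 1 * (Dinf z / z) \<noteq> 0"
proof -
  interpret T: stieltjes_indet s' P' by (rule stieltjes_indet_shift)
  have "z \<noteq> 0" using z by auto
  note inf = shift_inf[OF this, folded U_def]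
  have s1: "complex_of_real (s 1) \<noteq> 0" using s1_pos by simp
  have C: "T.Cinf z = of_real Kinf * X + Y"
    unfolding inf X_def Y_def U_def by simp
  have A: "T.Ainf z = (X - of_real Kinf * X - Y) / of_real (s 1)"
    unfolding inf X_def Y_def U_def by simp
  have D: "T.Dinf z = of_real (s 1) * (of_real Kinf * U + Dinf z / z)" by (rule inf(1))
  have B: "T.Binf z = U - of_real Kinf * U - Dinf z / z" by (rule inf(2))
  show "nev_quotient s' \<infinity> z =
        - ((of_real Kinf * X + of_real 1 * Y) / (of_real (s 1) * (of_real Kinf * U + of_real 1 * (Dinf z / z)))) \<and>
      of_real Kinf * U + of_real 1 * (Dinf z / z) \<noteq> 0"
    using T.mu_infinity(3)[OF z] unfolding nev_quotient_def T.nev_eqs C D by simp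
  assume e: "e = 1 + (s 1 * t - 1) * Kinf" and h: "h = s 1 * t - 1"
  have den: "T.Binf z + of_real t * T.Dinf z = of_real e * U + of_real h * (Dinf z / z)"
    unfolding B D e h by (simp add: algebra_simps)
  have num: "T.Ainf z + of_real t * T.Cinf z = (of_real e * X + of_real h * Y) / of_real (s 1)"
  proof -
    have "T.Ainf z + of_real t * T.Cinf z =
        ((X - of_real Kinf * X - Y) + of_real (s 1) * of_real t * (of_real Kinf * X + Y)) / of_real (s 1)"
      unfolding A C using s1 by (simp add: add_divide_distrib)
    also have "(X - of_real Kinf * X - Y) + of_real (s 1) * of_real t * (of_real Kinf * X + Y) = of_real e * X + of_real h * Y"
      unfolding e h by (simp add: algebra_simps)
    finally show ?thesis .
  qed
  show "nev_quotient s' (ereal t) z =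
        - ((of_real e * X + of_real h * Y) / (of_real (s 1) * (of_real e * U + of_real h * (Dinf z / z)))) \<and>
      of_real e * U + of_real h * (Dinf z / z) \<noteq> 0"
    using T.mu_real(3)[OF z, of t] unfolding nev_quotient_def T.nev_eqs ereal.case den num by simp
qed

lemma times_x_mu_eq:
  assumes "mu s t \<in> solutions s" "AE x in mu s t. x \<ge> 0"
    and "\<And>z. Im z \<noteq> 0 \<Longrightarrow> (1 + z * (\<integral>x. 1 / (complex_of_real x - z) \<partial>mu s t)) / of_real (s 1) = nev_quotient s' t' z"
  shows "times_x (mu s t) = scale_measure (ennreal (s 1)) (mu s' t')"
proof -
  have "mu s' t' = density (mu s t) (\<lambda>x. ennreal (x / s 1))"
  proof (rule mu_eqI)
    show "density (mu s t) (\<lambda>x. ennreal (x / s 1)) \<in> solutions s'"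
      unfolding s'_eq by (rule density_linear_solution[OF assms(1,2) s1_pos])
    show "(\<integral>x. 1 / (complex_of_real x - z) \<partial>density (mu s t) (\<lambda>x. ennreal (x / s 1))) = nev_quotient s' t' z"
      if z: "Im z \<noteq> 0" for z
      using density_linear_transform[OF assms(1,2) s1_pos z] assms(3)[OF z] by (simp only: s0 of_real_1)
  qed
  then show ?thesis
    using scale_density_linear[OF solutionsD(1)[OF assms(1)] s1_pos] by simp
qed

lemma times_x_mu_F:
  "times_x (mu s (ereal F)) = scale_measure (ennreal (s 1)) (mu s' (ereal (1 / s 1)))"
proof (rule times_x_mu_eq[OF mu_real(1) mu_real(4)[OF order.refl]])
  fix z :: complex assume z: "Im z \<noteq> 0"
  have U: "Binf z + of_real F * Dinf z \<noteq> 0" by (rule mu_real(3)[OF z])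
  have frac: "(1 + z * - (w / u)) / c = - ((z * w - u) / (c * u))" if "u \<noteq> 0" for w u c
  proof -
    have "1 + z * - (w / u) = - ((z * w - u) / u)" using that by (simp add: diff_divide_distrib)
    then show ?thesis by (simp add: mult.commute)
  qed
  have eh: "(1 :: real) = 1 + (s 1 * (1 / s 1) - 1) * Kinf" "0 = s 1 * (1 / s 1) - 1" using s1_pos by simp_all
  show "(1 + z * (\<integral>x. 1 / (complex_of_real x - z) \<partial>mu s (ereal F))) / of_real (s 1) =
      nev_quotient s' (ereal (1 / s 1)) z"
    unfolding conjunct1[OF shift_quotient(1)[OF z eh]] mu_real(2)[OF z]
      of_real_1 of_real_0 mult_1_left mult_zero_left add_0_right
    by (rule frac[OF U])
qed

text \<open>The limit in \<open>shift_\<sigma>\<close>. It is strictly less than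
  \<open>1 / s 1\<close>, so the Friedrichs and Krein solutions of \<open>s\<close> lead to
  different parameters for \<open>s'\<close>.\<close>

lemma shift_F: "stieltjes_indet.F s' P' = (Kinf - 1) / (s 1 * Kinf)"
proof -
  interpret T: stieltjes_indet s' P' by (rule stieltjes_indet_shift)
  have lim: "T.\<sigma> \<longlonglongrightarrow> (1 - Kinf) / (s 1 * Kinf)"
    unfolding shift_\<sigma> using Kinf_gt_1 s1_pos by (intro tendsto_intros k0_tendsto) auto
  have "- T.F = (1 - Kinf) / (s 1 * Kinf)" by (rule LIMSEQ_unique[OF T.\<sigma>_tendsto lim])
  then have "T.F = - ((1 - Kinf) / (s 1 * Kinf))" by linarith
  then show ?thesis by (simp only: minus_divide_left minus_diff_eq)
qed

lemma times_x_mu_infinity: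
  "times_x (mu s \<infinity>) = scale_measure (ennreal (s 1)) (mu s' (friedrichs_param s'))"
proof (rule times_x_mu_eq[OF mu_infinity(1) mu_infinity(4)])
  interpret T: stieltjes_indet s' P' by (rule stieltjes_indet_shift)
  fix z :: complex assume z: "Im z \<noteq> 0"
  then have z0: "z \<noteq> 0" by auto
  have D: "Dinf z \<noteq> 0" by (rule mu_infinity(3)[OF z])
  have K: "Kinf > 0" using Kinf_gt_1 by simp
  \<comment> \<open>The parameter \<open>F(s')\<close> makes \<open>e = 0\<close> and leaves the
    non-zero \<open>h = - 1 / Kinf\<close>, which cancels from the quotient; only \<open>Y\<close>
    and \<open>Dinf z / z\<close> remain.\<close>
  have h: "- 1 / Kinf = s 1 * ((Kinf - 1) / (s 1 * Kinf)) - 1"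
    using K s1_pos by (simp add: field_simps)
  have e: "0 = 1 + (s 1 * ((Kinf - 1) / (s 1 * Kinf)) - 1) * Kinf"
    unfolding h[symmetric] using K by simp
  have K0: "complex_of_real (- 1 / Kinf) \<noteq> 0" using K by simp
  have "nev_quotient s' (friedrichs_param s') z = - ((of_real (- 1 / Kinf) * (Cinf z - Dinf z / z)) /
      (of_real (s 1) * (of_real (- 1 / Kinf) * (Dinf z / z))))"
    unfolding T.friedrichs_param_eq shift_F conjunct1[OF shift_quotient(1)[OF z e h]] by simp
  also have "\<dots> = - ((Cinf z - Dinf z / z) / (of_real (s 1) * (Dinf z / z)))"
    unfolding mult.left_commute[of "of_real (s 1)" "of_real (- 1 / Kinf)"]
    by (subst mult_divide_mult_cancel_left[OF K0]) (rule refl)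
  also have "\<dots> = (1 + z * (- (Cinf z / Dinf z))) / of_real (s 1)"
    using D z0 s1_pos by (simp add: field_simps)
  finally show "(1 + z * (\<integral>x. 1 / (complex_of_real x - z) \<partial>mu s \<infinity>)) / of_real (s 1) =
      nev_quotient s' (friedrichs_param s') z"
    unfolding mu_infinity(2)[OF z] by (rule sym)
qed

text \<open>Up to the common factor \<open>- 1 / s 1\<close> the two transforms are quotients of
  combinations of the pairs \<open>(X, U)\<close> and \<open>(z Y, Dinf z)\<close>, with
  coefficients \<open>(e, h / z)\<close> and \<open>(1, \<delta>)\<close>. The pairs are
  independent, so equality forces \<open>h = e \<delta> z\<close>, impossible for real
  \<open>e\<close>, \<open>h\<close> not both 0 at a non-real \<open>z\<close>, as
  \<open>\<delta> > 0\<close>.\<close>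

lemma times_x_mu_not_extremal:
  assumes t: "F < t" and t': "t' \<noteq> -\<infinity>"
  shows "times_x (mu s (ereal t)) \<noteq> scale_measure (ennreal (s 1)) (mu s' t')"
proof
  interpret T: stieltjes_indet s' P' by (rule stieltjes_indet_shift)
  assume eq: "times_x (mu s (ereal t)) = scale_measure (ennreal (s 1)) (mu s' t')"
  note M = mu_real(1)[of t] mu_real(4)[OF less_imp_le[OF t]]
  define z where "z = \<i>"
  have z: "Im z \<noteq> 0" "z \<noteq> 0" by (simp_all add: z_def)
  define U X Y G where "U = Binf z + of_real F * Dinf z"
    and "X = z * (Ainf z + of_real F * Cinf z) - (Binf z + of_real F * Dinf z)"
    and "Y = Cinf z - Dinf z / z"
    and "G = (\<integral>x. 1 / (complex_of_real x - z) \<partial>mu s (ereal t))"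
  note defs = this
  obtain e h :: real where eh: "e \<noteq> 0 \<or> h \<noteq> 0"
    and quot: "nev_quotient s' t' z =
        - ((of_real e * X + of_real h * Y) / (of_real (s 1) * (of_real e * U + of_real h * (Dinf z / z))))"
    and den: "of_real e * U + of_real h * (Dinf z / z) \<noteq> 0"
    and tr: "(\<integral>x. 1 / (complex_of_real x - z) \<partial>mu s' t') = nev_quotient s' t' z"
  proof (cases t')
    case (real r)
    show ?thesis
    proof (rule that)
      let ?h = "s 1 * r - 1" and ?e = "1 + (s 1 * r - 1) * Kinf"
      show "?e \<noteq> 0 \<or> ?h \<noteq> 0" by (cases "?h = 0") auto
      show "nev_quotient s' t' z =
        - ((of_real ?e * X + of_real ?h * Y) / (of_real (s 1) * (of_real ?e * U + of_real ?h * (Dinf z / z))))"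
        unfolding real defs by (rule conjunct1[OF shift_quotient(1)[OF z(1) refl refl]])
      show "of_real ?e * U + of_real ?h * (Dinf z / z) \<noteq> 0"
        unfolding defs by (rule conjunct2[OF shift_quotient(1)[OF z(1) refl refl]])
      show "(\<integral>x. 1 / (complex_of_real x - z) \<partial>mu s' t') = nev_quotient s' t' z"
        unfolding real T.mu_real(2)[OF z(1)] by (simp add: nev_quotient_def T.nev_eqs)
    qed
  next
    case PInf
    show ?thesis
    proof (rule that)
      show "Kinf \<noteq> 0 \<or> (1::real) \<noteq> 0" by simp
      show "nev_quotient s' t' z =
        - ((of_real Kinf * X + of_real 1 * Y) / (of_real (s 1) * (of_real Kinf * U + of_real 1 * (Dinf z / z))))"
        unfolding PInf defs by (rule conjunct1[OF shift_quotient(2)[OF z(1)]])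
      show "of_real Kinf * U + of_real 1 * (Dinf z / z) \<noteq> 0"
        unfolding defs by (rule conjunct2[OF shift_quotient(2)[OF z(1)]])
      show "(\<integral>x. 1 / (complex_of_real x - z) \<partial>mu s' t') = nev_quotient s' t' z"
        unfolding PInf T.mu_infinity(2)[OF z(1)] by (simp add: nev_quotient_def T.nev_eqs)
    qed
  qed (use t' in simp)
  have "scale_measure (ennreal (s 1)) (mu s' t') = scale_measure (ennreal (s 1)) (density (mu s (ereal t)) (\<lambda>x. ennreal (x / s 1)))"
    using eq scale_density_linear[OF solutionsD(1)[OF M(1)] s1_pos] by simp
  then have "scale_measure (ennreal (1 / s 1)) (scale_measure (ennreal (s 1)) (mu s' t')) =
      scale_measure (ennreal (1 / s 1)) (scale_measure (ennreal (s 1)) (density (mu s (ereal t)) (\<lambda>x. ennreal (x / s 1))))"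
    by simp
  then have "mu s' t' = density (mu s (ereal t)) (\<lambda>x. ennreal (x / s 1))"
    using s1_pos by (simp add: scale_scale_measure ennreal_mult[symmetric])
  then have "nev_quotient s' t' z = (1 + z * G) / of_real (s 1)"
    using tr density_linear_transform[OF M s1_pos z(1)] by (simp add: s0 G_def)
  then have main: "- ((of_real e * X + of_real h * Y) / (of_real (s 1) * (of_real e * U + of_real h * (Dinf z / z)))) =
      (1 + z * G) / of_real (s 1)"
    using quot by simp
  define \<delta> where "\<delta> = t - F"
  have V: "Binf z + of_real t * Dinf z = U + of_real \<delta> * Dinf z"
    by (simp add: U_def \<delta>_def algebra_simps)
  have Vnz: "U + of_real \<delta> * Dinf z \<noteq> 0" using mu_real(3)[OF z(1), of t] unfolding V .
  have G: "1 + z * G = - ((X + of_real \<delta> * (z * Y)) / (U + of_real \<delta> * Dinf z))"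
  proof -
    have "G = - ((Ainf z + of_real t * Cinf z) / (U + of_real \<delta> * Dinf z))"
      unfolding G_def mu_real(2)[OF z(1)] V ..
    then have "G * (U + of_real \<delta> * Dinf z) = - (Ainf z + of_real t * Cinf z)"
      using Vnz by simp
    then have "(1 + z * G) * (U + of_real \<delta> * Dinf z) = (U + of_real \<delta> * Dinf z) - z * (Ainf z + of_real t * Cinf z)"
      by (simp only: distrib_right mult_1_left mult.assoc) (simp only: mult_minus_right diff_conv_add_uminus)
    also have "\<dots> = - (X + of_real \<delta> * (z * Y))"
      using z(2) by (simp add: U_def X_def Y_def \<delta>_def algebra_simps)
    finally show ?thesis using Vnz by (simp add: field_simps)
  qed
  have "(of_real e * X + of_real h * Y) / (of_real e * U + of_real h * (Dinf z / z)) =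
      (X + of_real \<delta> * (z * Y)) / (U + of_real \<delta> * Dinf z)"
  proof -
    have canc: "a / b = c / d" if "- (a / (u * b)) = - (c / d) / u" "u \<noteq> 0" for a b c d u :: complex
    proof -
      have "- (a / b) / u = - (c / d) / u"
        using that(1) by (simp add: mult.commute)
      then show ?thesis using that(2) by (simp only: divide_cancel_right neg_equal_iff_equal) simp
    qed
    have "complex_of_real (s 1) \<noteq> 0" using s1_pos by simp
    then show ?thesis by (rule canc[OF main[unfolded G]])
  qed
  then have cross: "(of_real e * X + of_real h * Y) * (U + of_real \<delta> * Dinf z) =
      (X + of_real \<delta> * (z * Y)) * (of_real e * U + of_real h * (Dinf z / z))"
    by (rule iffD1[OF frac_eq_eq[OF den Vnz]])
  have det: "X * Dinf z - z * Y * U = z"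
  proof -
    have "X * Dinf z - z * Y * U = z * (Ainf z * Dinf z - Binf z * Cinf z)"
      using z(2) by (simp add: X_def Y_def U_def algebra_simps)
    then show ?thesis by (simp add: det_inf)
  qed
  \<comment> \<open>Multiplicativity of determinants: up to the factor \<open>z\<close>, the
    difference of the two sides of \<open>cross\<close> is the determinant of the coefficients times
    that of the pairs.\<close>
  have "(of_real e * of_real \<delta> * z - of_real h) * (X * Dinf z - z * Y * U) = 0"
  proof -
    have ring: "(a * r * z - b) * (X * d - z * Y * U) =
        z * ((a * X + b * Y) * (U + r * d) - (X + r * (z * Y)) * (a * U + b * E))"
      if "d = z * E" for a b r d E
      unfolding that by (simp add: algebra_simps)
    have "Dinf z = z * (Dinf z / z)" using z(2) by simp
    from ring[OF this, of "of_real e" "of_real \<delta>" "of_real h"] show ?thesis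
      unfolding cross by (simp only: diff_self mult_zero_right)
  qed
  then have "of_real e * of_real \<delta> * z - complex_of_real h = 0" unfolding det using z(2) by (simp only: mult_eq_0_iff simp_thms)
  \<comment> \<open>Imaginary and real part at \<open>z = \<i>\<close>.\<close>
  then have "e * \<delta> = 0" "h = 0" by (auto simp: z_def complex_eq_iff)
  then show False using eh t by (simp add: \<delta>_def)
qed

end

theorem corollary3p5:
  fixes s :: "nat \<Rightarrow> real"
  assumes "s 0 = 1" and "indet_S s"
  shows "(\<forall>t. friedrichs_param s \<le> t \<and> t \<le> \<infinity> \<longrightarrow> times_x (mu s t) \<in> solutions (\<lambda>n. s (n + 1)))
    \<and> N_extremal_solution (\<lambda>n. s (n + 1)) (times_x (mu s (friedrichs_param s)))
    \<and> krein_solution s (mu s \<infinity>)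
    \<and> friedrichs_solution (\<lambda>n. s (n + 1)) (times_x (mu s \<infinity>))
    \<and> (\<forall>t. friedrichs_param s < t \<and> t < \<infinity> \<longrightarrow>
         times_x (mu s t) \<in> solutions (\<lambda>n. s (n + 1)) \<and>
         \<not> N_extremal_solution (\<lambda>n. s (n + 1)) (times_x (mu s t)))"
proof -
  obtain P where "stieltjes_indet s P" using stieltjes_indet_if_indet_S[OF assms] by blast
  then interpret stieltjes_indet s P .
  have sol: "times_x (mu s t) \<in> solutions (\<lambda>n. s (n + 1))" if "friedrichs_param s \<le> t" for t
  proof (cases t)
    case (real r)
    then have "F \<le> r" using that by (simp add: friedrichs_param_eq)
    then show ?thesis unfolding real by (intro times_x_solution mu_real)
  next
    case PInf
    show ?thesis unfolding PInf by (rule times_x_solution[OF mu_infinity(1,4)])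
  qed (use that in \<open>simp add: friedrichs_param_eq\<close>)
  have ext: "N_extremal_solution (\<lambda>n. s (n + 1)) (times_x (mu s (friedrichs_param s)))"
    unfolding N_extremal_solution_def normalize_shift friedrichs_param_eq
    using shift_indeterminate[OF assms(2)] times_x_mu_F
    by (intro conjI exI[of _ "ereal (1 / s 1)"]) simp_all
  have "normalize_seq s = s" using assms(1) by (simp add: fun_eq_iff normalize_seq_def)
  then have krein: "krein_solution s (mu s \<infinity>)"
    using assms by (simp add: krein_solution_def indet_S_def)
  have fried: "friedrichs_solution (\<lambda>n. s (n + 1)) (times_x (mu s \<infinity>))"
    unfolding friedrichs_solution_def normalize_shift
    using shift_indeterminate[OF assms(2)] times_x_mu_infinity by simp
  have "\<not> N_extremal_solution (\<lambda>n. s (n + 1)) (times_x (mu s t))"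
    if t: "friedrichs_param s < t" "t < \<infinity>" for t
  proof -
    obtain r where r: "t = ereal r" "F < r"
      using t by (cases t) (auto simp: friedrichs_param_eq)
    then show ?thesis
      unfolding N_extremal_solution_def normalize_shift
      using times_x_mu_not_extremal[OF r(2)] by auto
  qed
  then show ?thesis using sol ext krein fried by (simp add: less_imp_le)
qed

end
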